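(* Let $F$ be a locally convex Souslin topological vector space equipped with its Borel $\sigma$-algebra $\mathcal F$. Let $X$ be an $F$-valued random variable and let $L:F\to C^\alpha(S^1)$ be a continuous mapping for some $\alpha>1$. Let $$\varepsilon=\sum_{k\in\mathbf Z}\varepsilon_ke^{ikt}$$ be an $H^{-1}(S^1)$-valued random variable, statistically independent from $X$, such that all $\varepsilon_k$, $k\in\mathbf Z$, are mutually statistically independent random variables with probability density functions $$\rho_k(t)=\frac1{2b}e^{-|t|/b}$$ with respect to the Lebesgue measure for some $b>0$. Then the solution of the statistical inverse problem of estimating the distribution of $X$ given a sample $y\in H^{-1}(S^1)$ of $Y=L(X)+\varepsilon$ is essentially unique and has a version $\mu$ such that $$\mu(U,y)=\frac{\int_Ue^{b^{-1}\sum_{k=-\infty}^\infty(|\widehat y_k|-|\widehat y_k-\widehat{L(x)}_k|)}\,d\mu_X(x)}{\int_Fe^{b^{-1}\sum_{k=-\infty}^\infty(|\widehat y_k|-|\widehat y_k-\widehat{L(x)}_k|)}\,d\mu_X(x)}$$ for all $U\in\mathcal F$ and for all $y\in H^{-1}(S^1)$ such that the denominator is finite and non-zero.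
   Context: A Souslin space is a Hausdorff topological space that is the image of a complete separable metric space under a continuous mapping. Random variables are defined on a complete probability space $(\Omega,\Sigma,P)$; $\mu_V=P\circ V^{-1}$ denotes the image measure of a random variable $V$. $S^1$ is the circle, parametrized by $t\in[0,2\pi)$. For a function $g$ on $S^1$, $\widehat g_k=\frac1{2\pi}\int_0^{2\pi}g(t)e^{-ikt}\,dt$ are its Fourier coefficients; for $y\in H^{-1}(S^1)$, $\widehat y_k=\langle y,e^{-ikt}\rangle_{H^{-1}(S^1),H^1(S^1)}$ with the duality normalized consistently, so that $\widehat\varepsilon_k=\varepsilon_k$. With $G=H^{-1}(S^1)$ and $\mathcal G$ its Borel $\sigma$-algebra, a solution of the statistical inverse problem of estimating the distribution of $X$ given $Y$ is a mapping $\mu:\mathcal F\times G\to[0,1]$ such that (1) $\mu(U,Y(\omega))=\mathbf E[1_U(X)|Y^{-1}(\mathcal G)](\omega)$ $P$-a.s. for every $U\in\mathcal F$; (2) $y\mapsto\mu(U,y)$ is $\mu_Y$-measurable (measurable with respect to the $\mu_Y$-completion of $\mathcal G$) for every $U\in\mathcal F$; (3) $\mu(\cdot,y)$ is a probability measure on $(F,\mathcal F)$ for every $y\in G$. It is essentially unique if any other solution agrees with it on $\mathcal F\times C$ for some $C$ in the $\mu_Y$-completion of $\mathcal G$ with $\mu_Y(C)=1$; "has a version" means that there is a solution of the displayed form.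
   Formalization: Added assumption: almost surely all Fourier coefficients of L(X) are real. Without it the claim fails: for F=R, X=±1, L(x)=ix and real ε_k, the imaginary part of the zeroth coefficient of Y reveals X, while the formula gives both values positive mass. *)

theory Defs
  imports "HOL-Probability.Probability"
begin

section \<open>Souslin spaces and locally convex spaces\<close>

text \<open>The existential quantifier over complete separable metric spaces ranges over metrics whose
  carrier is a set of real numbers. This is no restriction, because a separable metric space has
  at most continuum many points; see \<open>souslin_spaceI\<close> below.\<close>

definition souslin_space :: "'a topology \<Rightarrow> bool" where
  "souslin_space T \<longleftrightarrow> Hausdorff_space T \<and>
     (\<exists>(m :: real metric) \<phi>. mcomplete_of m \<and> separable_space (mtopology_of m) \<and>
        continuous_map (mtopology_of m) T \<phi> \<and> \<phi> ` mspace m = topspace T)"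

lemma separable_metric_inj_real:
  fixes m :: "'p metric"
  assumes "separable_space (mtopology_of m)"
  shows "\<exists>g :: 'p \<Rightarrow> real. inj_on g (mspace m)"
proof (cases "mspace m = {}")
  case False
  interpret Metric_space "mspace m" "mdist m" by simp
  have top: "mtopology_of m = mtopology" by (simp add: mtopology_of_def)
  obtain C where C: "countable C" "C \<subseteq> mspace m" "mtopology closure_of C = mspace m"
    using assms unfolding separable_space_def top by auto
  have "C \<noteq> {}" using C(3) False by auto
  define h where "h x = {prod_encode (n, j) | n j. mdist m (from_nat_into C n) x < 1 / real (Suc j)}" for x
  have "inj_on h (mspace m)"
  proof (rule inj_onI, rule ccontr)
    fix x y assume xy: "x \<in> mspace m" "y \<in> mspace m" "h x = h y" "x \<noteq> y"
    then have "0 < mdist m x y" by simp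
    then obtain j where j: "1 / real (Suc j) < mdist m x y / 2"
      using reals_Archimedean[of "mdist m x y / 2"] by (auto simp: inverse_eq_divide)
    have "x \<in> mtopology closure_of C" using C xy by simp
    then obtain c where c: "c \<in> C" "mdist m x c < 1 / real (Suc j)"
      unfolding metric_closure_of using j
      by (smt (verit) in_mball mem_Collect_eq of_nat_0_less_iff zero_less_Suc zero_less_divide_1_iff)
    obtain n where n: "c = from_nat_into C n"
      using c(1) C(1) by (metis from_nat_into_to_nat_on)
    have "prod_encode (n, j) \<in> h x" using c n by (auto simp: h_def commute)
    then have "prod_encode (n, j) \<in> h y" using xy by simp
    then have "mdist m c y < 1 / real (Suc j)" using n by (auto simp: h_def)
    moreover have "mdist m x y \<le> mdist m x c + mdist m c y"
      using triangle xy c C(2) by blast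
    ultimately show False using c(2) j by linarith
  qed
  moreover obtain k :: "nat set \<Rightarrow> real" where "inj k"
    using nat_sets_eqpoll_reals by (auto simp: eqpoll_def bij_betw_def)
  ultimately have "inj_on (k \<circ> h) (mspace m)"
    by (meson comp_inj_on inj_on_subset subset_UNIV)
  then show ?thesis by blast
qed auto

lemma souslin_spaceI:
  fixes m :: "'p metric"
  assumes haus: "Hausdorff_space T"
    and compl: "mcomplete_of m" and sep: "separable_space (mtopology_of m)"
    and cont: "continuous_map (mtopology_of m) T \<phi>" and onto: "\<phi> ` mspace m = topspace T"
  shows "souslin_space T"
proof -
  obtain g :: "'p \<Rightarrow> real" where g: "inj_on g (mspace m)"
    using separable_metric_inj_real[OF sep] by blast
  define h where "h = inv_into (mspace m) g"
  define N where "N = g ` mspace m"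
  define d where "d a b = (if a \<in> N \<and> b \<in> N then mdist m (h a) (h b) else 0)" for a b
  have hg: "h (g x) = x" if "x \<in> mspace m" for x using g that by (simp add: h_def)
  have gh: "g (h a) = a" and hN: "h a \<in> mspace m" if "a \<in> N" for a
    using that unfolding N_def h_def by (auto simp: f_inv_into_f inv_into_into)
  interpret A: Metric_space "mspace m" "mdist m" by simp
  interpret B: Metric_space N d
  proof
    fix x y assume "x \<in> N" "y \<in> N" then show "(d x y = 0) = (x = y)"
      using gh hN by (metis A.zero d_def)
  qed (auto simp: d_def A.commute intro: A.triangle hN)
  have hc: "continuous_map B.mtopology A.mtopology h"
    unfolding B.metric_continuous_map[OF A.Metric_space_axioms]
    by (auto simp: d_def hN)
  have gc: "continuous_map A.mtopology B.mtopology g"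
    unfolding A.metric_continuous_map[OF B.Metric_space_axioms]
    by (auto simp: d_def hg N_def)
  have sepB: "separable_space B.mtopology"
  proof (rule separable_space_continuous_map_image[OF _ gc])
    show "separable_space A.mtopology" using sep by (simp add: mtopology_of_def)
  qed (simp flip: N_def)
  have complB: "B.mcomplete"
    unfolding B.mcomplete_def
  proof (intro allI impI)
    fix \<sigma> assume s: "B.MCauchy \<sigma>"
    have sN: "\<sigma> n \<in> N" for n using s by (auto simp: B.MCauchy_def)
    have "A.MCauchy (h \<circ> \<sigma>)"
      using s sN hN unfolding A.MCauchy_def B.MCauchy_def by (auto simp: d_def)
    then obtain x where "limitin A.mtopology (h \<circ> \<sigma>) x sequentially"
      using compl by (auto simp: mcomplete_of_def A.mcomplete_def)
    then have "limitin B.mtopology (g \<circ> (h \<circ> \<sigma>)) (g x) sequentially"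
      using continuous_map_limit[OF gc] by blast
    then show "\<exists>x. limitin B.mtopology \<sigma> x sequentially"
      using gh sN by (auto simp: o_def)
  qed
  show ?thesis
    unfolding souslin_space_def
  proof (intro conjI exI)
    show "mcomplete_of B.Self" by (simp add: mcomplete_of_def B.Self_def complB)
    show "separable_space (mtopology_of B.Self)" by (simp add: B.Self_def sepB)
    show "continuous_map (mtopology_of B.Self) T (\<phi> \<circ> h)"
      using continuous_map_compose[OF hc] cont by (simp add: B.Self_def mtopology_of_def)
    have "h ` N = mspace m" using hg hN by (force simp: N_def)
    then have "(\<phi> \<circ> h) ` N = topspace T" unfolding image_comp[symmetric] using onto by (simp only:)
    then show "(\<phi> \<circ> h) ` mspace B.Self = topspace T" by (simp add: B.Self_def)
  qed (rule haus)
qed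

definition locally_convex_tvs :: "'a::{real_vector, topological_space} itself \<Rightarrow> bool" where
  "locally_convex_tvs _ \<longleftrightarrow>
     continuous_on UNIV (\<lambda>(x::'a, y). x + y) \<and>
     continuous_on UNIV (\<lambda>(c::real, x::'a). c *\<^sub>R x) \<and>
     (\<forall>U::'a set. open U \<and> 0 \<in> U \<longrightarrow> (\<exists>V. open V \<and> convex V \<and> 0 \<in> V \<and> V \<subseteq> U))"


section \<open>Functions and distributions on the circle\<close>

text \<open>Functions on the circle are \<open>2 * pi\<close>-periodic functions on the real line.\<close>

definition circle_fun :: "(real \<Rightarrow> complex) \<Rightarrow> bool" where
  "circle_fun f \<longleftrightarrow> (\<forall>t. f (t + 2 * pi) = f t)"

definition fourier_coeff :: "(real \<Rightarrow> complex) \<Rightarrow> int \<Rightarrow> complex" where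
  "fourier_coeff g k = 1 / (2 * pi) * integral {0..2 * pi} (\<lambda>t. g t * cis (- (of_int k * t)))"

subsection \<open>Hoelder spaces\<close>

definition vderiv :: "nat \<Rightarrow> (real \<Rightarrow> complex) \<Rightarrow> real \<Rightarrow> complex" where
  "vderiv j f = ((\<lambda>g t. vector_derivative g (at t)) ^^ j) f"

text \<open>For \<open>\<alpha> = m + \<beta>\<close> with \<open>m\<close> an integer and \<open>0 \<le> \<beta> < 1\<close>: \<open>m\<close> times continuously
  differentiable with \<open>\<beta>\<close>-Hoelder continuous \<open>m\<close>-th derivative. For \<open>\<beta> = 0\<close> the last condition
  only says that the \<open>m\<close>-th derivative is bounded (\<open>r powr 0 = 1\<close> for \<open>r > 0\<close>), so that integer
  exponents give the classical space of \<open>m\<close> times continuously differentiable functions.\<close>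

definition holder_space :: "real \<Rightarrow> (real \<Rightarrow> complex) set" where
  "holder_space \<alpha> =
     (let m = nat \<lfloor>\<alpha>\<rfloor>; \<beta> = frac \<alpha> in
      {f. circle_fun f \<and> (\<forall>j<m. \<forall>t. vderiv j f differentiable at t) \<and>
          continuous_on UNIV (vderiv m f) \<and>
          (\<exists>K. \<forall>s t. cmod (vderiv m f s - vderiv m f t) \<le> K * \<bar>s - t\<bar> powr \<beta>)})"

definition holder_norm :: "real \<Rightarrow> (real \<Rightarrow> complex) \<Rightarrow> real" where
  "holder_norm \<alpha> f =
     (let m = nat \<lfloor>\<alpha>\<rfloor>; \<beta> = frac \<alpha> in
      (\<Sum>j\<le>m. SUP t. cmod (vderiv j f t)) +
      (SUP (s, t)\<in>{(s, t). s \<noteq> t}. cmod (vderiv m f s - vderiv m f t) / \<bar>s - t\<bar> powr \<beta>))"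

text \<open>The locale \<open>Metric_space\<close> wants symmetry and nonnegativity also outside the carrier, whence
  the case distinctions in the distance functions.\<close>

definition holder_dist :: "real \<Rightarrow> (real \<Rightarrow> complex) \<Rightarrow> (real \<Rightarrow> complex) \<Rightarrow> real" where
  "holder_dist \<alpha> f g =
     (if f \<in> holder_space \<alpha> \<and> g \<in> holder_space \<alpha> then holder_norm \<alpha> (\<lambda>t. f t - g t) else 0)"

definition holder_topology :: "real \<Rightarrow> (real \<Rightarrow> complex) topology" where
  "holder_topology \<alpha> = Metric_space.mtopology (holder_space \<alpha>) (holder_dist \<alpha>)"

lemma vderiv_0: "vderiv 0 f = f"
  and vderiv_Suc: "vderiv (Suc j) f t = vector_derivative (vderiv j f) (at t)"
  by (simp_all add: vderiv_def)

lemma vderiv_diff: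
  assumes "\<forall>i<j. \<forall>t. vderiv i f differentiable at t" "\<forall>i<j. \<forall>t. vderiv i g differentiable at t"
  shows "vderiv j (\<lambda>t. f t - g t) = (\<lambda>t. vderiv j f t - vderiv j g t)"
  using assms
proof (induction j)
  case (Suc j)
  then have "vderiv j (\<lambda>t. f t - g t) = (\<lambda>t. vderiv j f t - vderiv j g t)" by simp
  then have "vderiv (Suc j) (\<lambda>t. f t - g t) x = vderiv (Suc j) f x - vderiv (Suc j) g x" for x
    unfolding vderiv_Suc using Suc.prems by (simp only: vector_derivative_diff_at lessI)
  then show ?case by blast
qed (simp add: vderiv_0)

lemma circle_fun_vderiv:
  assumes "circle_fun f" "\<forall>i<j. \<forall>t. vderiv i f differentiable at t"
  shows "circle_fun (vderiv j f)"
  using assms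
proof (induction j)
  case (Suc j)
  have per: "vderiv j f (t + 2 * pi) = vderiv j f t" for t
    using Suc by (simp add: circle_fun_def)
  have "vector_derivative (vderiv j f) (at (t + 2 * pi)) = vector_derivative (vderiv j f) (at t)" for t
  proof -
    have "(vderiv j f has_vector_derivative vector_derivative (vderiv j f) (at (t + 2 * pi)))
            (at (t + 2 * pi))"
      using Suc.prems by (simp add: vector_derivative_works)
    then have "((vderiv j f \<circ> (\<lambda>t. t + 2 * pi)) has_vector_derivative
        1 *\<^sub>R vector_derivative (vderiv j f) (at (t + 2 * pi))) (at t)"
      by (intro vector_diff_chain_at) (auto intro!: derivative_eq_intros)
    then have "(vderiv j f has_vector_derivative vector_derivative (vderiv j f) (at (t + 2 * pi))) (at t)"
      by (simp add: o_def per)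
    then show ?thesis by (simp add: vector_derivative_at)
  qed
  then show ?case by (simp add: circle_fun_def vderiv_Suc)
qed (simp add: vderiv_0)

lemma circle_fun_bounded:
  assumes "circle_fun f" "continuous_on UNIV f"
  shows "\<exists>B. \<forall>t. cmod (f t) \<le> B"
proof -
  have up: "f (t + 2 * pi * real n) = f t" for t n
  proof (induction n)
    case (Suc n)
    have "t + 2 * pi * real (Suc n) = t + 2 * pi * real n + 2 * pi" by (simp add: algebra_simps)
    then show ?case using assms(1) Suc unfolding circle_fun_def by (simp only:)
  qed simp
  have shift: "f (t + 2 * pi * of_int n) = f t" for t n
  proof (cases "n \<ge> 0")
    case True
    then show ?thesis using up[of t "nat n"] by simp
  next
    case False
    then have "t + 2 * pi * of_int n + 2 * pi * real (nat (- n)) = t" by simp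
    then show ?thesis using up[of "t + 2 * pi * of_int n" "nat (- n)"] by (simp only:)
  qed
  have "compact (f ` {0..2 * pi})"
    by (rule compact_continuous_image) (auto intro: continuous_on_subset[OF assms(2)])
  then have "bounded (f ` {0..2 * pi})" by (rule compact_imp_bounded)
  then obtain B where "\<forall>x\<in>f ` {0..2 * pi}. cmod x \<le> B" unfolding bounded_iff ..
  then have B: "cmod (f t) \<le> B" if "t \<in> {0..2 * pi}" for t using that by (rule bspec[OF _ imageI])
  have "cmod (f t) \<le> B" for t
  proof -
    define n where "n = \<lfloor>t / (2 * pi)\<rfloor>"
    have "of_int n \<le> t / (2 * pi)" "t / (2 * pi) \<le> of_int n + 1"
      unfolding n_def by linarith+
    then have "of_int n * (2 * pi) \<le> t" "t \<le> (of_int n + 1) * (2 * pi)"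
      by (simp_all only: pos_le_divide_eq pos_divide_le_eq pi_gt_zero mult_pos_pos zero_less_numeral)
    then have "t - 2 * pi * of_int n \<in> {0..2 * pi}" by (simp add: algebra_simps)
    then have "cmod (f (t - 2 * pi * of_int n)) \<le> B" by (rule B)
    then show ?thesis using shift[of "t - 2 * pi * of_int n" n] by (simp only: diff_add_cancel)
  qed
  then show ?thesis by blast
qed

lemma SUP_norm_triangle:
  fixes u v :: "'i \<Rightarrow> complex"
  assumes "I \<noteq> {}" "bdd_above ((\<lambda>i. cmod (u i)) ` I)" "bdd_above ((\<lambda>i. cmod (v i)) ` I)"
  shows "(SUP i\<in>I. cmod (u i + v i)) \<le> (SUP i\<in>I. cmod (u i)) + (SUP i\<in>I. cmod (v i))"
proof (rule cSUP_least[OF assms(1)])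
  fix i assume "i \<in> I"
  then have "cmod (u i) \<le> (SUP i\<in>I. cmod (u i))" "cmod (v i) \<le> (SUP i\<in>I. cmod (v i))"
    using assms by (auto intro: cSUP_upper)
  then show "cmod (u i + v i) \<le> (SUP i\<in>I. cmod (u i)) + (SUP i\<in>I. cmod (v i))"
    using norm_triangle_ineq[of "u i" "v i"] by linarith
qed

lemma Metric_space_holder: "Metric_space (holder_space \<alpha>) (holder_dist \<alpha>)"
proof -
  define m where "m = nat \<lfloor>\<alpha>\<rfloor>"
  define \<beta> where "\<beta> = frac \<alpha>"
  define S where "S = holder_space \<alpha>"
  define I where "I = {(s, t). s \<noteq> (t::real)}"
  define D where "D j f g t = vderiv j f t - vderiv j g t" for j f g and t :: real
  define Q where "Q f g p = (D m f g (fst p) - D m f g (snd p)) / complex_of_real (\<bar>fst p - snd p\<bar> powr \<beta>)"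
    for f g p
  define N where "N f g = (\<Sum>j\<le>m. SUP t. cmod (D j f g t)) + (SUP p\<in>I. cmod (Q f g p))" for f g
  have S: "circle_fun f" "\<And>j t. j < m \<Longrightarrow> vderiv j f differentiable at t" "continuous_on UNIV (vderiv m f)"
      "\<exists>K. \<forall>s t. cmod (vderiv m f s - vderiv m f t) \<le> K * \<bar>s - t\<bar> powr \<beta>" if "f \<in> S" for f
    using that by (auto simp: S_def holder_space_def Let_def m_def \<beta>_def)
  have Iex: "(1, 0) \<in> I" by (simp add: I_def)
  have bdd: "\<exists>B. \<forall>t. cmod (vderiv j f t) \<le> B" if "f \<in> S" "j \<le> m" for f j
  proof (rule circle_fun_bounded)
    show "circle_fun (vderiv j f)" using S[OF that(1)] that(2) by (intro circle_fun_vderiv) auto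
    show "continuous_on UNIV (vderiv j f)"
    proof (cases "j = m")
      case False
      then show ?thesis using S(2)[OF that(1)] that(2)
        by (auto intro!: continuous_at_imp_continuous_on differentiable_imp_continuous_within)
    qed (use S(3)[OF that(1)] in simp)
  qed
  have bD: "bdd_above (range (\<lambda>t. cmod (D j f g t)))" if fg: "f \<in> S" "g \<in> S" "j \<le> m" for f g j
  proof -
    obtain A B where "\<And>t. cmod (vderiv j f t) \<le> A" "\<And>t. cmod (vderiv j g t) \<le> B"
      using bdd fg by metis
    then have "cmod (D j f g t) \<le> A + B" for t
      unfolding D_def using norm_triangle_ineq4[of "vderiv j f t" "vderiv j g t"] by (smt (verit))
    then show ?thesis by (auto intro!: bdd_aboveI)
  qed
  have bQ: "bdd_above ((\<lambda>p. cmod (Q f g p)) ` I)" if fg: "f \<in> S" "g \<in> S" for f g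
  proof -
    obtain A B where AB: "\<And>s t. cmod (vderiv m f s - vderiv m f t) \<le> A * \<bar>s - t\<bar> powr \<beta>"
      "\<And>s t. cmod (vderiv m g s - vderiv m g t) \<le> B * \<bar>s - t\<bar> powr \<beta>"
      using S(4) fg by metis
    have "cmod (Q f g (s, t)) \<le> A + B" if "s \<noteq> t" for s t
    proof -
      have "D m f g s - D m f g t = (vderiv m f s - vderiv m f t) - (vderiv m g s - vderiv m g t)"
        by (simp add: D_def)
      then have "cmod (D m f g s - D m f g t) \<le>
          cmod (vderiv m f s - vderiv m f t) + cmod (vderiv m g s - vderiv m g t)"
        by (simp only: norm_triangle_ineq4)
      also have "\<dots> \<le> (A + B) * \<bar>s - t\<bar> powr \<beta>"
        using AB[of s t] by (simp add: distrib_right)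
      finally have "cmod (D m f g s - D m f g t) \<le> (A + B) * \<bar>s - t\<bar> powr \<beta>" .
      moreover have "\<bar>s - t\<bar> powr \<beta> > 0" using that by simp
      ultimately show ?thesis by (simp add: Q_def norm_divide divide_le_eq)
    qed
    then show ?thesis by (auto intro!: bdd_aboveI simp: I_def)
  qed
  have dist: "holder_dist \<alpha> f g = (if f \<in> S \<and> g \<in> S then N f g else 0)" for f g
  proof (cases "f \<in> S \<and> g \<in> S")
    case True
    have V: "vderiv j (\<lambda>t. f t - g t) = D j f g" if "j \<le> m" for j
      unfolding D_def using True S(2) that by (intro vderiv_diff) auto
    have "(SUP (s, t)\<in>I. cmod (D m f g s - D m f g t) / \<bar>s - t\<bar> powr \<beta>) = (SUP p\<in>I. cmod (Q f g p))"
      by (rule SUP_cong) (auto simp: Q_def norm_divide)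
    then have "holder_norm \<alpha> (\<lambda>t. f t - g t) = N f g"
      using V unfolding holder_norm_def Let_def m_def[symmetric] \<beta>_def[symmetric] N_def I_def by simp
    then show ?thesis using True by (simp add: holder_dist_def S_def)
  qed (auto simp: holder_dist_def S_def)
  have nnD: "0 \<le> (SUP t. cmod (D j f g t))" if "f \<in> S" "g \<in> S" "j \<le> m" for f g j
    by (rule cSUP_upper2[OF bD[OF that], of 0]) auto
  have nnQ: "0 \<le> (SUP p\<in>I. cmod (Q f g p))" if "f \<in> S" "g \<in> S" for f g
    by (rule cSUP_upper2[OF bQ[OF that] Iex]) auto
  have nn: "0 \<le> N f g" if "f \<in> S" "g \<in> S" for f g
    unfolding N_def using that by (intro add_nonneg_nonneg sum_nonneg nnD nnQ) auto
  have D0: "D 0 f g t = f t - g t" for f g t by (simp add: D_def vderiv_0)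
  show ?thesis
    unfolding S_def[symmetric]
  proof
    fix f g show "0 \<le> holder_dist \<alpha> f g" using nn by (simp add: dist)
    have "cmod (D j f g t) = cmod (D j g f t)" for j t by (simp add: D_def norm_minus_commute)
    moreover have "cmod (Q f g p) = cmod (Q g f p)" for p
    proof -
      have "D m f g (fst p) - D m f g (snd p) = - (D m g f (fst p) - D m g f (snd p))"
        by (simp add: D_def)
      then show ?thesis unfolding Q_def norm_divide by (metis norm_minus_cancel)
    qed
    ultimately show "holder_dist \<alpha> f g = holder_dist \<alpha> g f" by (simp add: dist N_def)
  next
    fix f g assume fg: "f \<in> S" "g \<in> S"
    show "(holder_dist \<alpha> f g = 0) = (f = g)"
    proof
      assume "f = g"
      have "(SUP p\<in>I. 0::real) = 0" using Iex by (intro cSUP_const) auto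
      then show "holder_dist \<alpha> f g = 0" using \<open>f = g\<close> fg by (simp add: dist N_def D_def Q_def)
    next
      assume "holder_dist \<alpha> f g = 0"
      then have "(\<Sum>j\<le>m. SUP t. cmod (D j f g t)) + (SUP p\<in>I. cmod (Q f g p)) = 0"
        using fg by (simp add: dist N_def)
      moreover have "(SUP t. cmod (D 0 f g t)) \<le> (\<Sum>j\<le>m. SUP t. cmod (D j f g t))"
        using fg nnD by (intro member_le_sum) auto
      ultimately have "(SUP t. cmod (D 0 f g t)) \<le> 0" using nnQ[OF fg] by linarith
      moreover have "cmod (D 0 f g t) \<le> (SUP t. cmod (D 0 f g t))" for t
        using bD[OF fg, of 0] by (intro cSUP_upper) auto
      ultimately have "cmod (f t - g t) \<le> 0" for t unfolding D0 by (meson order_trans)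
      then show "f = g" by auto
    qed
  next
    fix f g h assume fgh: "f \<in> S" "g \<in> S" "h \<in> S"
    have "(SUP t. cmod (D j f h t)) \<le> (SUP t. cmod (D j f g t)) + (SUP t. cmod (D j g h t))" if "j \<le> m" for j
      using SUP_norm_triangle[of UNIV "D j f g" "D j g h"] bD fgh that by (simp add: D_def)
    then have "(\<Sum>j\<le>m. SUP t. cmod (D j f h t)) \<le>
        (\<Sum>j\<le>m. SUP t. cmod (D j f g t)) + (\<Sum>j\<le>m. SUP t. cmod (D j g h t))"
      by (subst sum.distrib[symmetric], intro sum_mono) auto
    moreover have "Q f g p + Q g h p = Q f h p" for p
      by (simp add: Q_def D_def add_divide_distrib[symmetric])
    then have "(SUP p\<in>I. cmod (Q f h p)) \<le> (SUP p\<in>I. cmod (Q f g p)) + (SUP p\<in>I. cmod (Q g h p))"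
      using SUP_norm_triangle[of I "Q f g" "Q g h"] bQ fgh Iex by auto
    ultimately show "holder_dist \<alpha> f h \<le> holder_dist \<alpha> f g + holder_dist \<alpha> g h"
      using fgh by (simp add: dist N_def)
  qed
qed

lemma topspace_holder_topology: "topspace (holder_topology \<alpha>) = holder_space \<alpha>"
  by (simp add: holder_topology_def Metric_space.topspace_mtopology[OF Metric_space_holder])

subsection \<open>Sobolev spaces\<close>

text \<open>The Sobolev space of order 1 on the circle consists of the square integrable \<open>f\<close> for which
  the sum of \<open>(1 + k\<^sup>2) * \<bar>f\<^sub>k\<bar>\<^sup>2\<close> over the Fourier coefficients \<open>f\<^sub>k\<close> is finite. Every such class
  has exactly one continuous representative, which is the one used here. \<open>Hm1\<close> is the dual space
  of \<open>H1\<close>, that is, the Sobolev space of order \<open>-1\<close>, with the dual norm.\<close>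

definition H1 :: "(real \<Rightarrow> complex) set" where
  "H1 = {f. circle_fun f \<and> continuous_on UNIV f \<and>
            (\<lambda>k::int. (1 + (of_int k)\<^sup>2) * (cmod (fourier_coeff f k))\<^sup>2) summable_on UNIV}"

definition H1_norm :: "(real \<Rightarrow> complex) \<Rightarrow> real" where
  "H1_norm f = sqrt (\<Sum>\<^sub>\<infinity>k::int. (1 + (of_int k)\<^sup>2) * (cmod (fourier_coeff f k))\<^sup>2)"

definition Hm1 :: "((real \<Rightarrow> complex) \<Rightarrow> complex) set" where
  "Hm1 = {y \<in> extensional H1.
            (\<forall>f\<in>H1. \<forall>g\<in>H1. y (\<lambda>t. f t + g t) = y f + y g) \<and>
            (\<forall>c. \<forall>f\<in>H1. y (\<lambda>t. c * f t) = c * y f) \<and>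
            (\<exists>K. \<forall>f\<in>H1. cmod (y f) \<le> K * H1_norm f)}"

definition Hm1_add ::
    "((real \<Rightarrow> complex) \<Rightarrow> complex) \<Rightarrow> ((real \<Rightarrow> complex) \<Rightarrow> complex) \<Rightarrow> (real \<Rightarrow> complex) \<Rightarrow> complex" where
  "Hm1_add y z = (\<lambda>f\<in>H1. y f + z f)"

definition Hm1_norm :: "((real \<Rightarrow> complex) \<Rightarrow> complex) \<Rightarrow> real" where
  "Hm1_norm y = (SUP f\<in>{f\<in>H1. H1_norm f \<le> 1}. cmod (y f))"

definition Hm1_dist ::
    "((real \<Rightarrow> complex) \<Rightarrow> complex) \<Rightarrow> ((real \<Rightarrow> complex) \<Rightarrow> complex) \<Rightarrow> real" where
  "Hm1_dist y z = (if y \<in> Hm1 \<and> z \<in> Hm1 then Hm1_norm (\<lambda>f\<in>H1. y f - z f) else 0)"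

definition Hm1_topology :: "((real \<Rightarrow> complex) \<Rightarrow> complex) topology" where
  "Hm1_topology = Metric_space.mtopology Hm1 Hm1_dist"

lemma fourier_coeff_scale: "fourier_coeff (\<lambda>t. c * f t) k = c * fourier_coeff f k"
  by (simp add: fourier_coeff_def mult.assoc)

lemma H1_scale:
  assumes "f \<in> H1"
  shows "(\<lambda>t. c * f t) \<in> H1" "H1_norm (\<lambda>t. c * f t) = cmod c * H1_norm f"
proof -
  have eq: "(1 + (of_int k)\<^sup>2) * (cmod (fourier_coeff (\<lambda>t. c * f t) k))\<^sup>2 =
      (cmod c)\<^sup>2 * ((1 + (of_int k)\<^sup>2) * (cmod (fourier_coeff f k))\<^sup>2)" for k :: int
    by (simp add: fourier_coeff_scale norm_mult power_mult_distrib)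
  show "(\<lambda>t. c * f t) \<in> H1"
    using assms unfolding H1_def mem_Collect_eq eq
    by (auto simp: circle_fun_def intro!: continuous_intros summable_on_cmult_right)
  show "H1_norm (\<lambda>t. c * f t) = cmod c * H1_norm f"
    unfolding H1_norm_def eq infsum_cmult_right' by (simp add: real_sqrt_mult)
qed

lemma H1_norm_nonneg: "0 \<le> H1_norm f"
  unfolding H1_norm_def by (intro real_sqrt_ge_zero infsum_nonneg) auto

lemma Metric_space_Hm1: "Metric_space Hm1 Hm1_dist"
proof -
  define I where "I = {f \<in> H1. H1_norm f \<le> 1}"
  define N where "N y z = (SUP f\<in>I. cmod (y f - z f))" for y z :: "(real \<Rightarrow> complex) \<Rightarrow> complex"
  have "(\<lambda>t. 0) \<in> H1" "H1_norm (\<lambda>t. 0) = 0"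
    by (simp_all add: H1_def H1_norm_def circle_fun_def fourier_coeff_def)
  then have Iex: "(\<lambda>t. 0) \<in> I" by (simp add: I_def)
  have dist: "Hm1_dist y z = (if y \<in> Hm1 \<and> z \<in> Hm1 then N y z else 0)" for y z
    by (auto simp: Hm1_dist_def Hm1_norm_def N_def I_def intro!: SUP_cong)
  have bdd: "bdd_above ((\<lambda>f. cmod (y f - z f)) ` I)" if "y \<in> Hm1" "z \<in> Hm1" for y z
  proof -
    obtain A where "\<And>f. f \<in> H1 \<Longrightarrow> cmod (y f) \<le> A * H1_norm f"
      using \<open>y \<in> Hm1\<close> unfolding Hm1_def by blast
    moreover obtain B where "\<And>f. f \<in> H1 \<Longrightarrow> cmod (z f) \<le> B * H1_norm f"
      using \<open>z \<in> Hm1\<close> unfolding Hm1_def by blast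
    moreover have "A * H1_norm f \<le> \<bar>A\<bar>" "B * H1_norm f \<le> \<bar>B\<bar>" if "f \<in> I" for f
    proof -
      have le: "c * H1_norm f \<le> \<bar>c\<bar>" for c
      proof -
        have "c * H1_norm f \<le> \<bar>c\<bar> * H1_norm f"
          using H1_norm_nonneg[of f] by (intro mult_right_mono) auto
        also have "\<dots> \<le> \<bar>c\<bar>" using that by (intro mult_left_le) (auto simp: I_def)
        finally show ?thesis .
      qed
      show "A * H1_norm f \<le> \<bar>A\<bar>" "B * H1_norm f \<le> \<bar>B\<bar>" by (rule le)+
    qed
    ultimately have "cmod (y f - z f) \<le> \<bar>A\<bar> + \<bar>B\<bar>" if "f \<in> I" for f
      using that norm_triangle_ineq4[of "y f" "z f"] unfolding I_def by fastforce
    then show ?thesis by (auto intro!: bdd_aboveI)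
  qed
  show ?thesis
  proof
    fix y z
    have "0 \<le> N y z" if "y \<in> Hm1" "z \<in> Hm1"
      unfolding N_def by (rule cSUP_upper2[OF bdd[OF that] Iex]) auto
    then show "0 \<le> Hm1_dist y z" by (simp add: dist)
    show "Hm1_dist y z = Hm1_dist z y" by (simp add: dist N_def norm_minus_commute)
  next
    fix y z assume yz: "y \<in> Hm1" "z \<in> Hm1"
    show "(Hm1_dist y z = 0) = (y = z)"
    proof
      have "(SUP f\<in>I. 0::real) = 0" using Iex by (intro cSUP_const) auto
      then show "y = z \<Longrightarrow> Hm1_dist y z = 0" using yz by (simp add: dist N_def)
    next
      assume "Hm1_dist y z = 0"
      then have *: "y f = z f" if "f \<in> I" for f
        using cSUP_upper[OF that bdd[OF yz]] yz by (auto simp: dist N_def)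
      have "y f = z f" if f: "f \<in> H1" for f
      proof -
        define c where "c = complex_of_real (1 / (1 + H1_norm f))"
        have "0 < 1 + H1_norm f" using H1_norm_nonneg[of f] by linarith
        then have c: "c \<noteq> 0" "cmod c * H1_norm f \<le> 1"
          using H1_norm_nonneg[of f] by (auto simp: c_def norm_divide field_simps
            simp del: of_real_add of_real_divide)
        then have "(\<lambda>t. c * f t) \<in> I" using f by (simp add: I_def H1_scale)
        then have "y (\<lambda>t. c * f t) = z (\<lambda>t. c * f t)" by (rule *)
        moreover have "y (\<lambda>t. c * f t) = c * y f" "z (\<lambda>t. c * f t) = c * z f"
          using yz f by (auto simp: Hm1_def)
        ultimately have "c * y f = c * z f" by simp
        then show ?thesis using c by simp
      qed
      then show "y = z" using yz by (auto simp: Hm1_def intro: extensionalityI)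
    qed
  next
    fix x y z assume xyz: "x \<in> Hm1" "y \<in> Hm1" "z \<in> Hm1"
    have "N x z \<le> N x y + N y z"
      using SUP_norm_triangle[of I "\<lambda>f. x f - y f" "\<lambda>f. y f - z f"] bdd xyz Iex
      by (auto simp: N_def)
    then show "Hm1_dist x z \<le> Hm1_dist x y + Hm1_dist y z" using xyz by (simp add: dist)
  qed
qed

lemma topspace_Hm1_topology: "topspace Hm1_topology = Hm1"
  by (simp add: Hm1_topology_def Metric_space.topspace_mtopology[OF Metric_space_Hm1])

definition Hm1_borel :: "((real \<Rightarrow> complex) \<Rightarrow> complex) measure" where
  "Hm1_borel = sigma Hm1 {U. openin Hm1_topology U}"

text \<open>The duality is normalized so that the functional given by an ordinary function has the same
  Fourier coefficients as the function.\<close>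

definition Hm1_of_fun :: "(real \<Rightarrow> complex) \<Rightarrow> (real \<Rightarrow> complex) \<Rightarrow> complex" where
  "Hm1_of_fun g = (\<lambda>f\<in>H1. 1 / (2 * pi) * integral {0..2 * pi} (\<lambda>t. g t * f t))"

definition Hm1_coeff :: "((real \<Rightarrow> complex) \<Rightarrow> complex) \<Rightarrow> int \<Rightarrow> complex" where
  "Hm1_coeff y k = y (\<lambda>t. cis (- (of_int k * t)))"

lemma fourier_coeff_cis:
  "fourier_coeff (\<lambda>t. cis (of_int n * t)) k = (if n = k then 1 else 0)"
proof -
  have eq: "cis (of_int n * t) * cis (- (of_int k * t)) = cis (of_int (n - k) * t)" for t
    by (simp add: cis_mult algebra_simps)
  show ?thesis
  proof (cases "n = k")
    case True
    then show ?thesis unfolding fourier_coeff_def eq by (simp add: scaleR_conv_of_real)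
  next
    case False
    define c where "c = \<i> * of_int (n - k)"
    have c: "c \<noteq> 0" using False by (simp add: c_def)
    have "((\<lambda>t. exp (c * of_real t)) has_integral
        exp (c * of_real (2 * pi)) / c - exp (c * of_real 0) / c) {0..2 * pi}"
    proof (rule fundamental_theorem_of_calculus)
      fix t :: real
      have "((\<lambda>z. exp (c * z) / c) has_field_derivative exp (c * of_real t)) (at (of_real t))"
        using c by (auto intro!: derivative_eq_intros)
      then show "((\<lambda>t. exp (c * of_real t) / c) has_vector_derivative exp (c * of_real t))
          (at t within {0..2 * pi})"
        by (intro has_vector_derivative_real_field)
    qed simp
    moreover have "exp (c * of_real (2 * pi)) = 1"
      unfolding exp_eq_1 c_def by (auto intro!: exI[of _ "n - k"])
    moreover have "exp (c * of_real t) = cis (of_int (n - k) * t)" for t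
      by (simp add: cis_conv_exp c_def algebra_simps)
    ultimately have "integral {0..2 * pi} (\<lambda>t. cis (of_int (n - k) * t)) = 0"
      by (simp add: integral_unique)
    then show ?thesis using False unfolding fourier_coeff_def eq by (simp only: mult_zero_right if_False)
  qed
qed

lemma cis_in_H1: "(\<lambda>t. cis (of_int n * t)) \<in> H1"
proof -
  have "cis (of_int n * (t + 2 * pi)) = cis (of_int n * t) * cis (2 * pi * of_int n)" for t
    by (simp add: cis_mult algebra_simps)
  then have "circle_fun (\<lambda>t. cis (of_int n * t))"
    unfolding circle_fun_def by (simp only: cis_multiple_2pi Ints_of_int mult_1_right simp_thms)
  moreover have "(\<lambda>k::int. (1 + (of_int k)\<^sup>2) * (cmod (fourier_coeff (\<lambda>t. cis (of_int n * t)) k))\<^sup>2)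
      summable_on UNIV"
    by (rule finite_nonzero_values_imp_summable_on, rule finite_subset[of _ "{n}"])
      (auto simp: fourier_coeff_cis)
  moreover have "continuous_on UNIV (\<lambda>t. cis (of_int n * t))"
    by (intro continuous_intros)
  ultimately show ?thesis by (simp add: H1_def)
qed

lemma Hm1_coeff_of_fun: "Hm1_coeff (Hm1_of_fun g) k = fourier_coeff g k"
proof -
  have "(\<lambda>t. cis (- (of_int k * t))) \<in> H1" using cis_in_H1[of "- k"] by simp
  then show ?thesis unfolding Hm1_coeff_def Hm1_of_fun_def fourier_coeff_def by simp
qed


section \<open>Statistical inverse problems\<close>

text \<open>A solution \<open>\<mu>(U, y)\<close> is represented by the measures \<open>\<mu> y\<close>, so \<open>\<mu>(U, y)\<close> is
  \<open>measure (\<mu> y) U\<close>. Here \<open>F\<close> and \<open>G\<close> only serve as measurable spaces.\<close>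

definition inverse_problem_solution ::
    "'w measure \<Rightarrow> 'f measure \<Rightarrow> ('w \<Rightarrow> 'f) \<Rightarrow> 'g measure \<Rightarrow> ('w \<Rightarrow> 'g) \<Rightarrow> ('g \<Rightarrow> 'f measure) \<Rightarrow> bool" where
  "inverse_problem_solution P F X G Y \<mu> \<longleftrightarrow>
     (\<forall>U\<in>sets F. AE \<omega> in P. measure (\<mu> (Y \<omega>)) U =
        real_cond_exp P (vimage_algebra (space P) Y G) (\<lambda>\<omega>'. indicator U (X \<omega>')) \<omega>) \<and>
     (\<forall>U\<in>sets F. (\<lambda>y. measure (\<mu> y) U) \<in> borel_measurable (completion (distr P G Y))) \<and>
     (\<forall>y\<in>space G. sets (\<mu> y) = sets F \<and> prob_space (\<mu> y))"

definition solution_essentially_unique ::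
    "'w measure \<Rightarrow> 'f measure \<Rightarrow> ('w \<Rightarrow> 'f) \<Rightarrow> 'g measure \<Rightarrow> ('w \<Rightarrow> 'g) \<Rightarrow> bool" where
  "solution_essentially_unique P F X G Y \<longleftrightarrow>
     (\<forall>\<mu> \<nu>. inverse_problem_solution P F X G Y \<mu> \<longrightarrow> inverse_problem_solution P F X G Y \<nu> \<longrightarrow>
        (\<exists>C\<in>sets (completion (distr P G Y)). emeasure (completion (distr P G Y)) C = 1 \<and>
           (\<forall>U\<in>sets F. \<forall>y\<in>C. measure (\<mu> y) U = measure (\<nu> y) U)))"

end

theory Submission
  imports Defs
begin

text \<open>Translating the noise by a function with real, absolutely summable Fourier coefficients \<open>c\<^sub>k\<close>
  multiplies its law by the density \<open>exp ((\<Sum>k. \<bar>t\<^sub>k\<bar> - \<bar>t\<^sub>k - c\<^sub>k\<bar>) / b)\<close>: on finitely many coordinates this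
  is a product of one-dimensional substitutions, and since all partial products are bounded by
  \<open>exp ((\<Sum>k. \<bar>c\<^sub>k\<bar>) / b)\<close>, dominated convergence yields the infinite product. The coefficients of
  \<open>L x\<close> are absolutely summable because \<open>\<alpha> > 1\<close> makes \<open>L x\<close> continuously differentiable. As the coefficients
  generate the Borel sets of \<open>Hm1\<close>, Fubini gives the joint law of \<open>X\<close> and \<open>Y\<close> the density \<open>w\<close>
  with respect to the product of the laws of \<open>\<epsilon>\<close> and \<open>X\<close>, and Bayes' formula follows.

  For the uniqueness, two solutions agree almost everywhere on a countable family of open sets that
  separates points. Compact sets lie in the generated \<open>\<sigma>\<close>-algebra, and finite Borel measures on a
  Souslin space are tight, so that they are determined by their values on compact sets.\<close>

section \<open>Fourier coefficients\<close>

text \<open>The noise has real coefficients almost surely, so a shift with a non-real coefficient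
  would give a law singular to that of the noise; hence the hypothesis \<open>L_real_coeffs\<close>.
  Observations \<open>y\<close> with non-real coefficients form a null set, but the formula still
  has to make sense for them, which is why \<open>w\<close> is written with \<open>cmod\<close>. The
  Borel sets of \<open>Hm1\<close> come from a dual norm, a supremum over an uncountable unit ball.
  Questions of measurability are reduced to coefficients by comparing this norm with a weighted
  \<open>l2\<close> norm. Essential uniqueness asks for one null set that serves all Borel sets at
  once. That countably many open sets separating points generate all Borel sets of a Souslin space
  is a theorem on analytic sets; it is bypassed here, because only the equality of two finite
  measures is at stake.\<close>

lemma symmetric_int_interval_Suc:
  "{- int (Suc n)..int (Suc n)} = insert (int (Suc n)) (insert (- int (Suc n)) {- int n..int n})"
  by auto

lemma sum_symmetric_telescope:
  fixes a :: "int \<Rightarrow> 'a::ab_group_add"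
  shows "(\<Sum>k\<in>{- int n..int n}. a k - a (k + 1)) = a (- int n) - a (int n + 1)"
proof (induction n)
  case (Suc n)
  have "1 + (- 1 - int n) = - int n" by simp
  then show ?case
    unfolding symmetric_int_interval_Suc using Suc by (simp add: algebra_simps)
qed simp

text \<open>\<open>infsum\<close> is a limit over all finite sets, whereas measurability and
  convergence theorems need a sequence; this is the passage from one to the other. The sum of the
  \<open>\<bar>k\<bar>\<close> over \<open>X\<close> bounds each of them and also makes sense for
  empty \<open>X\<close>.\<close>

lemma filterlim_symmetric_intervals:
  "filterlim (\<lambda>n. {- int n..int n}) (finite_subsets_at_top UNIV) sequentially"
  unfolding filterlim_finite_subsets_at_top
proof (intro allI impI)
  fix X :: "int set" assume "finite X \<and> X \<subseteq> UNIV"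
  then have fin: "finite X" by simp
  have "X \<subseteq> {- int n..int n}" if "n \<ge> (\<Sum>k\<in>X. nat \<bar>k\<bar>)" for n
  proof
    fix k assume "k \<in> X"
    then have "nat \<bar>k\<bar> \<le> (\<Sum>k\<in>X. nat \<bar>k\<bar>)" using fin by (intro member_le_sum) auto
    then show "k \<in> {- int n..int n}" using that by auto
  qed
  then show "\<forall>\<^sub>F n in sequentially. finite {- int n..int n} \<and> X \<subseteq> {- int n..int n} \<and> {- int n..int n} \<subseteq> UNIV"
    unfolding eventually_sequentially by auto
qed

lemma infsum_symmetric_LIMSEQ:
  fixes f :: "int \<Rightarrow> 'a::{comm_monoid_add, t2_space}"
  assumes "f summable_on UNIV"
  shows "(\<lambda>n. \<Sum>k\<in>{- int n..int n}. f k) \<longlonglongrightarrow> infsum f UNIV"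
  using filterlim_compose[OF infsum_tendsto[OF assms] filterlim_symmetric_intervals] .

lemma summable_on_int_symmetric:
  fixes f :: "int \<Rightarrow> real"
  assumes "\<And>k. f (- k) = f k" "(\<lambda>n. f (int n)) summable_on UNIV"
  shows "f summable_on UNIV"
proof -
  have "(\<lambda>n. f (- int n)) summable_on UNIV" using assms by simp
  moreover have "inj int" "inj (\<lambda>n. - int n)" by (auto intro: injI)
  ultimately have "f summable_on range int" "f summable_on range (\<lambda>n. - int n)"
    using assms(2) by (simp_all add: summable_on_reindex o_def)
  moreover have "UNIV = range int \<union> range (\<lambda>n. - int n)"
  proof -
    have "k \<in> range int \<union> range (\<lambda>n. - int n)" for k
      by (cases k rule: int_cases2) auto
    then show ?thesis by auto
  qed
  ultimately show ?thesis by (metis summable_on_union)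
qed

text \<open>At \<open>k = 0\<close> the term is \<open>1 / 0 = 0\<close>.\<close>

lemma summable_on_inverse_square_int: "(\<lambda>k::int. 1 / (of_int k)\<^sup>2 :: real) summable_on UNIV"
proof (rule summable_on_int_symmetric)
  have "summable (\<lambda>n. 1 / real n ^ 2)"
    using inverse_power_summable[of 2, where 'a=real]
        by (simp add: inverse_eq_divide power_one_over)
  then show "(\<lambda>n. 1 / (of_int (int n))\<^sup>2 :: real) summable_on UNIV"
    by (subst summable_on_UNIV_nonneg_real_iff) auto
qed simp

section \<open>Linearity of Fourier coefficients, trigonometric polynomials\<close>

lemma integrable_on_times_cis:
  assumes "continuous_on {0..2 * pi} f"
  shows "(\<lambda>t. f t * cis (- (of_int k * t))) integrable_on {0..2 * pi}"
  using assms by (intro integrable_continuous_real continuous_intros)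

lemma fourier_coeff_add:
  assumes "continuous_on {0..2 * pi} f" "continuous_on {0..2 * pi} g"
  shows "fourier_coeff (\<lambda>t. f t + g t) k = fourier_coeff f k + fourier_coeff g k"
  unfolding fourier_coeff_def distrib_right
  by (subst integral_add) (use assms in \<open>auto intro!: integrable_on_times_cis simp: distrib_left\<close>)

lemma fourier_coeff_diff:
  assumes "continuous_on {0..2 * pi} f" "continuous_on {0..2 * pi} g"
  shows "fourier_coeff (\<lambda>t. f t - g t) k = fourier_coeff f k - fourier_coeff g k"
  unfolding fourier_coeff_def left_diff_distrib
  by (subst integral_diff) (use assms in \<open>auto intro!: integrable_on_times_cis simp: right_diff_distrib\<close>)

lemma fourier_coeff_trig_poly:
  assumes "finite K"
  shows "fourier_coeff (\<lambda>t. \<Sum>n\<in>K. a n * cis (of_int n * t)) k = (if k \<in> K then a k else 0)"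
  using assms
proof (induction K)
  case (insert n K)
  have "fourier_coeff (\<lambda>t. \<Sum>n\<in>insert n K. a n * cis (of_int n * t)) k =
      fourier_coeff (\<lambda>t. a n * cis (of_int n * t) + (\<Sum>n\<in>K. a n * cis (of_int n * t))) k"
    using insert by simp
  also have "\<dots> = a n * fourier_coeff (\<lambda>t. cis (of_int n * t)) k + (if k \<in> K then a k else 0)"
    using insert by (subst fourier_coeff_add) (auto intro!: continuous_intros simp: fourier_coeff_scale)
  finally show ?case using insert by (auto simp: fourier_coeff_cis)
qed (simp add: fourier_coeff_def)

lemma integral_times_trig_poly:
  assumes "continuous_on {0..2 * pi} f" "finite K"
  shows "integral {0..2 * pi} (\<lambda>t. f t * (\<Sum>k\<in>K. a k * cis (- (of_int k * t)))) =
    2 * pi * (\<Sum>k\<in>K. a k * fourier_coeff f k)"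
proof -
  have "integral {0..2 * pi} (\<lambda>t. f t * (\<Sum>k\<in>K. a k * cis (- (of_int k * t)))) =
      integral {0..2 * pi} (\<lambda>t. \<Sum>k\<in>K. a k * (f t * cis (- (of_int k * t))))"
    by (simp add: sum_distrib_left mult_ac)
  also have "\<dots> = (\<Sum>k\<in>K. a k * integral {0..2 * pi} (\<lambda>t. f t * cis (- (of_int k * t))))"
    using assms by (subst integral_sum) (auto intro!: integrable_on_mult_right integrable_on_times_cis)
  also have "\<dots> = 2 * pi * (\<Sum>k\<in>K. a k * fourier_coeff f k)"
    by (simp add: fourier_coeff_def sum_distrib_left)
  finally show ?thesis .
qed

text \<open>For the partial sum \<open>p\<close> over \<open>K\<close>, the remainder
  \<open>h - p\<close> has no coefficients in \<open>K\<close> and is therefore orthogonal to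
  \<open>p\<close>. Expanding the square of \<open>h = p + (h - p)\<close> gives Pythagoras, and the
  mass of the remainder is dropped.\<close>

lemma bessel_inequality:
  assumes h: "continuous_on {0..2 * pi} h" and K: "finite K"
  shows "2 * pi * (\<Sum>k\<in>K. (cmod (fourier_coeff h k))\<^sup>2) \<le> integral {0..2 * pi} (\<lambda>t. (cmod (h t))\<^sup>2)"
proof -
  define p where "p t = (\<Sum>k\<in>K. fourier_coeff h k * cis (of_int k * t))" for t
  have p[continuous_intros]: "continuous_on {0..2 * pi} p"
    unfolding p_def by (intro continuous_intros)
  have cnj_p: "cnj (p t) = (\<Sum>k\<in>K. cnj (fourier_coeff h k) * cis (- (of_int k * t)))" for t
    by (simp add: p_def cis_cnj)
  have pk: "fourier_coeff p k = fourier_coeff h k" if "k \<in> K" for k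
    unfolding p_def using fourier_coeff_trig_poly[OF K] that by simp
  have "integral {0..2 * pi} (\<lambda>t. (h t - p t) * cnj (p t)) =
      2 * pi * (\<Sum>k\<in>K. cnj (fourier_coeff h k) * fourier_coeff (\<lambda>t. h t - p t) k)"
    unfolding cnj_p by (rule integral_times_trig_poly[OF _ K]) (intro continuous_intros h)
  also have "\<dots> = 0" using pk by (simp add: fourier_coeff_diff[OF h p])
  finally have orth: "integral {0..2 * pi} (\<lambda>t. (h t - p t) * cnj (p t)) = 0" .
  have "complex_of_real (integral {0..2 * pi} (\<lambda>t. (cmod (p t))\<^sup>2)) =
      integral {0..2 * pi} (\<lambda>t. p t * cnj (p t))"
    unfolding complex_norm_square[symmetric]
    by (subst integral_linear[OF _ bounded_linear_of_real, unfolded o_def])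
      (auto intro!: integrable_continuous_real continuous_intros)
  also have "\<dots> = 2 * pi * (\<Sum>k\<in>K. cnj (fourier_coeff h k) * fourier_coeff p k)"
    unfolding cnj_p by (rule integral_times_trig_poly[OF p K])
  also have "\<dots> = complex_of_real (2 * pi * (\<Sum>k\<in>K. (cmod (fourier_coeff h k))\<^sup>2))"
  proof -
    have "cnj z * z = complex_of_real ((cmod z)\<^sup>2)" for z
      by (simp only: complex_norm_square mult.commute)
    then show ?thesis using pk by (simp del: of_real_power)
  qed
  finally have norm_p: "integral {0..2 * pi} (\<lambda>t. (cmod (p t))\<^sup>2) =
      2 * pi * (\<Sum>k\<in>K. (cmod (fourier_coeff h k))\<^sup>2)"
    by (simp only: of_real_eq_iff)
  have split: "(cmod (h t))\<^sup>2 =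
      (cmod (p t))\<^sup>2 + (cmod (h t - p t))\<^sup>2 + 2 * Re ((h t - p t) * cnj (p t))" for t
    unfolding cmod_power2 by (simp add: power2_eq_square) (simp add: algebra_simps)
  have int: "(\<lambda>t. (h t - p t) * cnj (p t)) integrable_on {0..2 * pi}"
    by (intro integrable_continuous_real continuous_intros h)
  have "integral {0..2 * pi} (\<lambda>t. Re ((h t - p t) * cnj (p t))) = 0"
    using orth integral_linear[OF int bounded_linear_Re] by (simp add: o_def)
  moreover have "integral {0..2 * pi} (\<lambda>t. (cmod (h t))\<^sup>2) = integral {0..2 * pi} (\<lambda>t. (cmod (p t))\<^sup>2) +
      integral {0..2 * pi} (\<lambda>t. (cmod (h t - p t))\<^sup>2) + 2 * integral {0..2 * pi} (\<lambda>t. Re ((h t -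
          p t) * cnj (p t)))"
    unfolding split
    by (subst integral_add integral_mult_right;
        (intro integrable_continuous_real continuous_intros h integrable_add)?)+ simp
  moreover have "0 \<le> integral {0..2 * pi} (\<lambda>t. (cmod (h t - p t))\<^sup>2)"
    by (intro integral_nonneg integrable_continuous_real continuous_intros h) auto
  ultimately show ?thesis using norm_p by simp
qed

lemma summable_on_fourier_coeff_square:
  assumes "continuous_on {0..2 * pi} h"
  shows "(\<lambda>k. (cmod (fourier_coeff h k))\<^sup>2) summable_on UNIV"
proof (rule nonneg_bdd_above_summable_on)
  show "bdd_above (sum (\<lambda>k. (cmod (fourier_coeff h k))\<^sup>2) ` {F. F \<subseteq> UNIV \<and> finite F})"
  proof (rule bdd_aboveI2)
    fix F :: "int set" assume "F \<in> {F. F \<subseteq> UNIV \<and> finite F}"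
    then show "(\<Sum>k\<in>F. (cmod (fourier_coeff h k))\<^sup>2) \<le> integral {0..2 * pi} (\<lambda>t. (cmod (h t))\<^sup>2) / (2 * pi)"
      using bessel_inequality[OF assms, of F] by (simp add: field_simps)
  qed
qed simp

text \<open>Square summability over all integers is inherited along an injective sequence of
  frequencies. Leaving \<open>\<sigma>\<close> free covers both ends of a symmetric
  interval.\<close>

lemma riemann_lebesgue:
  assumes "continuous_on {0..2 * pi} h" "inj \<sigma>"
  shows "(\<lambda>n::nat. fourier_coeff h (\<sigma> n)) \<longlonglongrightarrow> 0"
proof -
  have "(\<lambda>k. (cmod (fourier_coeff h k))\<^sup>2) summable_on range \<sigma>"
    using summable_on_fourier_coeff_square[OF assms(1)] by (rule summable_on_subset_banach) simp
  then have "(\<lambda>n. (cmod (fourier_coeff h (\<sigma> n)))\<^sup>2) summable_on UNIV"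
    using assms(2) by (simp add: summable_on_reindex o_def)
  then have "summable (\<lambda>n. (cmod (fourier_coeff h (\<sigma> n)))\<^sup>2)"
    by (subst (asm) summable_on_UNIV_nonneg_real_iff) auto
  then have "(\<lambda>n. (cmod (fourier_coeff h (\<sigma> n)))\<^sup>2) \<longlonglongrightarrow> 0" by (rule summable_LIMSEQ_zero)
  then have "(\<lambda>n. sqrt ((cmod (fourier_coeff h (\<sigma> n)))\<^sup>2)) \<longlonglongrightarrow> sqrt 0" by (intro tendsto_intros)
  then show ?thesis by (simp add: tendsto_norm_zero_iff)
qed


section \<open>Continuously differentiable functions on the circle\<close>

lemma has_vector_derivative_cis:
  "((\<lambda>t. cis (c * t)) has_vector_derivative \<i> * of_real c * cis (c * t)) (at t)"
proof -
  have "((\<lambda>z. exp (\<i> * of_real c * z)) has_field_derivative \<i> * of_real c * exp (\<i> * of_real c * of_real t))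
      (at (of_real t))"
    by (auto intro!: derivative_eq_intros)
  then have "((\<lambda>t. exp (\<i> * of_real c * of_real t)) has_vector_derivative
      \<i> * of_real c * exp (\<i> * of_real c * of_real t)) (at t)"
    by (rule has_vector_derivative_real_field)
  then show ?thesis by (simp add: cis_conv_exp mult.assoc)
qed

text \<open>The limit form of the derivative, in which two difference quotients can be divided by
  each other; this is needed at the removable singularity in Chernoff's argument.\<close>

lemma has_vector_derivative_quotient:
  assumes "(f has_vector_derivative D) (at x)"
  shows "((\<lambda>y. (f y - f x) /\<^sub>R (y - x)) \<longlongrightarrow> D) (at x)"
proof -
  have "((\<lambda>y. norm (f y - f x - (y - x) *\<^sub>R D) / norm (y - x)) \<longlongrightarrow> 0) (at x)"
    using assms unfolding has_vector_derivative_def has_derivative_iff_norm by simp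
  moreover have "\<forall>\<^sub>F y in at x. norm (f y - f x - (y - x) *\<^sub>R D) / norm (y - x) =
      norm ((f y - f x) /\<^sub>R (y - x) - D)"
    unfolding eventually_at_filter
  proof (intro always_eventually allI impI)
    fix y assume "y \<noteq> x"
    then have "(f y - f x) /\<^sub>R (y - x) - D = (f y - f x - (y - x) *\<^sub>R D) /\<^sub>R (y - x)"
      by (simp add: scaleR_diff_right)
    then show "norm (f y - f x - (y - x) *\<^sub>R D) / norm (y - x) = norm ((f y - f x) /\<^sub>R (y - x) - D)"
      by (simp add: divide_inverse mult.commute)
  qed
  ultimately have "((\<lambda>y. norm ((f y - f x) /\<^sub>R (y - x) - D)) \<longlongrightarrow> 0) (at x)"
    by (rule Lim_transform_eventually)
  then show ?thesis by (simp add: tendsto_norm_zero_iff LIM_zero_iff)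
qed

text \<open>The form in which \<open>\<alpha> > 1\<close> is used: functions in the Hoelder space
  are of this kind, with \<open>g'\<close> the first derivative.\<close>

locale C1_circle =
  fixes g g' :: "real \<Rightarrow> complex"
  assumes circle: "circle_fun g" and deriv: "\<And>t. (g has_vector_derivative g' t) (at t)"
    and cont': "continuous_on UNIV g'"
begin

lemma cont: "continuous_on A g"
  by (meson continuous_at_imp_continuous_on deriv has_vector_derivative_continuous)

text \<open>Integration by parts over a full period, where the boundary terms cancel.\<close>

lemma fourier_coeff_deriv: "fourier_coeff g' k = \<i> * of_int k * fourier_coeff g k"
proof -
  let ?c = "\<lambda>t. cis (- (of_int k * t))"
  have c: "(?c has_vector_derivative - (\<i> * of_int k) * ?c t) (at t)" for t
    using has_vector_derivative_cis[of "- of_int k" t] by simp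
  have "((\<lambda>t. g' t * ?c t - \<i> * of_int k * (g t * ?c t)) has_integral g (2 * pi) * ?c (2 * pi) -
      g 0 * ?c 0) {0..2 * pi}"
  proof (rule fundamental_theorem_of_calculus)
    fix t :: real
    have "((\<lambda>t. g t * ?c t) has_vector_derivative g t * (- (\<i> * of_int k) * ?c t) + g' t * ?c t) (at t)"
      by (rule has_vector_derivative_mult[OF deriv c])
    then show "((\<lambda>t. g t * ?c t) has_vector_derivative g' t * ?c t - \<i> * of_int k * (g t *
        ?c t)) (at t within {0..2 * pi})"
      by (auto intro: has_vector_derivative_at_within simp: algebra_simps)
  qed simp
  moreover have "g (2 * pi) * ?c (2 * pi) - g 0 * ?c 0 = 0"
  proof -
    have "?c (2 * pi) = cis (2 * pi * of_int (- k))" by (simp add: mult.commute)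
    also have "\<dots> = 1" by (rule cis_multiple_2pi) simp
    finally show ?thesis using circle unfolding circle_fun_def
        by (metis add_0 cis_zero minus_zero mult_zero_right diff_self)
  qed
  ultimately have "integral {0..2 * pi} (\<lambda>t. g' t * ?c t - \<i> * of_int k * (g t * ?c t)) = 0"
    by (simp add: integral_unique)
  moreover have "integral {0..2 * pi} (\<lambda>t. g' t * ?c t - \<i> * of_int k * (g t * ?c t)) =
      integral {0..2 * pi} (\<lambda>t. g' t * ?c t) - \<i> * of_int k * integral {0..2 * pi} (\<lambda>t. g t * ?c t)"
    using cont continuous_on_subset[OF cont' subset_UNIV]
    by (subst integral_diff) (auto intro!: integrable_on_times_cis integrable_on_mult_right)
  ultimately show ?thesis by (simp add: fourier_coeff_def)
qed

text \<open>Away from 0 the modulus is \<open>x * y\<close> with \<open>x\<close> the modulus of the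
  coefficient of \<open>g'\<close> and \<open>y = 1 / \<bar>k\<bar>\<close>. Both are square
  summable, the former by Bessel's inequality, and \<open>x * y \<le> x\<^sup>2 + y\<^sup>2\<close>.
  The frequency 0 is added at the end.\<close>

lemma fourier_coeff_summable: "(\<lambda>k. cmod (fourier_coeff g k)) summable_on UNIV"
proof -
  let ?B = "\<lambda>k. (cmod (fourier_coeff g' k))\<^sup>2 + 1 / (of_int k)\<^sup>2"
  have "?B summable_on UNIV"
    by (intro summable_on_add summable_on_fourier_coeff_square summable_on_inverse_square_int
        continuous_on_subset[OF cont' subset_UNIV])
  then have "?B summable_on (UNIV - {0})" by (rule summable_on_subset_banach) simp
  moreover have "cmod (fourier_coeff g k) \<le> (cmod (fourier_coeff g' k))\<^sup>2 + 1 / (of_int k)\<^sup>2"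
      if "k \<noteq> 0" for k
  proof -
    define x where "x = cmod (fourier_coeff g' k)"
    define y where "y = 1 / \<bar>real_of_int k\<bar>"
    have "cmod (fourier_coeff g k) = x * y"
      using that by (simp add: x_def y_def fourier_coeff_deriv norm_mult)
    also have "\<dots> \<le> x\<^sup>2 + y\<^sup>2"
    proof -
      have "0 \<le> x * y" by (simp add: x_def y_def)
      then show ?thesis using sum_squares_bound[of x y] by linarith
    qed
    finally show ?thesis by (simp add: x_def y_def power_divide)
  qed
  ultimately have "(\<lambda>k. cmod (fourier_coeff g k)) summable_on (UNIV - {0})"
    by (rule summable_on_comparison_test) auto
  then show ?thesis
    using summable_on_insert_iff[of "\<lambda>k. cmod (fourier_coeff g k)" 0 "UNIV - {0}"]
        by (simp add: insert_UNIV)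
qed

text \<open>Chernoff's argument: \<open>g t - g t0 = h t * (cis t - cis t0)\<close> with a continuous \<open>h\<close>, so that the
  partial sums at \<open>t0\<close> telescope.\<close>

lemma fourier_partial_sum_LIMSEQ:
  assumes t0: "t0 \<in> {0<..<2 * pi}"
  shows "(\<lambda>n. \<Sum>k\<in>{- int n..int n}. fourier_coeff g k * cis (of_int k * t0)) \<longlonglongrightarrow> g t0"
proof -
  \<comment> \<open>The value at \<open>t0\<close> is the limit of the quotient, since
    \<open>cis\<close> has derivative \<open>\<i> * cis t0\<close> there; with it \<open>h\<close>
    is continuous and the Riemann-Lebesgue lemma applies.\<close>
  define h where "h t = (if t = t0 then g' t0 / (\<i> * cis t0) else (g t - g t0) / (cis t - cis t0))"
      for t
  \<comment> \<open>For \<open>t0\<close> in the open interval, \<open>t - t0\<close> stays strictly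
    below a full period even if \<open>t\<close> is an endpoint, so \<open>cis\<close> separates the
    two. If \<open>t0\<close> were an endpoint, this would fail at the other one.\<close>
  have cis_ne: "cis t \<noteq> cis t0" if "t \<in> {0..2 * pi}" "t \<noteq> t0" for t
  proof
    assume "cis t = cis t0"
    then have "cis (t - t0) = 1" by (metis cis_divide cis_neq_zero divide_self)
    then have "cos (t - t0) = 1" by (metis Re_complex_of_real cis.sel(1) of_real_1)
    then obtain n :: int where n: "t - t0 = of_int n * 2 * pi" using cos_one_2pi_int by blast
    moreover have "\<bar>t - t0\<bar> < 2 * pi" using that t0 by auto
    ultimately have "\<bar>real_of_int n\<bar> * (2 * pi) < 1 * (2 * pi)" by (simp add: abs_mult)
    then have "\<bar>real_of_int n\<bar> < 1" using pi_gt_zero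
        by (subst (asm) mult_less_cancel_right_pos) auto
    then have "n = 0" by linarith
    then show False using n that by simp
  qed
  have h: "continuous_on {0..2 * pi} h"
  proof (rule continuous_at_imp_continuous_on, intro ballI)
    fix s assume s: "s \<in> {0..2 * pi}"
    show "isCont h s"
    proof (cases "s = t0")
      case True
      have cis': "(cis has_vector_derivative \<i> * cis t0) (at t0)"
        using has_vector_derivative_cis[of 1 t0] by simp
      have "((\<lambda>t. ((g t - g t0) /\<^sub>R (t - t0)) / ((cis t - cis t0) /\<^sub>R (t - t0))) \<longlongrightarrow>
          g' t0 / (\<i> * cis t0)) (at t0)"
        using deriv[of t0] cis' by (intro tendsto_divide) (auto intro: has_vector_derivative_quotient)
      moreover have "\<forall>\<^sub>F t in at t0. ((g t - g t0) /\<^sub>R (t - t0)) / ((cis t - cis t0) /\<^sub>R (t - t0)) = h t"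
        unfolding eventually_at_filter by (auto simp: h_def scaleR_conv_of_real)
      ultimately have "(h \<longlongrightarrow> g' t0 / (\<i> * cis t0)) (at t0)" by (rule Lim_transform_eventually)
      then show ?thesis using True by (simp add: isCont_def h_def)
    next
      case False
      have "isCont (\<lambda>t. (g t - g t0) / (cis t - cis t0)) s"
        using cis_ne[OF s False] cont[of UNIV] has_vector_derivative_continuous[OF has_vector_derivative_cis[of 1 s]]
        by (intro continuous_intros) (auto simp: continuous_on_eq_continuous_at)
      moreover have "\<forall>\<^sub>F t in nhds s. (g t - g t0) / (cis t - cis t0) = h t"
        using t1_space_nhds[OF False] by eventually_elim (simp add: h_def)
      ultimately show ?thesis by (simp add: isCont_cong)
    qed
  qed
  have split: "fourier_coeff (\<lambda>t. g t - g t0) k = fourier_coeff h (k - 1) - cis t0 * fourier_coeff h k" for k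
  proof -
    have "fourier_coeff (\<lambda>t. g t - g t0) k = fourier_coeff (\<lambda>t. h t * cis t - cis t0 * h t) k"
      unfolding fourier_coeff_def
      by (intro arg_cong[where f="\<lambda>x. _ * x"] integral_cong) (use cis_ne in \<open>auto simp: h_def field_simps\<close>)
    also have "\<dots> = fourier_coeff (\<lambda>t. h t * cis t) k - cis t0 * fourier_coeff h k"
      by (subst fourier_coeff_diff) (auto intro!: continuous_intros h simp: fourier_coeff_scale)
    also have "fourier_coeff (\<lambda>t. h t * cis t) k = fourier_coeff h (k - 1)"
    proof -
      have "cis t * cis (- (of_int k * t)) = cis (- (of_int (k - 1) * t))" for t
        by (simp add: cis_mult algebra_simps)
      then show ?thesis by (simp only: fourier_coeff_def mult.assoc)
    qed
    finally show ?thesis .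
  qed
  \<comment> \<open>\<open>\<delta>\<close> holds the coefficients of the constant function
    \<open>g t0\<close>. Multiplying \<open>split\<close> by \<open>cis (of_int k * t0)\<close>
    turns its two terms into consecutive values of \<open>a\<close>, because the factor
    \<open>cis t0\<close> raises the frequency by one.\<close>
  define \<delta> where "\<delta> k = (if k = 0 then g t0 else 0)" for k :: int
  define a where "a k = cis (of_int k * t0) * fourier_coeff h (k - 1)" for k
  have const: "fourier_coeff (\<lambda>t. g t0) k = (if k = 0 then g t0 else 0)" for k
    using fourier_coeff_trig_poly[of "{0}" "\<lambda>_. g t0" k] by simp
  have "fourier_coeff g k * cis (of_int k * t0) = (a k - a (k + 1)) + \<delta> k" for k
  proof -
    have "fourier_coeff (\<lambda>t. g t - g t0) k = fourier_coeff g k - fourier_coeff (\<lambda>t. g t0) k"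
      by (rule fourier_coeff_diff) (auto intro: cont)
    then have "fourier_coeff g k = fourier_coeff h (k - 1) - cis t0 * fourier_coeff h k + \<delta> k"
      using split[of k] const[of k] by (simp add: \<delta>_def)
    then have "fourier_coeff g k * cis (of_int k * t0) =
        cis (of_int k * t0) * fourier_coeff h (k - 1) - cis (of_int k * t0) * cis t0 *
            fourier_coeff h k + \<delta> k * cis (of_int k * t0)"
      by (simp only:) (simp add: algebra_simps)
    moreover have "cis (of_int (k + 1) * t0) = cis (of_int k * t0) * cis t0"
      by (simp add: cis_mult algebra_simps)
    moreover have "\<delta> k * cis (of_int k * t0) = \<delta> k" by (simp add: \<delta>_def)
    ultimately show ?thesis by (simp add: a_def)
  qed
  then have "(\<Sum>k\<in>{- int n..int n}. fourier_coeff g k * cis (of_int k * t0)) =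
      (a (- int n) - a (int n + 1)) + g t0" for n
    by (simp only: sum.distrib sum_symmetric_telescope) (simp add: \<delta>_def)
  \<comment> \<open>Both boundary terms of the telescoping sum are, in modulus, coefficients of
    \<open>h\<close>, at the frequencies \<open>- int n - 1\<close> and
    \<open>int n\<close>.\<close>
  moreover have "(\<lambda>n. a (- int n)) \<longlonglongrightarrow> 0" "(\<lambda>n. a (int n + 1)) \<longlonglongrightarrow> 0"
  proof -
    have "(\<lambda>n. cmod (fourier_coeff h (- int n - 1))) \<longlonglongrightarrow> 0" "(\<lambda>n. cmod (fourier_coeff h (int n))) \<longlonglongrightarrow> 0"
      using riemann_lebesgue[OF h, of "\<lambda>n. - int n - 1"] riemann_lebesgue[OF h, of int]
      by (auto simp: inj_def tendsto_norm_zero_iff)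
    then show "(\<lambda>n. a (- int n)) \<longlonglongrightarrow> 0" "(\<lambda>n. a (int n + 1)) \<longlonglongrightarrow> 0"
      by (subst tendsto_norm_zero_iff[symmetric]; simp add: a_def norm_mult)+
  qed
  then have "(\<lambda>n. (a (- int n) - a (int n + 1)) + g t0) \<longlonglongrightarrow> (0 - 0) + g t0"
    by (intro tendsto_intros)
  ultimately show ?thesis by simp
qed

text \<open>The pairing of a partial sum of \<open>g\<close> with \<open>f\<close> is a finite sum
  of products of coefficients at opposite frequencies, which gives the bound. The partial sums stay
  below the sum of all \<open>cmod (fourier_coeff g k)\<close>, so dominated convergence carries the
  bound over to \<open>g\<close>. With \<open>B\<close> the Sobolev norm of \<open>f\<close>, it
  shows that \<open>g\<close> acts continuously on \<open>H1\<close>.\<close>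

lemma norm_integral_times_le:
  assumes f: "continuous_on {0..2 * pi} f" and B: "\<And>k. cmod (fourier_coeff f k) \<le> B"
  shows "cmod (1 / (2 * pi) * integral {0..2 * pi} (\<lambda>t. g t * f t)) \<le> (\<Sum>\<^sub>\<infinity>k. cmod (fourier_coeff g k)) * B"
proof -
  define S where "S = (\<Sum>\<^sub>\<infinity>k. cmod (fourier_coeff g k))"
  define G where "G n t = (\<Sum>k\<in>{- int n..int n}. fourier_coeff g k * cis (of_int k * t))" for n t
  have fin_le: "(\<Sum>k\<in>K. cmod (fourier_coeff g k)) \<le> S" if "finite K" for K
    unfolding S_def using fourier_coeff_summable that by (intro finite_sum_le_infsum) auto
  have "0 \<le> B" using B[of 0] norm_ge_zero order_trans by blast
  have Gn: "1 / (2 * pi) * integral {0..2 * pi} (\<lambda>t. G n t * f t) =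
      (\<Sum>k\<in>{- int n..int n}. fourier_coeff g k * fourier_coeff f (- k))" for n
  proof -
    have "integral {0..2 * pi} (\<lambda>t. G n t * f t) =
        integral {0..2 * pi} (\<lambda>t. \<Sum>k\<in>{- int n..int n}. fourier_coeff g k * (f t *
        cis (- (of_int (- k) * t))))"
      by (simp add: G_def sum_distrib_left sum_distrib_right mult_ac)
    also have "\<dots> = (\<Sum>k\<in>{- int n..int n}. fourier_coeff g k * integral {0..2 * pi} (\<lambda>t. f t *
        cis (- (of_int (- k) * t))))"
      using f by (subst integral_sum) (auto intro!: integrable_on_mult_right integrable_on_times_cis[of _ "- _", simplified])
    finally show ?thesis by (simp add: fourier_coeff_def sum_distrib_left mult_ac)
  qed
  have bound: "cmod (1 / (2 * pi) * integral {0..2 * pi} (\<lambda>t. G n t * f t)) \<le> S * B" for n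
  proof -
    have "cmod (\<Sum>k\<in>{- int n..int n}. fourier_coeff g k * fourier_coeff f (- k)) \<le>
        (\<Sum>k\<in>{- int n..int n}. cmod (fourier_coeff g k) * B)"
      by (rule sum_norm_le) (auto simp: norm_mult intro!: mult_left_mono B)
    also have "\<dots> \<le> S * B"
      unfolding sum_distrib_right[symmetric] using \<open>0 \<le> B\<close> by (intro mult_right_mono fin_le) auto
    finally show ?thesis unfolding Gn .
  qed
  \<comment> \<open>Convergence of the partial sums is known in the open interval; the endpoints do
    not affect the integral.\<close>
  have open_int: "integral {0..2 * pi} F = integral {0<..<2 * pi} F" for F :: "real \<Rightarrow> complex"
    using integral_open_interval[of 0 "2 * pi" F] by (simp add: box_real)
  obtain M where M: "\<And>t. t \<in> {0..2 * pi} \<Longrightarrow> cmod (f t) \<le> M"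
    using compact_imp_bounded[OF compact_continuous_image[OF f compact_Icc]] unfolding bounded_iff
        by blast
  have G_le: "cmod (G n t) \<le> S" for n t
    unfolding G_def by (rule order_trans[OF norm_sum]) (simp add: norm_mult fin_le)
  have Gf: "(\<lambda>t. G n t * f t) integrable_on {0<..<2 * pi}" for n
    using integrable_on_open_interval[of "\<lambda>t. G n t * f t" 0 "2 * pi"] f
    by (auto simp: box_real G_def intro!: integrable_continuous_real continuous_intros)
  have "(\<lambda>n. integral {0<..<2 * pi} (\<lambda>t. G n t * f t)) \<longlonglongrightarrow> integral {0<..<2 * pi} (\<lambda>t. g t * f t)"
  proof (rule dominated_convergence(2)[where h="\<lambda>_. S * M"])
    show "(\<lambda>_. S * M) integrable_on {0<..<2 * pi}"
      using integrable_on_open_interval[of "\<lambda>_. S * M" 0 "2 * pi"] by (auto simp: box_real)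
    show "norm (G n t * f t) \<le> S * M" if "t \<in> {0<..<2 * pi}" for n t
      using M[of t] that G_le[of n t]
          by (auto simp: norm_mult intro!: mult_mono order_trans[OF norm_ge_zero])
    show "(\<lambda>n. G n t * f t) \<longlonglongrightarrow> g t * f t" if "t \<in> {0<..<2 * pi}" for t
      unfolding G_def by (intro tendsto_intros fourier_partial_sum_LIMSEQ that)
  qed (rule Gf)
  then have "(\<lambda>n. cmod (1 / (2 * pi) * integral {0..2 * pi} (\<lambda>t. G n t * f t))) \<longlonglongrightarrow>
      cmod (1 / (2 * pi) * integral {0..2 * pi} (\<lambda>t. g t * f t))"
    unfolding open_int by (intro tendsto_intros)
  then show ?thesis unfolding S_def[symmetric] by (rule LIMSEQ_le_const2) (use bound in auto)
qed

end

section \<open>The Sobolev space and its dual\<close>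

lemma H1D:
  assumes "f \<in> H1"
  shows "circle_fun f" "continuous_on A f"
    "(\<lambda>k::int. (1 + (of_int k)\<^sup>2) * (cmod (fourier_coeff f k))\<^sup>2) summable_on UNIV"
  using assms continuous_on_subset[of UNIV f A] by (auto simp: H1_def)

lemma H1_norm_square:
  "(H1_norm f)\<^sup>2 = (\<Sum>\<^sub>\<infinity>k::int. (1 + (of_int k)\<^sup>2) * (cmod (fourier_coeff f k))\<^sup>2)"
  unfolding H1_norm_def by (intro real_sqrt_pow2 infsum_nonneg) auto

lemma sum_le_H1_norm_square:
  assumes "f \<in> H1" "finite K"
  shows "(\<Sum>k\<in>K. (1 + (of_int k)\<^sup>2) * (cmod (fourier_coeff f k))\<^sup>2) \<le> (H1_norm f)\<^sup>2"
  unfolding H1_norm_square using H1D(3)[OF assms(1)] assms(2) by (intro finite_sum_le_infsum) auto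

lemma fourier_coeff_le_H1_norm:
  assumes "f \<in> H1"
  shows "cmod (fourier_coeff f k) \<le> H1_norm f"
proof (rule power2_le_imp_le)
  have "(cmod (fourier_coeff f k))\<^sup>2 \<le> (1 + (of_int k)\<^sup>2) * (cmod (fourier_coeff f k))\<^sup>2"
    by (simp add: distrib_right)
  also have "\<dots> \<le> (H1_norm f)\<^sup>2" using sum_le_H1_norm_square[OF assms, of "{k}"] by simp
  finally show "(cmod (fourier_coeff f k))\<^sup>2 \<le> (H1_norm f)\<^sup>2" .
qed (rule H1_norm_nonneg)

lemma H1_add:
  assumes f: "f \<in> H1" and g: "g \<in> H1"
  shows "(\<lambda>t. f t + g t) \<in> H1"
proof -
  let ?s = "\<lambda>f (k::int). (1 + (of_int k)\<^sup>2) * (cmod (fourier_coeff f k))\<^sup>2"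
  have "(\<lambda>k. 2 * (?s f k + ?s g k)) summable_on UNIV"
    by (intro summable_on_cmult_right summable_on_add H1D f g)
  moreover have "?s (\<lambda>t. f t + g t) k \<le> 2 * (?s f k + ?s g k)" for k
  proof -
    have "(cmod (fourier_coeff f k + fourier_coeff g k))\<^sup>2 \<le>
        (cmod (fourier_coeff f k) + cmod (fourier_coeff g k))\<^sup>2"
      by (intro power_mono norm_triangle_ineq) simp
    also have "\<dots> \<le> 2 * ((cmod (fourier_coeff f k))\<^sup>2 + (cmod (fourier_coeff g k))\<^sup>2)"
      using sum_squares_bound[of "cmod (fourier_coeff f k)" "cmod (fourier_coeff g k)"]
          by (simp add: power2_sum)
    finally have "(cmod (fourier_coeff (\<lambda>t. f t + g t) k))\<^sup>2 \<le>
        2 * ((cmod (fourier_coeff f k))\<^sup>2 + (cmod (fourier_coeff g k))\<^sup>2)"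
      using f g by (simp add: fourier_coeff_add H1D)
    then have "?s (\<lambda>t. f t + g t) k \<le>
        (1 + (of_int k)\<^sup>2) * (2 * ((cmod (fourier_coeff f k))\<^sup>2 + (cmod (fourier_coeff g k))\<^sup>2))"
      by (intro mult_left_mono) auto
    then show ?thesis by (simp add: algebra_simps)
  qed
  ultimately have "?s (\<lambda>t. f t + g t) summable_on UNIV"
    by (rule summable_on_comparison_test) auto
  moreover have "circle_fun (\<lambda>t. f t + g t)" using H1D(1)[OF f] H1D(1)[OF g]
      by (simp add: circle_fun_def)
  moreover have "continuous_on UNIV (\<lambda>t. f t + g t)" by (intro continuous_intros H1D f g)
  ultimately show ?thesis by (simp add: H1_def)
qed

lemma H1_trig_poly:
  assumes "finite K"
  shows "(\<lambda>t. \<Sum>k\<in>K. a k * cis (of_int k * t)) \<in> H1"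
  using assms
proof (induction K)
  case empty
  then show ?case using H1_scale(1)[OF cis_in_H1, of 0] by simp
next
  case (insert n K)
  then show ?case using H1_add[OF H1_scale(1)[OF cis_in_H1] insert.IH] by simp
qed

lemma Hm1D:
  assumes "y \<in> Hm1"
  shows "f \<in> H1 \<Longrightarrow> g \<in> H1 \<Longrightarrow> y (\<lambda>t. f t + g t) = y f + y g"
    and "f \<in> H1 \<Longrightarrow> y (\<lambda>t. c * f t) = c * y f"
    and "\<exists>K\<ge>0. \<forall>f\<in>H1. cmod (y f) \<le> K * H1_norm f"
proof -
  show "f \<in> H1 \<Longrightarrow> g \<in> H1 \<Longrightarrow> y (\<lambda>t. f t + g t) = y f + y g" "f \<in> H1 \<Longrightarrow> y (\<lambda>t. c * f t) = c * y f"
    using assms by (auto simp: Hm1_def)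
  obtain K where "\<And>f. f \<in> H1 \<Longrightarrow> cmod (y f) \<le> K * H1_norm f" using assms unfolding Hm1_def by blast
  then have "\<And>f. f \<in> H1 \<Longrightarrow> cmod (y f) \<le> \<bar>K\<bar> * H1_norm f"
    by (meson H1_norm_nonneg abs_ge_self mult_right_mono order_trans)
  then show "\<exists>K\<ge>0. \<forall>f\<in>H1. cmod (y f) \<le> K * H1_norm f" by (intro exI[of _ "\<bar>K\<bar>"]) auto
qed

text \<open>\<open>Hm1_coeff y k\<close> is the value of \<open>y\<close> at the frequency
  \<open>- k\<close>, whence the sign on the right.\<close>

lemma Hm1_trig_poly:
  assumes y: "y \<in> Hm1" and "finite K"
  shows "y (\<lambda>t. \<Sum>k\<in>K. a k * cis (of_int k * t)) = (\<Sum>k\<in>K. a k * Hm1_coeff y (- k))"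
  using assms(2)
proof (induction K)
  case empty
  show ?case using Hm1D(2)[OF y cis_in_H1, of 0] by simp
next
  case (insert n K)
  then show ?case
    using Hm1D(1)[OF y H1_scale(1)[OF cis_in_H1] H1_trig_poly[OF insert.hyps(1)]] Hm1D(2)[OF y cis_in_H1]
    by (simp add: Hm1_coeff_def)
qed

lemma Hm1_add_in:
  assumes y: "y \<in> Hm1" and z: "z \<in> Hm1"
  shows "Hm1_add y z \<in> Hm1"
proof -
  obtain A B where A: "\<And>f. f \<in> H1 \<Longrightarrow> cmod (y f) \<le> A * H1_norm f" and B: "\<And>f. f \<in> H1 \<Longrightarrow> cmod (z f) \<le>
      B * H1_norm f"
    using Hm1D(3)[OF y] Hm1D(3)[OF z] by metis
  have "cmod (y f + z f) \<le> (A + B) * H1_norm f" if "f \<in> H1" for f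
    using A[OF that] B[OF that] norm_triangle_ineq[of "y f" "z f"] by (simp add: distrib_right)
  then show ?thesis
    using Hm1D(1,2)[OF y] Hm1D(1,2)[OF z] H1_add H1_scale(1)
    by (auto simp: Hm1_def Hm1_add_def distrib_left)
qed

lemma Hm1_coeff_add: "Hm1_coeff (Hm1_add y z) k = Hm1_coeff y k + Hm1_coeff z k"
  using cis_in_H1[of "- k"] by (simp add: Hm1_coeff_def Hm1_add_def)

lemma Hm1_diff_in:
  assumes y: "y \<in> Hm1" and z: "z \<in> Hm1"
  shows "(\<lambda>f\<in>H1. y f - z f) \<in> Hm1"
proof -
  obtain A B where A: "\<And>f. f \<in> H1 \<Longrightarrow> cmod (y f) \<le> A * H1_norm f" and B: "\<And>f. f \<in> H1 \<Longrightarrow> cmod (z f) \<le>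
      B * H1_norm f"
    using Hm1D(3)[OF y] Hm1D(3)[OF z] by metis
  have "cmod (y f - z f) \<le> (A + B) * H1_norm f" if "f \<in> H1" for f
    using A[OF that] B[OF that] norm_triangle_ineq4[of "y f" "z f"] by (simp add: distrib_right)
  then show ?thesis
    using Hm1D(1,2)[OF y] Hm1D(1,2)[OF z] H1_add H1_scale(1)
    by (auto simp: Hm1_def right_diff_distrib)
qed

lemma (in C1_circle) Hm1_of_fun_in: "Hm1_of_fun g \<in> Hm1"
proof -
  have int: "(\<lambda>t. g t * f t) integrable_on {0..2 * pi}" if "f \<in> H1" for f
    using that by (intro integrable_continuous_real continuous_intros cont H1D)
  have "Hm1_of_fun g (\<lambda>t. f t + f' t) = Hm1_of_fun g f + Hm1_of_fun g f'" if "f \<in> H1" "f' \<in> H1"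
      for f f'
    using that int H1_add[OF that]
        by (simp add: Hm1_of_fun_def distrib_left integral_add add_divide_distrib)
  moreover have "Hm1_of_fun g (\<lambda>t. c * f t) = c * Hm1_of_fun g f" if "f \<in> H1" for f c
    using that int H1_scale(1)[OF that] by (simp add: Hm1_of_fun_def mult.left_commute)
  moreover have "cmod (Hm1_of_fun g f) \<le> (\<Sum>\<^sub>\<infinity>k. cmod (fourier_coeff g k)) * H1_norm f" if "f \<in> H1"
      for f
    using norm_integral_times_le[OF H1D(2)[OF that] fourier_coeff_le_H1_norm[OF that]] that
    by (simp add: Hm1_of_fun_def)
  moreover have "Hm1_of_fun g \<in> extensional H1" by (simp add: Hm1_of_fun_def)
  ultimately show ?thesis unfolding Hm1_def by blast
qed

subsection \<open>The Borel sets of the dual Sobolev space\<close>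

lemma Hm1_norm_upper:
  assumes u: "u \<in> Hm1" and f: "f \<in> H1"
  shows "cmod (u f) \<le> Hm1_norm u * H1_norm f"
proof -
  obtain K where K: "K \<ge> 0" "\<And>f. f \<in> H1 \<Longrightarrow> cmod (u f) \<le> K * H1_norm f" using Hm1D(3)[OF u] by blast
  have bdd: "bdd_above ((\<lambda>f. cmod (u f)) ` {f \<in> H1. H1_norm f \<le> 1})"
  proof (rule bdd_aboveI2)
    fix f assume "f \<in> {f \<in> H1. H1_norm f \<le> 1}"
    then show "cmod (u f) \<le> K" using K(2)[of f] K(1) mult_left_le[of "H1_norm f" K] by auto
  qed
  show ?thesis
  proof (cases "H1_norm f = 0")
    case True
    then show ?thesis using K(2)[OF f] by simp
  next
    case False
    then have pos: "0 < H1_norm f" using H1_norm_nonneg[of f] by simp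
    define c where "c = complex_of_real (1 / H1_norm f)"
    have "(\<lambda>t. c * f t) \<in> {f \<in> H1. H1_norm f \<le> 1}"
      using H1_scale[OF f, of c] pos by (simp add: c_def norm_divide)
    then have "cmod (u (\<lambda>t. c * f t)) \<le> Hm1_norm u"
      unfolding Hm1_norm_def by (rule cSUP_upper[OF _ bdd])
    then show ?thesis
      using pos unfolding Hm1D(2)[OF u f] by (simp add: norm_mult c_def norm_divide field_simps)
  qed
qed

lemma Hm1_norm_least:
  assumes "\<And>f. f \<in> H1 \<Longrightarrow> H1_norm f \<le> 1 \<Longrightarrow> cmod (u f) \<le> B"
  shows "Hm1_norm u \<le> B"
proof -
  have "(\<lambda>t. 0 * cis (of_int 0 * t)) \<in> {f \<in> H1. H1_norm f \<le> 1}"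
    using H1_scale[OF cis_in_H1, of 0 0] by simp
  then show ?thesis unfolding Hm1_norm_def using assms by (intro cSUP_least) auto
qed

text \<open>The partial sums of the squared Sobolev norm of order \<open>-1\<close>, read off from a
  coefficient sequence. With \<open>n\<close> finite they make sense for arbitrary sequences and are
  visibly measurable in the coefficients.\<close>

definition weighted_sum :: "nat \<Rightarrow> (int \<Rightarrow> complex) \<Rightarrow> real" where
  "weighted_sum n a = (\<Sum>k\<in>{- int n..int n}. (cmod (a k))\<^sup>2 / (1 + (of_int k)\<^sup>2))"

lemma sum_symmetric_uminus:
  "(\<Sum>k\<in>{- int n..int n}. f (- k)) = (\<Sum>k\<in>{- int n..int n}. f k)"
  by (rule sum.reindex_bij_witness[of _ uminus uminus]) auto

lemma one_plus_square_pos: "0 < 1 + (real_of_int k)\<^sup>2"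
  by (simp add: add_pos_nonneg)

text \<open>The test function \<open>f\<close> is the Riesz representative of the truncated
  functional: its coefficient at \<open>k\<close> is the conjugate of that of \<open>u\<close> at
  \<open>- k\<close>, divided by \<open>1 + k\<^sup>2\<close>. Then \<open>u f\<close> and the
  square of \<open>H1_norm f\<close> both equal the weighted sum \<open>s\<close>, so that
  \<open>s \<le> Hm1_norm u * sqrt s\<close>.\<close>

lemma weighted_sum_le_Hm1_norm:
  assumes u: "u \<in> Hm1"
  shows "weighted_sum n (Hm1_coeff u) \<le> (Hm1_norm u)\<^sup>2"
proof -
  let ?I = "{- int n..int n}"
  define s where "s = weighted_sum n (Hm1_coeff u)"
  define a where "a k = cnj (Hm1_coeff u (- k)) / (1 + (of_int k)\<^sup>2)" for k
  define f where "f t = (\<Sum>k\<in>?I. a k * cis (of_int k * t))" for t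
  have f: "f \<in> H1" unfolding f_def by (rule H1_trig_poly) simp
  have s0: "0 \<le> s" unfolding s_def weighted_sum_def by (intro sum_nonneg) auto
  have "u f = (\<Sum>k\<in>?I. a k * Hm1_coeff u (- k))" unfolding f_def by (rule Hm1_trig_poly[OF u]) simp
  also have "\<dots> = (\<Sum>k\<in>?I. complex_of_real ((cmod (Hm1_coeff u (- k)))\<^sup>2 / (1 + (of_int (- k))\<^sup>2)))"
  proof (rule sum.cong[OF refl])
    fix k
    have "cnj z * z = complex_of_real ((cmod z)\<^sup>2)" for z
        by (simp only: complex_norm_square mult.commute)
    then show "a k * Hm1_coeff u (- k) =
        complex_of_real ((cmod (Hm1_coeff u (- k)))\<^sup>2 / (1 + (of_int (- k))\<^sup>2))"
      by (simp add: a_def)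
  qed
  also have "\<dots> = of_real s"
    unfolding s_def weighted_sum_def of_real_sum by (rule sum_symmetric_uminus)
  finally have uf: "u f = of_real s" .
  have coeff: "fourier_coeff f k = (if k \<in> ?I then a k else 0)" for k
    unfolding f_def by (rule fourier_coeff_trig_poly) simp
  have "(H1_norm f)\<^sup>2 = (\<Sum>k\<in>?I. (1 + (of_int k)\<^sup>2) * (cmod (a k))\<^sup>2)"
  proof -
    have "(H1_norm f)\<^sup>2 = (\<Sum>\<^sub>\<infinity>k\<in>?I. (1 + (of_int k)\<^sup>2) * (cmod (a k))\<^sup>2)"
      unfolding H1_norm_square by (rule infsum_cong_neutral) (auto simp: coeff)
    then show ?thesis by simp
  qed
  also have "\<dots> = (\<Sum>k\<in>?I. (cmod (Hm1_coeff u (- k)))\<^sup>2 / (1 + (of_int (- k))\<^sup>2))"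
  proof (rule sum.cong[OF refl])
    fix k :: int
    define c where "c = 1 + (real_of_int k)\<^sup>2"
    have "c > 0" unfolding c_def by (rule one_plus_square_pos)
    have "cmod (1 + (of_int k)\<^sup>2) = c"
      using \<open>c > 0\<close>
          by (metis abs_of_pos c_def norm_of_real of_real_1 of_real_add of_real_of_int_eq of_real_power)
    then have "cmod (a k) = cmod (Hm1_coeff u (- k)) / c" by (simp add: a_def norm_divide)
    then show "(1 + (of_int k)\<^sup>2) * (cmod (a k))\<^sup>2 = (cmod (Hm1_coeff u (- k)))\<^sup>2 / (1 + (of_int (- k))\<^sup>2)"
      using \<open>c > 0\<close> by (simp add: c_def[symmetric] power_divide) (simp add: power2_eq_square)
  qed
  also have "\<dots> = s" unfolding s_def weighted_sum_def by (rule sum_symmetric_uminus)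
  finally have nf: "H1_norm f = sqrt s" using H1_norm_nonneg[of f]
      by (metis real_sqrt_abs abs_of_nonneg)
  have "s \<le> Hm1_norm u * sqrt s" using Hm1_norm_upper[OF u f] s0 by (simp add: uf nf)
  then have "sqrt s * sqrt s \<le> Hm1_norm u * sqrt s" using s0 by simp
  \<comment> \<open>The factor \<open>sqrt s\<close> can be cancelled unless it is 0, and then the
    claim is that the dual norm is nonnegative.\<close>
  then have "sqrt s \<le> Hm1_norm u \<or> sqrt s = 0"
    using s0 by (metis mult_right_le_imp_le order_le_less real_sqrt_ge_0_iff)
  moreover have "0 \<le> Hm1_norm u"
  proof -
    have "0 \<le> cmod (u (\<lambda>t. cis (of_int 0 * t)))" by simp
    also have "\<dots> \<le> Hm1_norm u * H1_norm (\<lambda>t. cis (of_int 0 * t))"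
        by (rule Hm1_norm_upper[OF u cis_in_H1])
    finally have "0 \<le> Hm1_norm u * H1_norm (\<lambda>t. cis (of_int 0 * t))" .
    moreover have "0 < H1_norm (\<lambda>t. cis (of_int 0 * t))"
      using fourier_coeff_le_H1_norm[OF cis_in_H1[of 0], of 0] fourier_coeff_cis[of 0 0] by simp
    ultimately show ?thesis by (simp add: zero_le_mult_iff)
  qed
  ultimately have "sqrt s \<le> Hm1_norm u" by auto
  then show ?thesis unfolding s_def[symmetric] using s0 by (simp add: sqrt_le_D)
qed

text \<open>Cauchy-Schwarz, with the weight \<open>sqrt (1 + k\<^sup>2)\<close> on one factor and
  its inverse on the other, bounds \<open>u\<close> on the partial sums \<open>S n\<close> of
  \<open>f\<close>. The squared norms of the remainders \<open>R n\<close> are tails of a convergent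
  series and \<open>u\<close> is bounded, so the estimate passes to \<open>f\<close>.\<close>

lemma Hm1_norm_le_weighted_sum:
  assumes u: "u \<in> Hm1" and s: "\<And>n. weighted_sum n (Hm1_coeff u) \<le> r\<^sup>2" and "0 \<le> r"
  shows "Hm1_norm u \<le> r"
proof (rule Hm1_norm_least)
  fix f assume f: "f \<in> H1" "H1_norm f \<le> 1"
  let ?I = "\<lambda>n. {- int n..int n}"
  define S where "S n t = (\<Sum>k\<in>?I n. fourier_coeff f k * cis (of_int k * t))" for n t
  have S: "S n \<in> H1" for n unfolding S_def by (rule H1_trig_poly) simp
  have Sc: "fourier_coeff (S n) k = (if k \<in> ?I n then fourier_coeff f k else 0)" for n k
    unfolding S_def by (rule fourier_coeff_trig_poly) simp
  \<comment> \<open>Writing the difference as a sum with the factor \<open>- 1\<close> brings it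
    within reach of \<open>H1_add\<close> and \<open>H1_scale\<close>.\<close>
  define R where "R n t = f t + (- 1) * S n t" for n t
  have R: "R n \<in> H1" for n unfolding R_def by (intro H1_add H1_scale f S)
  have Rc: "fourier_coeff (R n) k = (if k \<in> ?I n then 0 else fourier_coeff f k)" for n k
  proof -
    have "fourier_coeff (R n) k = fourier_coeff f k + (- 1) * fourier_coeff (S n) k"
      unfolding R_def fourier_coeff_scale[symmetric]
      by (rule fourier_coeff_add) (intro H1D f H1_scale S)+
    then show ?thesis by (simp add: Sc)
  qed
  let ?w = "\<lambda>k::int. (1 + (of_int k)\<^sup>2) * (cmod (fourier_coeff f k))\<^sup>2"
  have "(H1_norm (R n))\<^sup>2 = infsum ?w UNIV - (\<Sum>k\<in>?I n. ?w k)" for n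
  proof -
    have "(H1_norm (R n))\<^sup>2 = infsum ?w (UNIV - ?I n)"
      unfolding H1_norm_square by (rule infsum_cong_neutral) (auto simp: Rc)
    also have "\<dots> = infsum ?w UNIV - infsum ?w (?I n)"
      by (rule infsum_Diff) (use H1D(3)[OF f(1)] in \<open>auto\<close>)
    finally show ?thesis by simp
  qed
  moreover have "(\<lambda>n. infsum ?w UNIV - (\<Sum>k\<in>?I n. ?w k)) \<longlonglongrightarrow> infsum ?w UNIV - infsum ?w UNIV"
    by (intro tendsto_intros infsum_symmetric_LIMSEQ H1D f)
  ultimately have "(\<lambda>n. (H1_norm (R n))\<^sup>2) \<longlonglongrightarrow> 0" by simp
  then have "(\<lambda>n. sqrt ((H1_norm (R n))\<^sup>2)) \<longlonglongrightarrow> sqrt 0" by (intro tendsto_intros)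
  then have R0: "(\<lambda>n. H1_norm (R n)) \<longlonglongrightarrow> 0" by (simp add: H1_norm_nonneg)
  have bound: "cmod (u (S n)) \<le> r" for n
  proof -
    let ?c = "\<lambda>k::int. sqrt (1 + (of_int k)\<^sup>2)"
    have c: "?c k > 0" for k using one_plus_square_pos[of k] by simp
    have c2: "(?c k)\<^sup>2 = 1 + (of_int k)\<^sup>2" for k using one_plus_square_pos[of k] by simp
    have "cmod (u (S n)) = cmod (\<Sum>k\<in>?I n. fourier_coeff f k * Hm1_coeff u (- k))"
      unfolding S_def by (subst Hm1_trig_poly[OF u]) auto
    also have "\<dots> \<le> (\<Sum>k\<in>?I n. \<bar>?c k * cmod (fourier_coeff f k)\<bar> * \<bar>cmod (Hm1_coeff u (- k)) / ?c (- k)\<bar>)"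
    proof (rule sum_norm_le)
      fix k
      have "\<bar>?c k * cmod (fourier_coeff f k)\<bar> * \<bar>cmod (Hm1_coeff u (- k)) / ?c k\<bar> =
          cmod (fourier_coeff f k) * cmod (Hm1_coeff u (- k))"
        using c[of k] by (simp only: abs_mult abs_divide abs_of_pos abs_norm_cancel) simp
      then show "norm (fourier_coeff f k * Hm1_coeff u (- k)) \<le>
          \<bar>?c k * cmod (fourier_coeff f k)\<bar> * \<bar>cmod (Hm1_coeff u (- k)) / ?c (- k)\<bar>"
        by (simp add: norm_mult)
    qed
    also have "\<dots> \<le> L2_set (\<lambda>k. ?c k * cmod (fourier_coeff f k)) (?I n) *
        L2_set (\<lambda>k. cmod (Hm1_coeff u (- k)) / ?c (- k)) (?I n)"
      by (rule L2_set_mult_ineq)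
    also have "\<dots> \<le> 1 * r"
    proof (intro mult_mono)
      have "(\<Sum>k\<in>?I n. (?c k * cmod (fourier_coeff f k))\<^sup>2) \<le> (H1_norm f)\<^sup>2"
        using sum_le_H1_norm_square[OF f(1), of "?I n"]
            by (simp only: power_mult_distrib c2 finite_atLeastAtMost_int)
      also have "\<dots> \<le> 1" using f(2) H1_norm_nonneg[of f] by (simp add: power_le_one)
      finally show "L2_set (\<lambda>k. ?c k * cmod (fourier_coeff f k)) (?I n) \<le> 1"
          by (simp add: L2_set_def)
      have "(\<Sum>k\<in>?I n. (cmod (Hm1_coeff u (- k)) / ?c (- k))\<^sup>2) = weighted_sum n (Hm1_coeff u)"
        unfolding weighted_sum_def power_divide c2
        by (rule sum_symmetric_uminus[of "\<lambda>k. (cmod (Hm1_coeff u k))\<^sup>2 / (1 + (of_int k)\<^sup>2)"])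
      then show "L2_set (\<lambda>k. cmod (Hm1_coeff u (- k)) / ?c (- k)) (?I n) \<le> r"
        using s[of n] \<open>0 \<le> r\<close> real_le_lsqrt by (simp add: L2_set_def)
    qed (auto simp: L2_set_nonneg)
    finally show ?thesis by simp
  qed
  obtain K where K: "K \<ge> 0" "\<And>f. f \<in> H1 \<Longrightarrow> cmod (u f) \<le> K * H1_norm f" using Hm1D(3)[OF u] by blast
  have le: "cmod (u f) \<le> r + K * H1_norm (R n)" for n
  proof -
    have "f = (\<lambda>t. S n t + R n t)" by (simp add: R_def)
    then have "u f = u (S n) + u (R n)" using Hm1D(1)[OF u S R] by metis
    then have "cmod (u f) \<le> cmod (u (S n)) + cmod (u (R n))" by (simp add: norm_triangle_ineq)
    then show ?thesis using bound[of n] K(2)[OF R[of n]] by linarith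
  qed
  have "(\<lambda>n. r + K * H1_norm (R n)) \<longlonglongrightarrow> r + K * 0" by (intro tendsto_intros R0)
  then show "cmod (u f) \<le> r" using LIMSEQ_le_const le
      by (metis (no_types, lifting) add.right_neutral mult_zero_right)
qed


section \<open>Balls of coefficient sequences and rational centres\<close>

lemma weighted_sum_mono: "m \<le> n \<Longrightarrow> weighted_sum m a \<le> weighted_sum n a"
  unfolding weighted_sum_def by (rule sum_mono2) (auto simp: less_imp_le[OF one_plus_square_pos])

lemma sqrt_weighted_sum_diff:
  "sqrt (weighted_sum n (\<lambda>k. a k - b k)) \<le>
      sqrt (weighted_sum n (\<lambda>k. a k - q k)) + sqrt (weighted_sum n (\<lambda>k. b k - q k))"
proof -
  let ?I = "{- int n..int n}" and ?c = "\<lambda>k::int. sqrt (1 + (of_int k)\<^sup>2)"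
  have L2: "sqrt (weighted_sum n d) = L2_set (\<lambda>k. cmod (d k) / ?c k) ?I" for d
    unfolding weighted_sum_def L2_set_def power_divide
    by (simp add: less_imp_le[OF one_plus_square_pos])
  have "L2_set (\<lambda>k. cmod (a k - b k) / ?c k) ?I \<le>
      L2_set (\<lambda>k. cmod (a k - q k) / ?c k + cmod (b k - q k) / ?c k) ?I"
  proof (rule L2_set_mono)
    fix k
    have "cmod (a k - b k) \<le> cmod (a k - q k) + cmod (b k - q k)"
      using norm_triangle_ineq4[of "a k - q k" "b k - q k"] by simp
    then show "cmod (a k - b k) / ?c k \<le> cmod (a k - q k) / ?c k + cmod (b k - q k) / ?c k"
      unfolding add_divide_distrib[symmetric] by (rule divide_right_mono) simp
  qed simp
  also have "\<dots> \<le> L2_set (\<lambda>k. cmod (a k - q k) / ?c k) ?I + L2_set (\<lambda>k. cmod (b k - q k) / ?c k) ?I"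
    by (rule L2_set_triangle_ineq)
  finally show ?thesis unfolding L2 .
qed

text \<open>The triangle inequality through \<open>q\<close> in the weighted norm; the factor 2 is
  the diameter of a ball of radius \<open>\<delta>\<close>.\<close>

lemma Hm1_dist_le_weighted_sum:
  assumes y: "y \<in> Hm1" and z: "z \<in> Hm1" and "0 \<le> \<delta>"
    and "\<And>n. weighted_sum n (\<lambda>k. Hm1_coeff y k - q k) \<le> \<delta>\<^sup>2"
    and "\<And>n. weighted_sum n (\<lambda>k. Hm1_coeff z k - q k) \<le> \<delta>\<^sup>2"
  shows "Hm1_dist y z \<le> 2 * \<delta>"
proof -
  let ?u = "\<lambda>f\<in>H1. y f - z f"
  have u: "?u \<in> Hm1" by (rule Hm1_diff_in[OF y z])
  have coeff: "Hm1_coeff ?u k = Hm1_coeff y k - Hm1_coeff z k" for k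
    using cis_in_H1[of "- k"] by (simp add: Hm1_coeff_def)
  have "Hm1_norm ?u \<le> 2 * \<delta>"
  proof (rule Hm1_norm_le_weighted_sum[OF u])
    fix n
    have "sqrt (weighted_sum n (\<lambda>k. Hm1_coeff y k - q k)) \<le>
        \<delta>" "sqrt (weighted_sum n (\<lambda>k. Hm1_coeff z k - q k)) \<le> \<delta>"
      using assms by (auto intro: real_le_lsqrt)
    then have "sqrt (weighted_sum n (Hm1_coeff ?u)) \<le> 2 * \<delta>"
      unfolding coeff using sqrt_weighted_sum_diff[of n "Hm1_coeff y" "Hm1_coeff z" q] by simp
    then show "weighted_sum n (Hm1_coeff ?u) \<le> (2 * \<delta>)\<^sup>2" by (rule sqrt_le_D)
  qed (use \<open>0 \<le> \<delta>\<close> in simp)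
  then show ?thesis using y z by (simp add: Hm1_dist_def)
qed

text \<open>Finitely supported sequences with rational real and imaginary parts. Coding them by
  association lists makes their index set a countable type.\<close>

definition rational_seq :: "(int \<times> rat \<times> rat) list \<Rightarrow> int \<Rightarrow> complex" where
  "rational_seq xs k = (case map_of xs k of None \<Rightarrow> 0 | Some (p, q) \<Rightarrow> Complex (of_rat p) (of_rat q))"

lemma rational_complex_approx:
  assumes "0 < \<eta>"
  shows "\<exists>p q. cmod (z - Complex (of_rat p) (of_rat q)) < \<eta>"
proof -
  obtain p q where "Re z < of_rat p" "of_rat p < Re z + \<eta> / 2" "Im z < of_rat q" "of_rat q < Im z + \<eta> / 2"
    using of_rat_dense[of "Re z" "Re z + \<eta> / 2"] of_rat_dense[of "Im z" "Im z + \<eta> / 2"] assms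
        by auto
  then have "cmod (z - Complex (of_rat p) (of_rat q)) < \<eta>"
    using cmod_le[of "z - Complex (of_rat p) (of_rat q)"] by simp
  then show ?thesis by blast
qed

text \<open>The bounded increasing sums have a limit \<open>L\<close>. Beyond an \<open>N\<close>
  after which less than \<open>\<delta> / 2\<close> is left, the approximation is 0; at the finitely
  many frequencies up to \<open>N\<close> it is a rational point near \<open>a k\<close>.\<close>

lemma rational_seq_approx:
  assumes bdd: "\<And>n. weighted_sum n a \<le> B" and "0 < \<delta>"
  shows "\<exists>xs. \<forall>n. weighted_sum n (\<lambda>k. a k - rational_seq xs k) \<le> \<delta>"
proof -
  have inc: "incseq (\<lambda>n. weighted_sum n a)" by (simp add: incseq_def weighted_sum_mono)
  obtain L where L: "(\<lambda>n. weighted_sum n a) \<longlonglongrightarrow> L" "\<And>n. weighted_sum n a \<le> L"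
    using incseq_convergent[OF inc] bdd by metis
  have "\<forall>\<^sub>F n in sequentially. L - \<delta> / 2 < weighted_sum n a"
    using order_tendstoD(1)[OF L(1), of "L - \<delta> / 2"] \<open>0 < \<delta>\<close> by simp
  then obtain N where N: "L - \<delta> / 2 < weighted_sum N a" by (auto simp: eventually_sequentially)
  \<comment> \<open>Each of the \<open>2 * N + 1\<close> central terms costs at most
    \<open>\<eta>\<^sup>2\<close>, because the weights are at least 1 and stand in the denominator.
    Together they cost at most \<open>\<delta> / 2\<close>.\<close>
  define \<eta> where "\<eta> = sqrt (\<delta> / (2 * (2 * real N + 1)))"
  have "0 < \<eta>" using \<open>0 < \<delta>\<close> by (simp add: \<eta>_def)
  then have "\<forall>k. \<exists>p q. cmod (a k - Complex (of_rat p) (of_rat q)) < \<eta>" using rational_complex_approx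
      by blast
  then obtain p q where pq: "\<And>k. cmod (a k - Complex (of_rat (p k)) (of_rat (q k))) < \<eta>" by metis
  define xs where "xs = map (\<lambda>k. (k, p k, q k)) [- int N..int N]"
  have map_of: "map_of (map (\<lambda>k. (k, h k)) ks) k = (if k \<in> set ks then Some (h k) else None)"
      for h :: "int \<Rightarrow> rat \<times> rat" and ks k
    by (induction ks) auto
  have xs: "rational_seq xs k = (if k \<in> {- int N..int N} then Complex (of_rat (p k)) (of_rat (q k)) else 0)" for k
    unfolding rational_seq_def xs_def map_of by simp
  let ?t = "\<lambda>a k. (cmod (a k))\<^sup>2 / (1 + (real_of_int k)\<^sup>2)"
  have low: "weighted_sum N (\<lambda>k. a k - rational_seq xs k) \<le> \<delta> / 2"
  proof -
    have "weighted_sum N (\<lambda>k. a k - rational_seq xs k) \<le> (\<Sum>k\<in>{- int N..int N}. \<eta>\<^sup>2)"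
      unfolding weighted_sum_def
    proof (rule sum_mono)
      fix k assume "k \<in> {- int N..int N}"
      then have "(cmod (a k - rational_seq xs k))\<^sup>2 \<le> \<eta>\<^sup>2" using pq[of k]
          by (intro power_mono) (auto simp: xs)
      moreover have "?t (\<lambda>k. a k - rational_seq xs k) k \<le> (cmod (a k - rational_seq xs k))\<^sup>2 / 1"
        by (rule divide_left_mono) (auto simp: add_pos_nonneg)
      ultimately show "?t (\<lambda>k. a k - rational_seq xs k) k \<le> \<eta>\<^sup>2" by simp
    qed
    also have "\<dots> = (2 * real N + 1) * \<eta>\<^sup>2" by simp
    also have "\<dots> = \<delta> / 2" using \<open>0 < \<delta>\<close> by (simp add: \<eta>_def field_simps)
    finally show ?thesis .
  qed
  have "weighted_sum n (\<lambda>k. a k - rational_seq xs k) \<le> \<delta>" for n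
  proof -
    have "weighted_sum n (\<lambda>k. a k - rational_seq xs k) \<le> weighted_sum (n + N) (\<lambda>k. a k - rational_seq xs k)"
      by (rule weighted_sum_mono) simp
    also have "\<dots> = weighted_sum N (\<lambda>k. a k - rational_seq xs k) +
        (\<Sum>k\<in>{- int (n + N)..int (n + N)} - {- int N..int N}. ?t (\<lambda>k. a k - rational_seq xs k) k)"
      unfolding weighted_sum_def
          by (subst sum.subset_diff[of "{- int N..int N}"]) (auto simp: add.commute)
    also have "(\<Sum>k\<in>{- int (n + N)..int (n + N)} - {- int N..int N}. ?t (\<lambda>k. a k - rational_seq xs k) k) =
        (\<Sum>k\<in>{- int (n + N)..int (n + N)} - {- int N..int N}. ?t a k)"
      by (rule sum.cong) (auto simp: xs)
    also have "\<dots> = weighted_sum (n + N) a - weighted_sum N a"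
      unfolding weighted_sum_def
          by (subst sum.subset_diff[of "{- int N..int N}" "{- int (n + N)..int (n + N)}"]) auto
    also have "weighted_sum (n + N) a - weighted_sum N a \<le> \<delta> / 2" using L(2)[of "n + N"] N by simp
    finally show ?thesis using low by simp
  qed
  then show ?thesis by blast
qed

section \<open>The Borel sets of \<open>Hm1\<close> in terms of coefficients\<close>

lemma space_Hm1_borel: "space Hm1_borel = Hm1"
  and sets_Hm1_borel: "sets Hm1_borel = sigma_sets Hm1 {U. openin Hm1_topology U}"
proof -
  have "{U. openin Hm1_topology U} \<subseteq> Pow Hm1" using openin_subset topspace_Hm1_topology by blast
  then show "space Hm1_borel = Hm1" "sets Hm1_borel = sigma_sets Hm1 {U. openin Hm1_topology U}"
    by (simp_all add: Hm1_borel_def space_measure_of sets_measure_of)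
qed

lemma Hm1_coeff_diff_le:
  assumes "y \<in> Hm1" "z \<in> Hm1"
  shows "cmod (Hm1_coeff y k - Hm1_coeff z k) \<le> Hm1_dist y z * H1_norm (\<lambda>t. cis (- (of_int k * t)))"
  using Hm1_norm_upper[OF Hm1_diff_in[OF assms] cis_in_H1[of "- k"]] cis_in_H1[of "- k"] assms
  by (simp add: Hm1_dist_def Hm1_coeff_def)

lemma continuous_map_Hm1_coeff: "continuous_map Hm1_topology euclidean (\<lambda>y. Hm1_coeff y k)"
proof -
  interpret Metric_space Hm1 Hm1_dist by (rule Metric_space_Hm1)
  let ?B = "H1_norm (\<lambda>t. cis (- (of_int k * t)))"
  have "\<exists>\<delta>>0. \<forall>z. z \<in> Hm1 \<and> Hm1_dist y z < \<delta> \<longrightarrow> dist (Hm1_coeff y k) (Hm1_coeff z k) < r"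
    if y: "y \<in> Hm1" and "0 < r" for y r
  proof (intro exI[of _ "r / (?B + 1)"] conjI allI impI)
    have B: "0 < ?B + 1" using H1_norm_nonneg[of "\<lambda>t. cis (- (of_int k * t))"] by linarith
    then show "0 < r / (?B + 1)" using \<open>0 < r\<close> by simp
    fix z assume z: "z \<in> Hm1 \<and> Hm1_dist y z < r / (?B + 1)"
    have "cmod (Hm1_coeff y k - Hm1_coeff z k) \<le> Hm1_dist y z * ?B" using Hm1_coeff_diff_le y z
        by blast
    also have "\<dots> \<le> Hm1_dist y z * (?B + 1)" by (intro mult_left_mono) auto
    also have "\<dots> < r" using z B by (simp add: pos_less_divide_eq)
    finally show "dist (Hm1_coeff y k) (Hm1_coeff z k) < r" by (simp add: dist_norm)
  qed
  then have "continuous_map mtopology Met_TC.mtopology (\<lambda>y. Hm1_coeff y k)"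
    unfolding metric_continuous_map[OF Met_TC.Metric_space_axioms] by auto
  then show ?thesis by (simp add: Hm1_topology_def)
qed

lemma measurable_Hm1_coeff[measurable]: "(\<lambda>y. Hm1_coeff y k) \<in> borel_measurable Hm1_borel"
proof (rule borel_measurableI)
  fix S :: "complex set" assume "open S"
  then have "openin Hm1_topology {y \<in> topspace Hm1_topology. Hm1_coeff y k \<in> S}"
    by (intro openin_continuous_map_preimage[OF continuous_map_Hm1_coeff]) simp
  moreover have "{y \<in> topspace Hm1_topology. Hm1_coeff y k \<in> S} = (\<lambda>y. Hm1_coeff y k) -` S \<inter> space Hm1_borel"
    by (auto simp: topspace_Hm1_topology space_Hm1_borel)
  ultimately show "(\<lambda>y. Hm1_coeff y k) -` S \<inter> space Hm1_borel \<in> sets Hm1_borel"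
    by (auto simp: sets_Hm1_borel)
qed

text \<open>An open set is a countable union of balls for the weighted \<open>l\<^sup>2\<close> distance of coefficient
  sequences. The centres are arbitrary sequences, so that no element of \<open>Hm1\<close> has to be constructed.\<close>

lemma measurable_Hm1I:
  assumes f: "\<And>x. x \<in> space M \<Longrightarrow> f x \<in> Hm1"
    and [measurable]: "\<And>k. (\<lambda>x. Hm1_coeff (f x) k) \<in> borel_measurable M"
  shows "f \<in> measurable M Hm1_borel"
proof (rule measurable_sigma_sets[OF sets_Hm1_borel])
  show "{U. openin Hm1_topology U} \<subseteq> Pow Hm1" using openin_subset topspace_Hm1_topology by blast
  show "f \<in> space M \<rightarrow> Hm1" using f by blast
  fix U assume "U \<in> {U. openin Hm1_topology U}"
  then have U: "openin Hm1_topology U" by simp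
  interpret Metric_space Hm1 Hm1_dist by (rule Metric_space_Hm1)
  define B where "B xs m = {y \<in> Hm1. \<forall>n. weighted_sum n (\<lambda>k. Hm1_coeff y k - rational_seq xs k) \<le>
      (1 / real (Suc m))\<^sup>2}" for xs m
  define I where "I = {i. B (fst i) (snd i) \<subseteq> U}"
  have "\<exists>i\<in>I. y \<in> B (fst i) (snd i)" if y: "y \<in> U" for y
  proof -
    obtain r where r: "0 < r" "mball y r \<subseteq> U" and "y \<in> Hm1"
      using U y unfolding Hm1_topology_def openin_mtopology by blast
    \<comment> \<open>The ball that catches \<open>y\<close> is not centred at \<open>y\<close>, so
      its diameter has to be below \<open>r\<close>.\<close>
    obtain m where m: "2 * (1 / real (Suc m)) < r"
      using reals_Archimedean[of "r / 2"] r(1) by (auto simp: inverse_eq_divide)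
    obtain xs where xs: "\<And>n. weighted_sum n (\<lambda>k. Hm1_coeff y k - rational_seq xs k) \<le> (1 / real (Suc m))\<^sup>2"
      using rational_seq_approx[OF weighted_sum_le_Hm1_norm[OF \<open>y \<in> Hm1\<close>], of "(1 / real (Suc m))\<^sup>2"]
      by (auto simp del: of_nat_Suc)
    have "B xs m \<subseteq> mball y r"
    proof
      fix z assume z: "z \<in> B xs m"
      then have "Hm1_dist y z \<le> 2 * (1 / real (Suc m))"
        by (intro Hm1_dist_le_weighted_sum[OF \<open>y \<in> Hm1\<close> _ _ xs]) (auto simp: B_def)
      then show "z \<in> mball y r" using z m \<open>y \<in> Hm1\<close> by (auto simp: B_def)
    qed
    then have "(xs, m) \<in> I" using r(2) by (auto simp: I_def)
    moreover have "y \<in> B xs m" using xs \<open>y \<in> Hm1\<close> by (simp add: B_def)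
    ultimately show ?thesis by (intro bexI[of _ "(xs, m)"]) auto
  qed
  then have "f -` U \<inter> space M = (\<Union>i\<in>I. f -` B (fst i) (snd i) \<inter> space M)"
    by (auto simp: I_def)
  also have "\<dots> \<in> sets M"
  proof (rule sets.countable_UN'')
    show "countable I" by (rule countable_subset[OF subset_UNIV]) simp
    fix i
    have "f -` B (fst i) (snd i) \<inter> space M =
        {x \<in> space M. \<forall>n. weighted_sum n (\<lambda>k. Hm1_coeff (f x) k - rational_seq (fst i) k) \<le>
            (1 / real (Suc (snd i)))\<^sup>2}"
      using f by (auto simp: B_def)
    also have "\<dots> \<in> sets M" unfolding weighted_sum_def by measurable
    finally show "f -` B (fst i) (snd i) \<inter> space M \<in> sets M" .
  qed
  finally show "f -` U \<inter> space M \<in> sets M" .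
qed

text \<open>Apply \<open>measurable_Hm1I\<close> to the identity, with the smallest \<sigma>-algebra
  that makes all coefficients measurable on the domain: every Borel set belongs to it, and its
  members are preimages under \<open>Hm1_coeff\<close>.\<close>

lemma sets_Hm1_borel_coeff:
  assumes "A \<in> sets Hm1_borel"
  obtains A' where "A' \<in> sets (PiM UNIV (\<lambda>_::int. borel :: complex measure))" "A =
      {y \<in> Hm1. Hm1_coeff y \<in> A'}"
proof -
  let ?M = "PiM UNIV (\<lambda>_::int. borel :: complex measure)"
  let ?V = "vimage_algebra Hm1 Hm1_coeff ?M"
  have space: "Hm1_coeff \<in> Hm1 \<rightarrow> space ?M" by (simp add: space_PiM)
  have "(\<lambda>y. y) \<in> measurable ?V Hm1_borel"
  proof (rule measurable_Hm1I)
    fix k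
    have [measurable]: "Hm1_coeff \<in> measurable ?V ?M" by (rule measurable_vimage_algebra1[OF space])
    show "(\<lambda>y. Hm1_coeff y k) \<in> borel_measurable ?V"
      using measurable_compose[OF \<open>Hm1_coeff \<in> measurable ?V ?M\<close> measurable_component_singleton[of k UNIV "\<lambda>_. borel"]]
      by simp
  qed simp
  then have "A \<in> sets ?V"
    using measurable_sets[of "\<lambda>y. y" ?V Hm1_borel A] assms sets.sets_into_space[OF assms]
    by (simp add: space_Hm1_borel Int_absorb2)
  then obtain A' where "A' \<in> sets ?M" "A = Hm1_coeff -` A' \<inter> Hm1"
    by (auto simp: sets_vimage_algebra2[OF space])
  then show thesis by (intro that[of A']) auto
qed

section \<open>Hoelder spaces\<close>

lemma holder_spaceD:
  assumes "f \<in> holder_space \<alpha>"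
  shows "circle_fun f" "\<And>j t. j < nat \<lfloor>\<alpha>\<rfloor> \<Longrightarrow> vderiv j f differentiable at t"
    "continuous_on UNIV (vderiv (nat \<lfloor>\<alpha>\<rfloor>) f)"
    "\<exists>K. \<forall>s t. cmod (vderiv (nat \<lfloor>\<alpha>\<rfloor>) f s - vderiv (nat \<lfloor>\<alpha>\<rfloor>) f t) \<le> K * \<bar>s - t\<bar> powr frac \<alpha>"
  using assms by (auto simp: holder_space_def Let_def)

lemma holder_space_continuous_vderiv:
  assumes "f \<in> holder_space \<alpha>" "j \<le> nat \<lfloor>\<alpha>\<rfloor>"
  shows "continuous_on UNIV (vderiv j f)"
proof (cases "j = nat \<lfloor>\<alpha>\<rfloor>")
  case False
  then show ?thesis using holder_spaceD(2)[OF assms(1), of j] assms(2)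
    by (auto intro!: continuous_at_imp_continuous_on differentiable_imp_continuous_within)
qed (use holder_spaceD(3)[OF assms(1)] in simp)

lemma holder_space_bounded_vderiv:
  assumes "f \<in> holder_space \<alpha>" "j \<le> nat \<lfloor>\<alpha>\<rfloor>"
  shows "\<exists>B. \<forall>t. cmod (vderiv j f t) \<le> B"
  using assms holder_spaceD(1,2)[OF assms(1)]
  by (intro circle_fun_bounded circle_fun_vderiv holder_space_continuous_vderiv) auto

lemma holder_space_continuous:
  assumes "f \<in> holder_space \<alpha>"
  shows "continuous_on A f"
  using holder_space_continuous_vderiv[OF assms, of 0] continuous_on_subset by (auto simp: vderiv_0)

lemma holder_space_C1:
  assumes f: "f \<in> holder_space \<alpha>" and "1 < \<alpha>"
  shows "C1_circle f (vderiv 1 f)"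
proof
  have m: "0 < nat \<lfloor>\<alpha>\<rfloor>" "1 \<le> nat \<lfloor>\<alpha>\<rfloor>" using \<open>1 < \<alpha>\<close> by (auto simp: le_nat_iff le_floor_iff)
  show "circle_fun f" by (rule holder_spaceD(1)[OF f])
  show "(f has_vector_derivative vderiv 1 f t) (at t)" for t
    using holder_spaceD(2)[OF f m(1), of t] vderiv_Suc[of 0 f t]
        by (simp add: vderiv_0 vector_derivative_works)
  show "continuous_on UNIV (vderiv 1 f)" by (rule holder_space_continuous_vderiv[OF f m(2)])
qed

text \<open>The supremum of \<open>cmod (f t - g t)\<close> is one summand of the norm, so the other
  summands have to be nonnegative. A supremum of reals says something only for a bounded set:
  boundedness comes from periodicity for the derivatives and from the Hoelder condition for the
  quotients.\<close>

lemma dist_le_holder_dist: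
  assumes f: "f \<in> holder_space \<alpha>" and g: "g \<in> holder_space \<alpha>"
  shows "cmod (f t - g t) \<le> holder_dist \<alpha> f g"
proof -
  define m where "m = nat \<lfloor>\<alpha>\<rfloor>"
  define \<beta> where "\<beta> = frac \<alpha>"
  define D where "D j t = vderiv j f t - vderiv j g t" for j t
  have V: "vderiv j (\<lambda>t. f t - g t) = D j" if "j \<le> m" for j
    unfolding D_def using holder_spaceD(2)[OF f] holder_spaceD(2)[OF g] that
    by (intro vderiv_diff) (auto simp: m_def)
  have bdd: "bdd_above (range (\<lambda>t. cmod (D j t)))" if j: "j \<le> m" for j
  proof -
    obtain A B where AB: "\<And>t. cmod (vderiv j f t) \<le> A" "\<And>t. cmod (vderiv j g t) \<le> B"
      using holder_space_bounded_vderiv[OF f, of j] holder_space_bounded_vderiv[OF g, of j] j m_def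
          by metis
    have "cmod (D j t) \<le> A + B" for t
      unfolding D_def using norm_triangle_ineq4[of "vderiv j f t" "vderiv j g t"] AB[of t]
          by linarith
    then show ?thesis by (auto intro!: bdd_aboveI)
  qed
  have nonneg: "0 \<le> (SUP t. cmod (D j t))" if "j \<le> m" for j
    by (rule cSUP_upper2[OF bdd[OF that], of 0]) auto
  have "0 \<le> (SUP (s, t)\<in>{(s, t). s \<noteq> t}. cmod (D m s - D m t) / \<bar>s - t\<bar> powr \<beta>)"
  proof -
    obtain A B where AB: "\<And>s t. cmod (vderiv m f s - vderiv m f t) \<le> A * \<bar>s - t\<bar> powr \<beta>"
      "\<And>s t. cmod (vderiv m g s - vderiv m g t) \<le> B * \<bar>s - t\<bar> powr \<beta>"
      using holder_spaceD(4)[OF f] holder_spaceD(4)[OF g] unfolding m_def \<beta>_def by metis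
    have "cmod (D m s - D m t) / \<bar>s - t\<bar> powr \<beta> \<le> A + B" if "s \<noteq> t" for s t
    proof -
      have "D m s - D m t = (vderiv m f s - vderiv m f t) - (vderiv m g s - vderiv m g t)"
          by (simp add: D_def)
      then have "cmod (D m s - D m t) \<le>
          cmod (vderiv m f s - vderiv m f t) + cmod (vderiv m g s - vderiv m g t)"
        by (simp only: norm_triangle_ineq4)
      also have "\<dots> \<le> (A + B) * \<bar>s - t\<bar> powr \<beta>" using AB[of s t] by (simp add: distrib_right)
      finally show ?thesis using that by (simp add: divide_le_eq)
    qed
    then have "bdd_above ((\<lambda>(s, t). cmod (D m s - D m t) / \<bar>s - t\<bar> powr \<beta>) ` {(s, t). s \<noteq> t})"
      by (intro bdd_aboveI2[where M="A + B"]) auto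
    then show ?thesis by (rule cSUP_upper2[of _ _ "(1, 0)"]) auto
  qed
  then have "(\<Sum>j\<le>m. SUP t. cmod (D j t)) \<le> holder_dist \<alpha> f g"
    using f g V unfolding holder_dist_def holder_norm_def Let_def m_def[symmetric] \<beta>_def[symmetric]
    by simp
  moreover have "(SUP t. cmod (D 0 t)) \<le> (\<Sum>j\<le>m. SUP t. cmod (D j t))"
    using nonneg by (intro member_le_sum) auto
  moreover have "cmod (D 0 t) \<le> (SUP t. cmod (D 0 t))" using bdd[of 0] by (intro cSUP_upper) auto
  moreover have "D 0 t = f t - g t" by (simp add: D_def vderiv_0)
  ultimately show ?thesis by simp
qed

lemma fourier_coeff_diff_le:
  assumes f: "f \<in> holder_space \<alpha>" and g: "g \<in> holder_space \<alpha>"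
  shows "cmod (fourier_coeff f k - fourier_coeff g k) \<le> holder_dist \<alpha> f g"
proof -
  have c: "continuous_on {0..2 * pi} (\<lambda>t. (f t - g t) * cis (- (of_int k * t)))"
    by (intro continuous_intros holder_space_continuous[OF f] holder_space_continuous[OF g])
  have "norm (integral {0..2 * pi} (\<lambda>t. (f t - g t) * cis (- (of_int k * t)))) \<le>
      holder_dist \<alpha> f g * (2 * pi - 0)"
    by (rule integral_bound[OF _ c]) (auto simp: norm_mult dist_le_holder_dist[OF f g])
  then have "cmod (fourier_coeff (\<lambda>t. f t - g t) k) \<le> holder_dist \<alpha> f g"
    by (simp add: fourier_coeff_def norm_mult norm_divide field_simps)
  then show ?thesis
    by (simp add: fourier_coeff_diff holder_space_continuous[OF f] holder_space_continuous[OF g])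
qed

lemma continuous_map_fourier_coeff:
  "continuous_map (holder_topology \<alpha>) euclidean (\<lambda>f. fourier_coeff f k)"
proof -
  interpret Metric_space "holder_space \<alpha>" "holder_dist \<alpha>" by (rule Metric_space_holder)
  have "dist (fourier_coeff f k) (fourier_coeff g k) < r"
    if "f \<in> holder_space \<alpha>" "g \<in> holder_space \<alpha>" "holder_dist \<alpha> f g < r" for f g r
    using fourier_coeff_diff_le[OF that(1,2), of k] that(3) by (simp add: dist_norm)
  then have "continuous_map mtopology Met_TC.mtopology (\<lambda>f. fourier_coeff f k)"
    unfolding metric_continuous_map[OF Met_TC.Metric_space_axioms] by auto
  then show ?thesis by (simp add: holder_topology_def)
qed

section \<open>Translating a sequence of Laplace variables\<close>

text \<open>The law \<open>\<mu>1\<close> of the shifted sequence and the law \<open>\<mu>2\<close>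
  of the original one under the changed density are compared on cylinder sets, which determine a
  finite measure on the sequence space.\<close>

lemma (in prob_space) laplace_translation_density:
  fixes e :: "int \<Rightarrow> 'a \<Rightarrow> real" and c :: "int \<Rightarrow> real"
  assumes b: "0 < b" and indep: "indep_vars (\<lambda>_. borel) e UNIV"
    and density: "\<And>k. distributed M lborel (e k) (\<lambda>t. ennreal (1 / (2 * b) * exp (- \<bar>t\<bar> / b)))"
    and c: "(\<lambda>k. \<bar>c k\<bar>) summable_on UNIV"
    and A: "A \<in> sets (PiM UNIV (\<lambda>_. borel))"
  shows "emeasure M {\<omega> \<in> space M. (\<lambda>k. c k + e k \<omega>) \<in> A} =
    (\<integral>\<^sup>+\<omega>. indicator A (\<lambda>k. e k \<omega>) * ennreal (exp (1 / b * (\<Sum>\<^sub>\<infinity>k. \<bar>e k \<omega>\<bar> - \<bar>e k \<omega> - c k\<bar>))) \<partial>M)"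
proof -
  let ?N = "PiM UNIV (\<lambda>_::int. borel :: real measure)" and ?I = "\<lambda>n::nat. {- int n..int n}"
  have [measurable]: "e k \<in> borel_measurable M" for k
    using distributed_measurable[OF density[of k]] by simp
  define D where "D \<omega> = (\<Sum>\<^sub>\<infinity>k. \<bar>e k \<omega>\<bar> - \<bar>e k \<omega> - c k\<bar>)" for \<omega>
  define Dn where "Dn n \<omega> = (\<Sum>k\<in>?I n. \<bar>e k \<omega>\<bar> - \<bar>e k \<omega> - c k\<bar>)" for n \<omega>
  define S where "S = (\<Sum>\<^sub>\<infinity>k. \<bar>c k\<bar>)"
  \<comment> \<open>Each term is at most \<open>\<bar>c k\<bar>\<close> in modulus, whatever
    \<open>e k \<omega>\<close> is, so the exponent converges for every \<open>\<omega>\<close> and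
    not only almost surely.\<close>
  have lim: "(\<lambda>n. Dn n \<omega>) \<longlonglongrightarrow> D \<omega>" for \<omega>
    unfolding D_def Dn_def
    by (rule infsum_symmetric_LIMSEQ, rule abs_summable_summable, rule summable_on_comparison_test[OF c]) auto
  have Dn_le: "Dn n \<omega> \<le> S" for n \<omega>
  proof -
    have "Dn n \<omega> \<le> (\<Sum>k\<in>?I n. \<bar>c k\<bar>)" unfolding Dn_def by (rule sum_mono) auto
    also have "\<dots> \<le> S" unfolding S_def using c by (intro finite_sum_le_infsum) auto
    finally show ?thesis .
  qed
  have [measurable]: "Dn n \<in> borel_measurable M" for n unfolding Dn_def by measurable
  have [measurable]: "D \<in> borel_measurable M"
      by (rule borel_measurable_LIMSEQ_real[OF lim]) measurable
  \<comment> \<open>The Laplace density satisfies \<open>\<rho> t * exp ((\<bar>t\<bar> - \<bar>t -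
    c k\<bar>) / b) = \<rho> (t - c k)\<close>; substituting \<open>c k + t\<close> then moves the
    shift into the argument of the indicator.\<close>
  have one: "(\<integral>\<^sup>+\<omega>. indicator B (e k \<omega>) * ennreal (exp (1 / b * (\<bar>e k \<omega>\<bar> - \<bar>e k \<omega> - c k\<bar>))) \<partial>M) =
      (\<integral>\<^sup>+\<omega>. indicator B (c k + e k \<omega>) \<partial>M)" if [measurable]: "B \<in> sets borel" for k and B :: "real set"
  proof -
    let ?\<rho> = "\<lambda>t. ennreal (1 / (2 * b) * exp (- \<bar>t\<bar> / b))"
    have "(\<integral>\<^sup>+\<omega>. indicator B (e k \<omega>) * ennreal (exp (1 / b * (\<bar>e k \<omega>\<bar> - \<bar>e k \<omega> - c k\<bar>))) \<partial>M) =
        (\<integral>\<^sup>+t. ?\<rho> t * (indicator B t * ennreal (exp (1 / b * (\<bar>t\<bar> - \<bar>t - c k\<bar>)))) \<partial>lborel)"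
      by (rule distributed_nn_integral[OF density, symmetric]) measurable
    also have "\<dots> = (\<integral>\<^sup>+t. ?\<rho> (t - c k) * indicator B t \<partial>lborel)"
    proof (rule nn_integral_cong)
      fix t
      have "?\<rho> t * ennreal (exp (1 / b * (\<bar>t\<bar> - \<bar>t - c k\<bar>))) = ?\<rho> (t - c k)"
        using b by (simp add: ennreal_mult[symmetric] exp_add[symmetric] mult.assoc add_divide_distrib[symmetric] diff_divide_distrib)
      then show "?\<rho> t * (indicator B t * ennreal (exp (1 / b * (\<bar>t\<bar> - \<bar>t - c k\<bar>)))) =
          ?\<rho> (t - c k) * indicator B t"
        by (metis mult.assoc mult.commute)
    qed
    also have "\<dots> = (\<integral>\<^sup>+t. ?\<rho> t * indicator B (c k + t) \<partial>lborel)"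
      by (subst nn_integral_real_affine[where c=1 and t="c k"]) auto
    also have "\<dots> = (\<integral>\<^sup>+\<omega>. indicator B (c k + e k \<omega>) \<partial>M)"
      by (rule distributed_nn_integral[OF density]) measurable
    finally show ?thesis .
  qed
  define \<mu>1 where "\<mu>1 = distr M ?N (\<lambda>\<omega> k. c k + e k \<omega>)"
  define \<mu>2 where "\<mu>2 = distr (density M (\<lambda>\<omega>. ennreal (exp (1 / b * D \<omega>)))) ?N (\<lambda>\<omega> k. e k \<omega>)"
  have meas[measurable]: "(\<lambda>\<omega> k. c k + e k \<omega>) \<in> measurable M ?N" "(\<lambda>\<omega> k. e k \<omega>) \<in> measurable M ?N"
    by (rule measurable_PiM_single'; auto)+
  have "\<mu>1 = \<mu>2"
  proof (rule measure_eqI_PiM_infinite)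
    show "sets \<mu>1 = ?N" "sets \<mu>2 = ?N" by (simp_all add: \<mu>1_def \<mu>2_def)
    interpret M1: prob_space \<mu>1 unfolding \<mu>1_def by (rule prob_space_distr) measurable
    show "finite_measure \<mu>1" by unfold_locales
    fix X :: "int \<Rightarrow> real set" and J :: "int set"
    assume J: "finite J" "\<And>i. i \<in> J \<Longrightarrow> X i \<in> sets borel"
    \<comment> \<open>A cylinder over \<open>J\<close> is padded by \<open>UNIV\<close> to a
      cylinder over a symmetric interval, so that set and density factor over the same
      indices.\<close>
    define B where "B k = (if k \<in> J then X k else UNIV)" for k
    have [measurable]: "B k \<in> sets borel" for k using J by (simp add: B_def)
    define C where "C = prod_emb UNIV (\<lambda>_. borel) J (Pi\<^sub>E J X)"
    have [measurable]: "C \<in> sets ?N" unfolding C_def using J by (intro sets_PiM_I) auto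
    have C_iff: "a \<in> C \<longleftrightarrow> (\<forall>k\<in>J. a k \<in> X k)" for a
      by (auto simp: C_def prod_emb_def space_PiM restrict_PiE_iff)
    have ind: "(indicator C a :: ennreal) = (\<Prod>k\<in>?I n. indicator (B k) (a k))" if "J \<subseteq> ?I n" for n a
    proof (cases "a \<in> C")
      case True
      then show ?thesis by (auto simp: C_iff B_def intro!: prod.neutral[symmetric])
    next
      case False
      then obtain k where "k \<in> J" "a k \<notin> X k" by (auto simp: C_iff)
      then have "\<exists>k\<in>?I n. (indicator (B k) (a k) :: ennreal) = 0" using that
          by (intro bexI[of _ k]) (auto simp: B_def)
      then have "(\<Prod>k\<in>?I n. indicator (B k) (a k)) = (0 :: ennreal)" by simp
      then show ?thesis using False by simp
    qed
    have "\<forall>\<^sub>F n in sequentially. J \<subseteq> ?I n"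
      using filterlim_symmetric_intervals J(1) unfolding filterlim_finite_subsets_at_top by auto
    \<comment> \<open>As soon as the interval contains \<open>J\<close>, the integral no longer
      depends on \<open>n\<close>: independence splits it, and each factor with
      \<open>B k = UNIV\<close> is 1. The limit is thus that of an eventually constant
      sequence.\<close>
    then have ev: "\<forall>\<^sub>F n in sequentially. (\<integral>\<^sup>+\<omega>. indicator C (\<lambda>k. e k \<omega>) * ennreal (exp (1 / b *
        Dn n \<omega>)) \<partial>M) = emeasure \<mu>1 C"
    proof eventually_elim
      case (elim n)
      have "(\<integral>\<^sup>+\<omega>. indicator C (\<lambda>k. e k \<omega>) * ennreal (exp (1 / b * Dn n \<omega>)) \<partial>M) =
          (\<integral>\<^sup>+\<omega>. (\<Prod>k\<in>?I n. indicator (B k) (e k \<omega>) * ennreal (exp (1 / b * (\<bar>e k \<omega>\<bar> - \<bar>e k \<omega> - c k\<bar>)))) \<partial>M)"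
        unfolding ind[OF elim] Dn_def sum_distrib_left exp_sum[OF finite_atLeastAtMost_int]
        by (simp add: prod.distrib prod_ennreal)
      also have "\<dots> = (\<Prod>k\<in>?I n. \<integral>\<^sup>+\<omega>. indicator (B k) (e k \<omega>) * ennreal (exp (1 / b * (\<bar>e k \<omega>\<bar> -
          \<bar>e k \<omega> - c k\<bar>))) \<partial>M)"
        by (intro indep_vars_nn_integral indep_vars_compose2[OF indep_vars_subset[OF indep]]) auto
      also have "\<dots> = (\<Prod>k\<in>?I n. \<integral>\<^sup>+\<omega>. indicator (B k) (c k + e k \<omega>) \<partial>M)"
        by (rule prod.cong[OF refl], rule one) measurable
      also have "\<dots> = (\<integral>\<^sup>+\<omega>. (\<Prod>k\<in>?I n. indicator (B k) (c k + e k \<omega>)) \<partial>M)"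
        by (intro indep_vars_nn_integral[symmetric] indep_vars_compose2[OF indep_vars_subset[OF indep]]) auto
      also have "\<dots> = (\<integral>\<^sup>+\<omega>. indicator C (\<lambda>k. c k + e k \<omega>) \<partial>M)" unfolding ind[OF elim] ..
      also have "\<dots> = (\<integral>\<^sup>+a. indicator C a \<partial>\<mu>1)" unfolding \<mu>1_def
          by (rule nn_integral_distr[symmetric]) measurable
      also have "\<dots> = emeasure \<mu>1 C" by (simp add: \<mu>1_def)
      finally show ?case .
    qed
    have "(\<lambda>n. \<integral>\<^sup>+\<omega>. indicator C (\<lambda>k. e k \<omega>) * ennreal (exp (1 / b * Dn n \<omega>)) \<partial>M) \<longlonglongrightarrow>
        (\<integral>\<^sup>+\<omega>. indicator C (\<lambda>k. e k \<omega>) * ennreal (exp (1 / b * D \<omega>)) \<partial>M)"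
    proof (rule nn_integral_dominated_convergence[where w="\<lambda>_. ennreal (exp (1 / b * S))"])
      show "AE \<omega> in M. indicator C (\<lambda>k. e k \<omega>) * ennreal (exp (1 / b * Dn n \<omega>)) \<le>
          ennreal (exp (1 / b * S))" for n
      proof (rule AE_I2)
        fix \<omega>
        have "ennreal (exp (1 / b * Dn n \<omega>)) \<le> ennreal (exp (1 / b * S))"
          using Dn_le[of n \<omega>] b by (intro ennreal_leI) (simp add: divide_right_mono)
        then show "indicator C (\<lambda>k. e k \<omega>) * ennreal (exp (1 / b * Dn n \<omega>)) \<le> ennreal (exp (1 / b * S))"
          by (auto split: split_indicator)
      qed
      show "AE \<omega> in M. (\<lambda>n. indicator C (\<lambda>k. e k \<omega>) * ennreal (exp (1 / b * Dn n \<omega>))) \<longlonglongrightarrow>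
          indicator C (\<lambda>k. e k \<omega>) * ennreal (exp (1 / b * D \<omega>))"
        by (intro AE_I2 ennreal_tendsto_cmult tendsto_ennrealI tendsto_intros lim) (simp split: split_indicator)
      show "(\<integral>\<^sup>+\<omega>. ennreal (exp (1 / b * S)) \<partial>M) < \<infinity>" by (simp add: emeasure_space_1)
    qed measurable
    then have "emeasure \<mu>1 C = (\<integral>\<^sup>+\<omega>. indicator C (\<lambda>k. e k \<omega>) * ennreal (exp (1 / b * D \<omega>)) \<partial>M)"
      using LIMSEQ_unique tendsto_eventually[OF ev] by blast
    also have "\<dots> = emeasure \<mu>2 C"
    proof -
      have "emeasure \<mu>2 C = (\<integral>\<^sup>+a. indicator C a \<partial>\<mu>2)" by (simp add: \<mu>2_def)
      also have "\<dots> = (\<integral>\<^sup>+\<omega>. indicator C (\<lambda>k. e k \<omega>) \<partial>density M (\<lambda>\<omega>. ennreal (exp (1 / b * D \<omega>))))"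
        unfolding \<mu>2_def by (rule nn_integral_distr) measurable
      also have "\<dots> = (\<integral>\<^sup>+\<omega>. ennreal (exp (1 / b * D \<omega>)) * indicator C (\<lambda>k. e k \<omega>) \<partial>M)"
        by (rule nn_integral_density) measurable
      finally show ?thesis by (simp add: mult.commute)
    qed
    finally show "emeasure \<mu>1 (prod_emb UNIV (\<lambda>_. borel) J (Pi\<^sub>E J X)) =
        emeasure \<mu>2 (prod_emb UNIV (\<lambda>_. borel) J (Pi\<^sub>E J X))"
      unfolding C_def .
  qed
  note [measurable] = A
  have "emeasure M {\<omega> \<in> space M. (\<lambda>k. c k + e k \<omega>) \<in> A} = emeasure \<mu>1 A"
    unfolding \<mu>1_def by (subst emeasure_distr) (auto intro!: arg_cong[where f="emeasure M"])
  also have "\<dots> = (\<integral>\<^sup>+a. indicator A a \<partial>\<mu>2)" using \<open>\<mu>1 = \<mu>2\<close> by (simp add: \<mu>2_def)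
  also have "\<dots> = (\<integral>\<^sup>+\<omega>. indicator A (\<lambda>k. e k \<omega>) \<partial>density M (\<lambda>\<omega>. ennreal (exp (1 / b * D \<omega>))))"
    unfolding \<mu>2_def by (rule nn_integral_distr) measurable
  also have "\<dots> = (\<integral>\<^sup>+\<omega>. ennreal (exp (1 / b * D \<omega>)) * indicator A (\<lambda>k. e k \<omega>) \<partial>M)"
    by (rule nn_integral_density) measurable
  finally show ?thesis by (simp add: mult.commute D_def)
qed

section \<open>Bayes' formula\<close>

text \<open>Here \<open>\<nu>\<close> is a reference measure and \<open>w y x\<close> the
  likelihood: by \<open>joint\<close>, it is the density of the law of \<open>Y\<close> and
  \<open>X\<close> together. The law of \<open>Y\<close> then has density \<open>D\<close> with
  respect to \<open>\<nu>\<close>, so dividing by \<open>D\<close> is legitimate outside a null set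
  of that law.\<close>

theorem bayes_inverse_problem_solution:
  fixes w :: "'g \<Rightarrow> 'f \<Rightarrow> ennreal"
  assumes "prob_space P" and X[measurable]: "X \<in> measurable P F" and Y[measurable]: "Y \<in> measurable P G"
    and sets_\<nu>: "sets \<nu> = sets G"
    and w: "(\<lambda>(y, x). w y x) \<in> borel_measurable (G \<Otimes>\<^sub>M F)"
    and joint: "\<And>A U. A \<in> sets G \<Longrightarrow> U \<in> sets F \<Longrightarrow>
      emeasure P {\<omega> \<in> space P. Y \<omega> \<in> A \<and> X \<omega> \<in> U} = (\<integral>\<^sup>+y\<in>A. (\<integral>\<^sup>+x\<in>U. w y x \<partial>distr P F X) \<partial>\<nu>)"
  shows "\<exists>\<mu>. inverse_problem_solution P F X G Y \<mu> \<and>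
    (\<forall>U\<in>sets F. \<forall>y\<in>space G. (\<integral>\<^sup>+x. w y x \<partial>distr P F X) \<noteq> \<infinity> \<longrightarrow> (\<integral>\<^sup>+x. w y x \<partial>distr P F X) \<noteq> 0 \<longrightarrow>
      emeasure (\<mu> y) U = (\<integral>\<^sup>+x\<in>U. w y x \<partial>distr P F X) / (\<integral>\<^sup>+x. w y x \<partial>distr P F X))"
proof -
  interpret prob_space P by fact
  let ?\<mu>X = "distr P F X"
  interpret MX: prob_space ?\<mu>X by (rule prob_space_distr) measurable
  note [measurable_cong] = sets_\<nu>
  have space_\<nu>: "space \<nu> = space G" using sets_\<nu> by (rule sets_eq_imp_space_eq)
  define N where "N U y = (\<integral>\<^sup>+x\<in>U. w y x \<partial>?\<mu>X)" for U y
  define D where "D y = (\<integral>\<^sup>+x. w y x \<partial>?\<mu>X)" for y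
  define ok where "ok y \<longleftrightarrow> D y \<noteq> 0 \<and> D y \<noteq> \<infinity>" for y
  \<comment> \<open>Where normalization is impossible the prior distribution is used, since a
    solution must be a probability measure for every \<open>y\<close>.\<close>
  define \<mu> where "\<mu> y = (if ok y then density ?\<mu>X (\<lambda>x. w y x / D y) else ?\<mu>X)" for y
  have w1[measurable]: "(\<lambda>x. w y x) \<in> borel_measurable F" if "y \<in> space G" for y
    using measurable_compose[OF measurable_Pair1'[OF that] w] by simp
  have w2: "(\<lambda>(y, x). w y x) \<in> borel_measurable (G \<Otimes>\<^sub>M ?\<mu>X)"
    using w by (simp cong: measurable_cong_sets sets_pair_measure_cong)
  have N_meas[measurable]: "N U \<in> borel_measurable G" if [measurable]: "U \<in> sets F" for U
  proof -
    have "(\<lambda>p. (case p of (y, x) \<Rightarrow> w y x) * indicator U (snd p)) \<in> borel_measurable (G \<Otimes>\<^sub>M ?\<mu>X)"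
      by (intro borel_measurable_times_ennreal w2) measurable
    then have "(\<lambda>y. \<integral>\<^sup>+x. w y x * indicator U x \<partial>?\<mu>X) \<in> borel_measurable G"
      using MX.borel_measurable_nn_integral[of "\<lambda>y x. w y x * indicator U x" G]
          by (simp add: split_beta')
    then show ?thesis unfolding N_def[abs_def] .
  qed
  have D_N: "D y = N (space F) y" for y
    unfolding D_def N_def by (rule nn_integral_cong) simp
  have D_meas[measurable]: "D \<in> borel_measurable G"
    using N_meas[of "space F"] D_N by (simp cong: measurable_cong)
  have [measurable]: "Measurable.pred G ok" unfolding ok_def by measurable
  have N_le: "N U y \<le> D y" for U y
    unfolding D_def N_def by (rule nn_integral_mono) (simp split: split_indicator)
  have em: "emeasure (\<mu> y) U = (if ok y then N U y / D y else emeasure ?\<mu>X U)"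
    if y: "y \<in> space G" and [measurable]: "U \<in> sets F" for y U
  proof (cases "ok y")
    case True
    note [measurable] = w1[OF y]
    have "emeasure (\<mu> y) U = (\<integral>\<^sup>+x. w y x / D y * indicator U x \<partial>?\<mu>X)"
      using True by (simp add: \<mu>_def emeasure_density)
    also have "\<dots> = (\<integral>\<^sup>+x. (w y x * indicator U x) / D y \<partial>?\<mu>X)"
      by (simp add: divide_ennreal_def mult_ac)
    also have "\<dots> = N U y / D y" unfolding N_def by (rule nn_integral_divide) measurable
    finally show ?thesis using True by simp
  qed (simp add: \<mu>_def)
  have prob_\<mu>: "prob_space (\<mu> y)" if "y \<in> space G" for y
  proof
    have "space (\<mu> y) = space F" by (simp add: \<mu>_def)
    then show "emeasure (\<mu> y) (space (\<mu> y)) = 1"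
      using em[OF that sets.top] D_N[of y] MX.emeasure_space_1
      by (auto simp: ok_def ennreal_divide_self less_top)
  qed
  have sets_\<mu>: "sets (\<mu> y) = sets F" for y by (simp add: \<mu>_def)
  have g_meas[measurable]: "(\<lambda>y. emeasure (\<mu> y) U) \<in> borel_measurable G"
      if [measurable]: "U \<in> sets F" for U
    by (subst measurable_cong[OF em[OF _ that]]) measurable
  then have m_meas[measurable]: "(\<lambda>y. measure (\<mu> y) U) \<in> borel_measurable G"
      if [measurable]: "U \<in> sets F" for U
    unfolding measure_def using that by measurable
  have \<mu>Y: "distr P G Y = density \<nu> D"
  proof (rule measure_eqI)
    fix A assume "A \<in> sets (distr P G Y)"
    then have [measurable]: "A \<in> sets G" by simp
    have "emeasure (distr P G Y) A = emeasure P {\<omega> \<in> space P. Y \<omega> \<in> A \<and> X \<omega> \<in> space F}"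
      using measurable_space[OF X]
          by (subst emeasure_distr) (auto intro!: arg_cong[where f="emeasure P"])
    also have "\<dots> = (\<integral>\<^sup>+y\<in>A. N (space F) y \<partial>\<nu>)" unfolding N_def by (rule joint) auto
    also have "\<dots> = emeasure (density \<nu> D) A" by (simp add: emeasure_density D_N)
    finally show "emeasure (distr P G Y) A = emeasure (density \<nu> D) A" .
  qed (simp add: sets_\<nu>)
  \<comment> \<open>\<open>D\<close> is the density of a probability law, so its integral is
    1.\<close>
  have D_fin: "AE y in \<nu>. D y \<noteq> \<infinity>"
  proof (rule nn_integral_PInf_AE)
    have "(\<integral>\<^sup>+y. D y \<partial>\<nu>) = emeasure (density \<nu> D) (space G)"
      by (subst emeasure_density) (auto intro!: nn_integral_cong simp: space_\<nu>)
    also have "\<dots> = 1"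
      using prob_space.emeasure_space_1[OF prob_space_distr[OF Y]] by (simp flip: \<mu>Y)
    finally show "(\<integral>\<^sup>+y. D y \<partial>\<nu>) \<noteq> \<infinity>" by simp
  qed measurable
  \<comment> \<open>The defining property of conditional expectation in terms of nonnegative
    integrals. The density \<open>D y\<close> of the law of \<open>Y\<close> cancels the
    normalization; where \<open>D y = 0\<close>, both sides vanish because
    \<open>N U y \<le> D y\<close>.\<close>
  have key: "(\<integral>\<^sup>+\<omega>. emeasure (\<mu> (Y \<omega>)) U * indicator A (Y \<omega>) \<partial>P) =
      emeasure P {\<omega> \<in> space P. Y \<omega> \<in> A \<and> X \<omega> \<in> U}"
    if [measurable]: "U \<in> sets F" "A \<in> sets G" for U A
  proof -
    have "(\<integral>\<^sup>+\<omega>. emeasure (\<mu> (Y \<omega>)) U * indicator A (Y \<omega>) \<partial>P) =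
        (\<integral>\<^sup>+y. emeasure (\<mu> y) U * indicator A y \<partial>distr P G Y)"
      by (subst nn_integral_distr) auto
    also have "\<dots> = (\<integral>\<^sup>+y. D y * (emeasure (\<mu> y) U * indicator A y) \<partial>\<nu>)"
      unfolding \<mu>Y by (rule nn_integral_density) measurable
    also have "\<dots> = (\<integral>\<^sup>+y\<in>A. N U y \<partial>\<nu>)"
    proof (rule nn_integral_cong_AE)
      have "AE y in \<nu>. y \<in> space G" using AE_space[of \<nu>] by (simp add: space_\<nu>)
      with D_fin show "AE y in \<nu>. D y * (emeasure (\<mu> y) U * indicator A y) = N U y * indicator A y"
      proof eventually_elim
        case (elim y)
        show ?case
        proof (cases "D y = 0")
          case True
          then show ?thesis using N_le[of U y] by simp
        next
          case False
          then have "ok y" using elim by (simp add: ok_def)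
          then have "D y * emeasure (\<mu> y) U = N U y"
            using em[OF elim(2)] elim False
                by (simp add: ennreal_times_divide mult_divide_eq_ennreal mult.commute[of "D y"])
          then show ?thesis by (simp add: mult.assoc[symmetric])
        qed
      qed
    qed
    also have "\<dots> = emeasure P {\<omega> \<in> space P. Y \<omega> \<in> A \<and> X \<omega> \<in> U}"
      unfolding N_def by (rule joint[symmetric]) measurable
    finally show ?thesis .
  qed
  let ?V = "vimage_algebra (space P) Y G"
  have sub: "subalgebra P ?V"
    using measurable_sets[OF Y] measurable_space[OF Y]
        by (auto simp: subalgebra_def sets_vimage_algebra2)
  interpret V: sigma_finite_subalgebra P ?V
    by (rule finite_measure_subalgebra_is_sigma_finite) (use sub in \<open>unfold_locales\<close>)
  have Y_V: "Y \<in> measurable ?V G"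
      by (rule measurable_vimage_algebra1) (use measurable_space[OF Y] in auto)
  have cond: "AE \<omega> in P. measure (\<mu> (Y \<omega>)) U = real_cond_exp P ?V (\<lambda>\<omega>'. indicator U (X \<omega>')) \<omega>"
    if U[measurable]: "U \<in> sets F" for U
  proof -
    have "AE \<omega> in P. real_cond_exp P ?V (\<lambda>\<omega>'. indicator U (X \<omega>')) \<omega> = measure (\<mu> (Y \<omega>)) U"
    proof (rule V.real_cond_exp_charact)
      show "(\<lambda>\<omega>. measure (\<mu> (Y \<omega>)) U) \<in> borel_measurable ?V"
        by (rule measurable_compose[OF Y_V m_meas[OF U]])
      have le1: "measure (\<mu> (Y \<omega>)) U \<le> 1" if "\<omega> \<in> space P" for \<omega>
        using prob_\<mu> measurable_space[OF Y that] by (simp add: prob_space.prob_le_1)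
      then show "integrable P (\<lambda>\<omega>. measure (\<mu> (Y \<omega>)) U)"
        by (intro integrable_const_bound[of _ 1]) auto
      show "integrable P (\<lambda>\<omega>. indicator U (X \<omega>) :: real)"
        by (intro integrable_const_bound[of _ 1]) auto
      fix A' assume "A' \<in> sets ?V"
      then obtain A where A[measurable]: "A \<in> sets G" and A': "A' = Y -` A \<inter> space P"
        using measurable_space[OF Y] by (auto simp: sets_vimage_algebra2)
      have "(\<integral>\<omega>\<in>A'. indicator U (X \<omega>) \<partial>P) = (\<integral>\<omega>. indicator {\<omega> \<in> space P. Y \<omega> \<in> A \<and> X \<omega> \<in> U} \<omega> \<partial>P)"
        unfolding set_lebesgue_integral_def A'
        by (rule Bochner_Integration.integral_cong) (auto split: split_indicator)
      also have "\<dots> = measure P {\<omega> \<in> space P. Y \<omega> \<in> A \<and> X \<omega> \<in> U}" by simp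
      also have "\<dots> = enn2real (\<integral>\<^sup>+\<omega>. emeasure (\<mu> (Y \<omega>)) U * indicator A (Y \<omega>) \<partial>P)"
        unfolding key[OF U A] by (simp add: measure_def)
      also have "\<dots> = enn2real (\<integral>\<^sup>+\<omega>. ennreal (indicator A' \<omega> * measure (\<mu> (Y \<omega>)) U) \<partial>P)"
      proof (intro arg_cong[where f=enn2real] nn_integral_cong)
        fix \<omega> assume \<omega>: "\<omega> \<in> space P"
        interpret M: prob_space "\<mu> (Y \<omega>)" using prob_\<mu> measurable_space[OF Y \<omega>] .
        show "emeasure (\<mu> (Y \<omega>)) U * indicator A (Y \<omega>) = ennreal (indicator A' \<omega> * measure (\<mu> (Y \<omega>)) U)"
          using \<omega> by (auto simp: A' M.emeasure_eq_measure split: split_indicator)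
      qed
      also have "\<dots> = (\<integral>\<omega>\<in>A'. measure (\<mu> (Y \<omega>)) U \<partial>P)"
        unfolding set_lebesgue_integral_def A'
        by (subst integral_eq_nn_integral) auto
      finally show "(\<integral>\<omega>\<in>A'. indicator U (X \<omega>) \<partial>P) = (\<integral>\<omega>\<in>A'. measure (\<mu> (Y \<omega>)) U \<partial>P)" .
    qed
    then show ?thesis by eventually_elim simp
  qed
  have "inverse_problem_solution P F X G Y \<mu>"
    unfolding inverse_problem_solution_def
    using cond prob_\<mu> sets_\<mu> m_meas by (auto intro!: measurable_completion)
  moreover have "emeasure (\<mu> y) U = N U y / D y" if "U \<in> sets F" "y \<in> space G" "D y \<noteq> \<infinity>" "D y \<noteq> 0"
      for U y
    using em[OF that(2,1)] that by (simp add: ok_def)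
  ultimately show ?thesis unfolding N_def D_def by blast
qed

section \<open>Measures on Souslin spaces\<close>

lemma (in Metric_space) separable_dense_sequence:
  assumes "separable_space mtopology" "M \<noteq> {}"
  obtains c :: "nat \<Rightarrow> 'a" where "\<And>n. c n \<in> M" "\<And>p e. p \<in> M \<Longrightarrow> 0 < e \<Longrightarrow> \<exists>n. d p (c n) < e"
proof -
  obtain C where C: "countable C" "C \<subseteq> M" "mtopology closure_of C = M"
    using assms(1) unfolding separable_space_def by auto
  have "C \<noteq> {}" using C(3) assms(2) by auto
  have "\<exists>n. d p (from_nat_into C n) < e" if p: "p \<in> M" "0 < e" for p e
  proof -
    have "p \<in> mtopology closure_of C" using C p by simp
    then obtain q where "q \<in> C" "d p q < e"
      unfolding metric_closure_of using p(2) by auto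
    then show ?thesis using C(1) by (metis from_nat_into_to_nat_on)
  qed
  moreover have "from_nat_into C n \<in> M" for n
    using from_nat_into[OF \<open>C \<noteq> {}\<close>] C(2) by auto
  ultimately show thesis using that by blast
qed

text \<open>Images of balls need not be open, so they cannot serve themselves. For each pair of
  balls with centres in a dense sequence and radii \<open>1 / Suc j\<close>, one open set is chosen,
  if there is any, that contains the image of the first ball and misses that of the second. Disjoint
  neighbourhoods of two points yield a pair of balls around preimages that admits such a
  set.\<close>

lemma souslin_space_separating_family:
  assumes "souslin_space (euclidean :: 'a::t2_space topology)"
  obtains \<U> :: "'a::t2_space set set" where "countable \<U>" "\<And>U. U \<in> \<U> \<Longrightarrow> open U"
    "\<And>x y. x \<noteq> y \<Longrightarrow> \<exists>U\<in>\<U>. x \<in> U \<and> y \<notin> U"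
proof -
  obtain m :: "real metric" and \<phi> where m: "mcomplete_of m" "separable_space (mtopology_of m)"
    "continuous_map (mtopology_of m) (euclidean :: 'a topology) \<phi>" "\<phi> ` mspace m = UNIV"
    using assms unfolding souslin_space_def by auto
  interpret Metric_space "mspace m" "mdist m" by simp
  have ne: "mspace m \<noteq> {}" using m(4) by auto
  have top: "mtopology_of m = mtopology" by (simp add: mtopology_of_def)
  obtain c where c: "\<And>n::nat. c n \<in> mspace m"
      "\<And>p e. p \<in> mspace m \<Longrightarrow> 0 < e \<Longrightarrow> \<exists>n. mdist m p (c n) < e"
    using separable_dense_sequence m(2) ne unfolding top by blast
  define B where "B n j = mball (c n) (1 / real (Suc j))" for n j
  have base: "\<exists>n j. p \<in> B n j \<and> \<phi> ` B n j \<subseteq> U" if p: "p \<in> mspace m" "\<phi> p \<in> U" "open U" for p U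
  proof -
    have "openin mtopology {q \<in> topspace mtopology. \<phi> q \<in> U}"
      using openin_continuous_map_preimage[OF m(3)] that top by auto
    then obtain r where r: "r > 0" "mball p r \<subseteq> {q \<in> mspace m. \<phi> q \<in> U}"
      unfolding openin_mtopology using p by auto
    obtain j where j: "1 / real (Suc j) < r / 2"
      using reals_Archimedean[of "r / 2"] r(1) by (auto simp: inverse_eq_divide)
    obtain n where n: "mdist m p (c n) < 1 / real (Suc j)" using c(2)[OF p(1)] by force
    have "B n j \<subseteq> mball p r"
    proof
      fix q assume "q \<in> B n j"
      then have q: "q \<in> mspace m" "mdist m (c n) q < 1 / real (Suc j)" by (auto simp: B_def)
      have "mdist m p q \<le> mdist m p (c n) + mdist m (c n) q" using triangle p c q by blast
      then show "q \<in> mball p r" using p q n j by (auto simp: in_mball)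
    qed
    moreover have "p \<in> B n j" using n p c by (auto simp: B_def commute)
    ultimately show ?thesis using r(2) by blast
  qed
  define ok where "ok U = (\<lambda>(n, j, n', j'). open U \<and> \<phi> ` B n j \<subseteq> U \<and> \<phi> ` B n' j' \<inter> U = {})" for U
  define \<U> where "\<U> = (\<lambda>i. SOME U. ok U i) ` {i. \<exists>U. ok U i}"
  have ok: "ok (SOME U. ok U i) i" if "\<exists>U. ok U i" for i using someI_ex[OF that] .
  show thesis
  proof
    show "countable \<U>" by (simp add: \<U>_def)
    show "open U" if U: "U \<in> \<U>" for U
    proof -
      obtain i where i: "\<exists>U. ok U i" "U = (SOME U. ok U i)" using U unfolding \<U>_def by blast
      then show ?thesis using ok[OF i(1)] by (auto simp: ok_def split: prod.splits)
    qed
    fix x y :: 'a assume "x \<noteq> y"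
    then obtain U V where UV: "open U" "open V" "x \<in> U" "y \<in> V" "U \<inter> V = {}" using hausdorff
        by metis
    obtain p q where pq: "p \<in> mspace m" "q \<in> mspace m" "x = \<phi> p" "y = \<phi> q" using m(4)
        by (metis UNIV_I imageE)
    obtain n j where nj: "p \<in> B n j" "\<phi> ` B n j \<subseteq> U" using base[of p U] UV pq by blast
    obtain n' j' where nj': "q \<in> B n' j'" "\<phi> ` B n' j' \<subseteq> V" using base[of q V] UV pq by blast
    define i where "i = (n, j, n', j')"
    have "ok U i" using UV nj nj' by (auto simp: ok_def i_def)
    then have ex: "\<exists>U. ok U i" by blast
    then have "(SOME U. ok U i) \<in> \<U>" by (auto simp: \<U>_def)
    moreover have "x \<in> (SOME U. ok U i) \<and> y \<notin> (SOME U. ok U i)"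
      using ok[OF ex] nj nj' pq by (auto simp: ok_def i_def)
    ultimately show "\<exists>U\<in>\<U>. x \<in> U \<and> y \<notin> U" by blast
  qed
qed

text \<open>The members of the family that avoid a point \<open>y\<close> outside \<open>K\<close>
  cover \<open>K\<close>, and a finite subcover still avoids \<open>y\<close>. For a countable
  family this exhibits \<open>K\<close> as an intersection of countably many sets.\<close>

lemma compact_eq_Inter_finite_Unions:
  fixes K :: "'a::topological_space set"
  assumes "compact K" "\<And>U. U \<in> \<U> \<Longrightarrow> open U"
    and sep: "\<And>x y. x \<noteq> y \<Longrightarrow> \<exists>U\<in>\<U>. x \<in> U \<and> y \<notin> U"
  shows "K = \<Inter>{\<Union>F | F. finite F \<and> F \<subseteq> \<U> \<and> K \<subseteq> \<Union>F}"
proof (intro equalityI subsetI)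
  fix y assume y: "y \<in> \<Inter>{\<Union>F | F. finite F \<and> F \<subseteq> \<U> \<and> K \<subseteq> \<Union>F}"
  show "y \<in> K"
  proof (rule ccontr)
    assume "y \<notin> K"
    have "K \<subseteq> \<Union>{U \<in> \<U>. y \<notin> U}"
    proof
      fix x assume "x \<in> K"
      then have "x \<noteq> y" using \<open>y \<notin> K\<close> by metis
      then obtain U where "U \<in> \<U>" "x \<in> U" "y \<notin> U" using sep by metis
      then show "x \<in> \<Union>{U \<in> \<U>. y \<notin> U}" by blast
    qed
    moreover have "\<And>U. U \<in> {U \<in> \<U>. y \<notin> U} \<Longrightarrow> open U" using assms(2) by auto
    ultimately obtain F where F: "F \<subseteq> {U \<in> \<U>. y \<notin> U}" "finite F" "K \<subseteq> \<Union>F"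
      using compactE[OF assms(1), of "{U \<in> \<U>. y \<notin> U}"] by metis
    then have "\<Union>F \<in> {\<Union>F | F. finite F \<and> F \<subseteq> \<U> \<and> K \<subseteq> \<Union>F}" by blast
    with y have "y \<in> \<Union>F" by (rule InterD)
    then show False using F by blast
  qed
qed blast

text \<open>A centre outside \<open>S\<close> is replaced by a point of \<open>S\<close> in its
  ball, at the cost of doubling the radius.\<close>

lemma (in Metric_space) mtotally_boundedI_outer_centres:
  assumes "S \<subseteq> M" "\<And>e. 0 < e \<Longrightarrow> \<exists>F. finite F \<and> F \<subseteq> M \<and> S \<subseteq> (\<Union>x\<in>F. mball x e)"
  shows "mtotally_bounded S"
  unfolding mtotally_bounded_def
proof (intro allI impI)
  fix e :: real assume "0 < e"
  then obtain F where F: "finite F" "F \<subseteq> M" "S \<subseteq> (\<Union>x\<in>F. mball x (e / 2))"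
    using assms(2)[of "e / 2"] by auto
  define F' where "F' = {x \<in> F. \<exists>q. q \<in> S \<inter> mball x (e / 2)}"
  define h where "h x = (SOME q. q \<in> S \<inter> mball x (e / 2))" for x
  have h: "h x \<in> S \<inter> mball x (e / 2)" if "x \<in> F'" for x
    unfolding h_def by (rule someI_ex) (use that in \<open>simp add: F'_def\<close>)
  have "S \<subseteq> (\<Union>y\<in>h ` F'. mball y e)"
  proof
    fix q assume q: "q \<in> S"
    then obtain x where x: "x \<in> F" "q \<in> mball x (e / 2)" using F(3) by blast
    then have xF: "x \<in> F'" using q by (auto simp: F'_def)
    have "h x \<in> M" "x \<in> M" "q \<in> M" using h[OF xF] q x assms(1) F by auto
    then have "d (h x) q \<le> d (h x) x + d x q" using triangle by blast
    then have "q \<in> mball (h x) e"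
      using h[OF xF] x(2) \<open>h x \<in> M\<close> \<open>q \<in> M\<close> by (auto simp: commute)
    then show "q \<in> (\<Union>y\<in>h ` F'. mball y e)" using xF by blast
  qed
  moreover have "h ` F' \<subseteq> S" using h by blast
  moreover have "finite (h ` F')" using F(1) by (simp add: F'_def)
  ultimately show "\<exists>K. finite K \<and> K \<subseteq> S \<and> S \<subseteq> (\<Union>x\<in>K. mball x e)" by blast
qed

text \<open>A sequence with \<open>\<sigma> j \<in> A j\<close> is totally bounded, because apart
  from its first terms it lies in \<open>A (Suc j)\<close>, which finitely many balls of radius
  \<open>1 / Suc j\<close> cover. By completeness a subsequence converges, and its limit is in every
  closed \<open>A j\<close>. The second claim applies this to points of \<open>A j\<close> outside
  \<open>U\<close>.\<close>

lemma (in Metric_space) decreasing_finite_ball_covers: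
  assumes "mcomplete"
    and A: "\<And>j. A j \<subseteq> M" "decseq A" "\<And>j. closedin mtopology (A j)"
    and cov: "\<And>j. \<exists>F. finite F \<and> F \<subseteq> M \<and> A (Suc j) \<subseteq> (\<Union>x\<in>F. mcball x (1 / real (Suc j)))"
  shows "compactin mtopology (\<Inter>j. A j)"
    and "openin mtopology U \<Longrightarrow> (\<Inter>j. A j) \<subseteq> U \<Longrightarrow> \<exists>j. A j \<subseteq> U"
proof -
  have conv: "\<exists>r l. strict_mono r \<and> limitin mtopology (\<sigma> \<circ> r) l sequentially"
    if \<sigma>: "\<And>j. \<sigma> j \<in> A j" for \<sigma> :: "nat \<Rightarrow> 'a"
  proof -
    have "mtotally_bounded (range \<sigma>)"
    proof (rule mtotally_boundedI_outer_centres)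
      show "range \<sigma> \<subseteq> M" using \<sigma> A(1) by blast
      fix e :: real assume "0 < e"
      then obtain j where j: "1 / real (Suc j) < e"
        using reals_Archimedean by (auto simp: inverse_eq_divide)
      obtain F where F: "finite F" "F \<subseteq> M" "A (Suc j) \<subseteq> (\<Union>x\<in>F. mcball x (1 / real (Suc j)))"
        using cov[of j] by metis
      \<comment> \<open>The terms up to \<open>j\<close> need not lie in \<open>A (Suc j)\<close>;
        they become centres of their own.\<close>
      have "range \<sigma> \<subseteq> (\<Union>x\<in>F \<union> \<sigma> ` {..j}. mball x e)"
      proof clarify
        fix n
        show "\<sigma> n \<in> (\<Union>x\<in>F \<union> \<sigma> ` {..j}. mball x e)"
        proof (cases "n \<le> j")
          case True
          then show ?thesis using \<open>0 < e\<close> \<sigma>[of n] A(1) by force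
        next
          case False
          then have "\<sigma> n \<in> A (Suc j)" using \<sigma>[of n] decseqD[OF A(2), of "Suc j" n] by auto
          then obtain x where "x \<in> F" "\<sigma> n \<in> mcball x (1 / real (Suc j))" using F(3) by blast
          then show ?thesis using j by force
        qed
      qed
      moreover have "F \<union> \<sigma> ` {..j} \<subseteq> M" using F(2) \<sigma> A(1) by blast
      ultimately show "\<exists>K. finite K \<and> K \<subseteq> M \<and> range \<sigma> \<subseteq> (\<Union>x\<in>K. mball x e)"
        using F(1) by (intro exI[of _ "F \<union> \<sigma> ` {..j}"]) auto
    qed
    then obtain r where r: "strict_mono r" "MCauchy (\<sigma> \<circ> r)"
      unfolding mtotally_bounded_sequentially by blast
    then show ?thesis using \<open>mcomplete\<close> unfolding mcomplete_def by blast
  qed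
  have lim: "l \<in> A j" if \<sigma>: "\<And>j. \<sigma> j \<in> A j" "strict_mono r" "limitin mtopology (\<sigma> \<circ> r) l sequentially"
    for \<sigma> r l j
  proof (rule limitin_closedin[OF that(3) A(3)])
    have "(\<sigma> \<circ> r) n \<in> A j" if "n \<ge> j" for n
      using \<sigma>(1)[of "r n"] decseqD[OF A(2), of j "r n"] strict_mono_imp_increasing[OF \<sigma>(2), of n] that by auto
    then show "\<forall>\<^sub>F n in sequentially. (\<sigma> \<circ> r) n \<in> A j" unfolding eventually_sequentially by blast
  qed auto
  show "compactin mtopology (\<Inter>j. A j)"
    unfolding compactin_sequentially
  proof (intro conjI allI impI)
    show "(\<Inter>j. A j) \<subseteq> M" using A(1) by blast
    fix \<sigma> :: "nat \<Rightarrow> 'a" assume "range \<sigma> \<subseteq> (\<Inter>j. A j)"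
    then have \<sigma>: "\<And>j. \<sigma> j \<in> A j" by blast
    then obtain r l where rl: "strict_mono r" "limitin mtopology (\<sigma> \<circ> r) l sequentially"
      using conv by blast
    then have "l \<in> (\<Inter>j. A j)" using lim[OF \<sigma>] by blast
    then show "\<exists>l r. l \<in> (\<Inter>j. A j) \<and> strict_mono r \<and> limitin mtopology (\<sigma> \<circ> r) l sequentially"
      using rl by blast
  qed
  show "\<exists>j. A j \<subseteq> U" if U: "openin mtopology U" "(\<Inter>j. A j) \<subseteq> U"
  proof (rule ccontr)
    assume "\<nexists>j. A j \<subseteq> U"
    then have "\<forall>j. \<exists>x. x \<in> A j - U" by blast
    then obtain \<sigma> where \<sigma>: "\<And>j. \<sigma> j \<in> A j - U" by metis
    then have \<sigma>A: "\<And>j. \<sigma> j \<in> A j" by blast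
    then obtain r l where rl: "strict_mono r" "limitin mtopology (\<sigma> \<circ> r) l sequentially"
      using conv by blast
    then have "l \<in> U" using lim[OF \<sigma>A] U(2) by blast
    then obtain n where "(\<sigma> \<circ> r) n \<in> U"
      using rl(2) U(1) unfolding limitin_def eventually_sequentially by blast
    then show False using \<sigma> by simp
  qed
qed

text \<open>Images of subsets of the metric space need not be Borel, so they are measured by the
  outer measure of \<open>\<mu>\<close>. It is continuous along increasing sequences, which allows
  cutting down to finitely many balls at small cost, but in general not along decreasing ones.
  Therefore \<open>K\<close> is estimated through open sets \<open>G\<close> around it, each of
  which already contains the image of some \<open>A j\<close>.\<close>

lemma souslin_space_tight:
  fixes \<mu> :: "'a::t2_space measure"
  assumes souslin: "souslin_space (euclidean :: 'a topology)"
    and fin: "finite_measure \<mu>" and sets: "sets \<mu> = sets borel" and "0 < r"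
  obtains K where "compact K" "emeasure \<mu> (- K) \<le> ennreal r"
proof -
  interpret finite_measure \<mu> by fact
  obtain m :: "real metric" and \<phi> where m: "mcomplete_of m" "separable_space (mtopology_of m)"
    "continuous_map (mtopology_of m) (euclidean :: 'a topology) \<phi>" "\<phi> ` mspace m = UNIV"
    using souslin unfolding souslin_space_def by auto
  obtain \<U> :: "'a set set" where \<U>: "countable \<U>" "\<And>U. U \<in> \<U> \<Longrightarrow> open U"
    "\<And>x y. x \<noteq> y \<Longrightarrow> \<exists>U\<in>\<U>. x \<in> U \<and> y \<notin> U"
    using souslin_space_separating_family[OF souslin] by blast
  interpret Metric_space "mspace m" "mdist m" by simp
  have ne: "mspace m \<noteq> {}" using m(4) by auto
  have top: "mtopology_of m = mtopology" by (simp add: mtopology_of_def)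
  have space: "space \<mu> = UNIV" using sets by (metis sets_eq_imp_space_eq space_borel)
  have [measurable]: "U \<in> sets \<mu>" if "open U" for U using that sets by simp
  define om where "om S = outer_measure_of \<mu> (\<phi> ` S)" for S
  obtain c where c: "\<And>n::nat. c n \<in> mspace m"
      "\<And>p e. p \<in> mspace m \<Longrightarrow> 0 < e \<Longrightarrow> \<exists>n. mdist m p (c n) < e"
    using separable_dense_sequence m(2) ne unfolding top by blast
  define E where "E j N = (\<Union>n\<le>N. mcball (c n) (1 / real (Suc j)))" for j N :: nat
  have om_le: "om S \<le> emeasure \<mu> G" if "\<phi> ` S \<subseteq> G" "open G" for S G
    using outer_measure_of_mono[OF that(1), of \<mu>] that(2) by (simp add: om_def outer_measure_of_eq)
  \<comment> \<open>The balls of one radius around the dense sequence cover the space, so finitely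
    many of them keep all but \<open>\<delta>\<close> of the outer measure, which is finite.\<close>
  have step: "\<exists>N. om S \<le> om (S \<inter> E j N) + ennreal \<delta>" if S: "S \<subseteq> mspace m" "0 < \<delta>" for S j \<delta>
  proof -
    have inc: "incseq (\<lambda>N. \<phi> ` (S \<inter> E j N))" unfolding incseq_def E_def by fastforce
    have "p \<in> (\<Union>N. E j N)" if "p \<in> S" for p
    proof -
      have "p \<in> mspace m" using that S by blast
      then obtain n where "mdist m p (c n) < 1 / real (Suc j)" using c(2)[of p "1 / real (Suc j)"]
          by auto
      then have "p \<in> mcball (c n) (1 / real (Suc j))" using \<open>p \<in> mspace m\<close> c by (auto simp: commute)
      then show ?thesis by (auto simp: E_def)
    qed
    then have "(\<Union>N. \<phi> ` (S \<inter> E j N)) = \<phi> ` S" by blast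
    then have eq: "om S = (SUP N. om (S \<inter> E j N))"
      using SUP_outer_measure_of_incseq[OF _ inc, of \<mu>] space by (simp add: om_def)
    have "om S \<le> emeasure \<mu> UNIV" by (rule om_le) auto
    then have "om S \<noteq> \<top>" using emeasure_finite[of UNIV] by (auto simp: top_unique)
    then show ?thesis
      using SUP_approx_ennreal[of \<delta> UNIV "om S" "\<lambda>N. om (S \<inter> E j N)"] eq that(2)
      by (auto intro: less_imp_le)
  qed
  \<comment> \<open>The costs \<open>r / 2 ^ Suc j\<close> of all steps add up to at most
    \<open>r\<close>.\<close>
  define \<delta> where "\<delta> j = r * (1 / 2) ^ Suc j" for j
  have \<delta>: "0 < \<delta> j" for j using \<open>0 < r\<close> by (simp add: \<delta>_def)
  define Nf where "Nf S j = (SOME N. om S \<le> om (S \<inter> E j N) + ennreal (\<delta> j))" for S j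
  define A where "A = rec_nat (mspace m) (\<lambda>j S. S \<inter> E j (Nf S j))"
  have A0: "A 0 = mspace m" and ASuc: "A (Suc j) = A j \<inter> E j (Nf (A j) j)" for j
    by (simp_all add: A_def)
  have AM: "A j \<subseteq> mspace m" for j by (induction j) (auto simp: A0 ASuc)
  have omA: "om (A j) \<le> om (A (Suc j)) + ennreal (\<delta> j)" for j
    unfolding ASuc Nf_def by (rule someI_ex[OF step[OF AM \<delta>]])
  have sumA: "om (mspace m) \<le> om (A j) + ennreal (\<Sum>i<j. \<delta> i)" for j
  proof (induction j)
    case (Suc j)
    have "om (mspace m) \<le> om (A (Suc j)) + ennreal (\<delta> j) + ennreal (\<Sum>i<j. \<delta> i)"
      using Suc omA[of j] by (meson add_right_mono order_trans)
    also have "\<dots> = om (A (Suc j)) + ennreal (\<Sum>i<Suc j. \<delta> i)"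
      using \<delta> by (simp add: add.assoc ennreal_plus[symmetric] sum_nonneg less_imp_le add.commute del: ennreal_plus)
    finally show ?case .
  qed (simp add: A0)
  have sum\<delta>: "(\<Sum>i<j. \<delta> i) \<le> r" for j
  proof -
    have "(\<Sum>i<j. \<delta> i) = r * (1 - (1 / 2) ^ j)"
      by (induction j) (auto simp: \<delta>_def algebra_simps)
    also have "\<dots> \<le> r * 1" using \<open>0 < r\<close> by (intro mult_left_mono) auto
    finally show ?thesis by simp
  qed
  have dec: "decseq A" by (rule decseq_SucI) (auto simp: ASuc)
  have Ecl: "closedin mtopology (E j N)" for j N
    unfolding E_def by (rule closedin_Union) (auto simp: closedin_mcball)
  have Acl: "closedin mtopology (A j)" for j
  proof (induction j)
    case 0
    show ?case using closedin_topspace[of mtopology] by (simp add: A0)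
  qed (simp add: ASuc Ecl closedin_Int)
  have cov: "\<exists>F. finite F \<and> F \<subseteq> mspace m \<and> A (Suc j) \<subseteq> (\<Union>x\<in>F. mcball x (1 / real (Suc j)))" for j
    using c(1) by (intro exI[of _ "c ` {..Nf (A j) j}"]) (auto simp: ASuc E_def)
  have complete: "mcomplete" using m(1) by (simp add: mcomplete_of_def)
  note covers = decreasing_finite_ball_covers[OF complete AM dec Acl cov]
  define K where "K = \<phi> ` (\<Inter>j. A j)"
  have "compactin euclidean K"
    unfolding K_def by (rule image_compactin[OF covers(1)]) (use m(3) top in simp)
  then have K: "compact K" by simp
  have G: "emeasure \<mu> UNIV \<le> emeasure \<mu> G + ennreal r" if G: "open G" "K \<subseteq> G" for G
  proof -
    have "openin mtopology {p \<in> mspace m. \<phi> p \<in> G}"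
      using openin_continuous_map_preimage[OF m(3)] G top by auto
    moreover have "(\<Inter>j. A j) \<subseteq> {p \<in> mspace m. \<phi> p \<in> G}" using G(2) AM unfolding K_def by blast
    ultimately obtain j where "A j \<subseteq> {p \<in> mspace m. \<phi> p \<in> G}" using covers(2) by blast
    then have "om (A j) \<le> emeasure \<mu> G" using G by (intro om_le) auto
    moreover have "om (mspace m) \<le> om (A j) + ennreal r"
      using sumA[of j] sum\<delta>[of j] by (meson add_left_mono ennreal_leI order_trans)
    moreover have "om (mspace m) = emeasure \<mu> UNIV"
      by (simp add: om_def m(4) outer_measure_of_eq)
    ultimately show ?thesis by (metis add_right_mono order_trans)
  qed
  have Gc: "emeasure \<mu> (- G) \<le> ennreal r" if G': "open G" "K \<subseteq> G" for G
  proof -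
    have "emeasure \<mu> UNIV = emeasure \<mu> G + emeasure \<mu> (- G)"
      using plus_emeasure[of G \<mu> "- G"] G' sets by (auto simp: Un_commute borel_open)
    then have "emeasure \<mu> G + emeasure \<mu> (- G) \<le> emeasure \<mu> G + ennreal r" using G[OF G'] by simp
    then show ?thesis using emeasure_finite[of G]
        by (metis ennreal_add_left_cancel_le infinity_ennreal_def)
  qed
  \<comment> \<open>\<open>K\<close> is the intersection of these countably many open sets; the
    complements of their finite intersections increase to the complement of \<open>K\<close>, so the
    bound \<open>Gc\<close> passes to it. Adding \<open>UNIV\<close> keeps the family nonempty for
    the enumeration.\<close>
  define \<W> where "\<W> = {\<Union>F | F. finite F \<and> F \<subseteq> \<U> \<and> K \<subseteq> \<Union>F} \<union> {UNIV}"
  have "countable {F. finite F \<and> F \<subseteq> \<U>}" using \<U>(1) by (simp add: countable_Collect_finite_subset)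
  then have "countable (Union ` {F. finite F \<and> F \<subseteq> \<U>})" by blast
  then have W: "countable \<W>" "\<W> \<noteq> {}"
    unfolding \<W>_def by (auto intro: countable_subset[rotated])
  have W_open: "open W" "K \<subseteq> W" if "W \<in> \<W>" for W
    using that \<U>(2) by (auto simp: \<W>_def)
  have KW: "K = \<Inter>\<W>"
    using compact_eq_Inter_finite_Unions[OF K \<U>(2,3)] unfolding \<W>_def by auto
  define W where "W = from_nat_into \<W>"
  have Wn: "W n \<in> \<W>" for n by (simp add: W_def W(2) from_nat_into)
  have "range W = \<W>" using W range_from_nat_into by (simp add: W_def)
  then have "- K = (\<Union>n. - W n)" unfolding KW by blast
  also have "\<dots> = (\<Union>n. - (\<Inter>i\<le>n. W i))" by blast
  finally have "- K = (\<Union>n. - (\<Inter>i\<le>n. W i))" .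
  moreover have "emeasure \<mu> (\<Union>n. - (\<Inter>i\<le>n. W i)) = (SUP n. emeasure \<mu> (- (\<Inter>i\<le>n. W i)))"
    using W_open[OF Wn] sets
    by (intro SUP_emeasure_incseq[symmetric]) (fastforce simp: incseq_def intro!: borel_closed closed_Compl)+
  moreover have "emeasure \<mu> (- (\<Inter>i\<le>n. W i)) \<le> ennreal r" for n
    using W_open[OF Wn] by (intro Gc) auto
  ultimately have "emeasure \<mu> (- K) \<le> ennreal r" by (simp add: SUP_least)
  then show thesis using K that by blast
qed

text \<open>Agreement on finite intersections extends to the generated \<sigma>-algebra by Dynkin's
  argument. A closed set meets a compact set in a compact set, and by tightness little mass is lost;
  the closed sets form a generator stable under intersection.\<close>

lemma souslin_space_measure_eqI:
  fixes \<mu> \<nu> :: "'a::t2_space measure"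
  assumes souslin: "souslin_space (euclidean :: 'a topology)"
    and fin: "finite_measure \<mu>" "finite_measure \<nu>" and sets: "sets \<mu> = sets borel" "sets \<nu> = sets borel"
    and \<U>: "countable \<U>" "\<And>U. U \<in> \<U> \<Longrightarrow> open U" "\<And>x y. x \<noteq> y \<Longrightarrow> \<exists>U\<in>\<U>. x \<in> U \<and> y \<notin> U"
    and eq: "\<And>F. finite F \<Longrightarrow> F \<subseteq> \<U> \<Longrightarrow> emeasure \<mu> (\<Inter>F) = emeasure \<nu> (\<Inter>F)"
  shows "\<mu> = \<nu>"
proof -
  define E where "E = {\<Inter>F | F. finite F \<and> F \<subseteq> \<U>}"
  have E_borel: "E \<subseteq> sets borel"
    using \<U>(2) by (auto simp: E_def intro!: borel_open open_Inter)
  have Int: "Int_stable E"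
  proof (rule Int_stableI)
    fix A B assume "A \<in> E" "B \<in> E"
    then obtain F G where "finite F" "F \<subseteq> \<U>" "A = \<Inter>F" "finite G" "G \<subseteq> \<U>" "B = \<Inter>G"
      by (auto simp: E_def)
    then show "A \<inter> B \<in> E" unfolding E_def by (intro CollectI exI[of _ "F \<union> G"]) auto
  qed
  have space: "space \<mu> = UNIV" "space \<nu> = UNIV" using sets
      by (metis sets_eq_imp_space_eq space_borel)+
  have sub: "sigma_sets UNIV E \<subseteq> sets borel"
    using E_borel sigma_sets_le_sets_iff[of borel E] by simp
  have subset_Pow: "E \<subseteq> Pow UNIV" by simp
  have eq_sigma: "emeasure \<mu> A = emeasure \<nu> A" if "A \<in> sigma_sets UNIV E" for A
    using Int subset_Pow that
  proof (induction rule: sigma_sets_induct_disjoint)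
    case (basic A)
    then show ?case using eq by (auto simp: E_def)
  next
    case (compl A)
    \<comment> \<open>The empty family has intersection \<open>UNIV\<close>, so the total masses
      agree.\<close>
    have "emeasure \<mu> UNIV = emeasure \<nu> UNIV" using eq[of "{}"] by simp
    then show ?case
      using compl sub sets emeasure_compl[of A \<mu>] emeasure_compl[of A \<nu>] fin
      by (auto simp: space subset_iff finite_measure.emeasure_finite)
  next
    case (union A)
    then have "range A \<subseteq> sets \<mu>" "range A \<subseteq> sets \<nu>" using sub sets by auto
    then show ?case using union suminf_emeasure[of A \<mu>] suminf_emeasure[of A \<nu>] by simp
  qed simp
  have eq_compact: "emeasure \<mu> K = emeasure \<nu> K" if "compact K" for K
  proof (rule eq_sigma)
    interpret sigma_algebra UNIV "sigma_sets UNIV E" by (rule sigma_algebra_sigma_sets) simp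
    define C where "C = {F. finite F \<and> F \<subseteq> \<U> \<and> K \<subseteq> \<Union>F}"
    have U: "U \<in> sigma_sets UNIV E" if "U \<in> \<U>" for U
      using that by (intro sigma_sets.Basic) (auto simp: E_def intro!: exI[of _ "{U}"])
    have "\<Union>F \<in> sigma_sets UNIV E" if "F \<in> C" for F
      using that U by (intro finite_Union) (auto simp: C_def)
    moreover have "countable C"
      unfolding C_def using countable_Collect_finite_subset[OF \<U>(1)]
          by (rule countable_subset[rotated]) auto
    moreover have "K = (\<Inter>F\<in>C. \<Union>F)"
      using compact_eq_Inter_finite_Unions[OF that \<U>(2,3)] unfolding C_def by blast
    ultimately show "K \<in> sigma_sets UNIV E"
      by (cases "C = {}") (auto intro!: countable_INT')
  qed
  \<comment> \<open>Stated for arbitrary measures, since the inequality is used in both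
    directions.\<close>
  have le: "emeasure \<mu>' Z \<le> emeasure \<nu>' Z"
    if m: "finite_measure \<mu>'" "sets \<mu>' = sets borel" "sets \<nu>' = sets borel" "closed Z"
      "\<And>K. compact K \<Longrightarrow> emeasure \<mu>' K = emeasure \<nu>' K" for \<mu>' \<nu>' :: "'a measure" and Z
  proof (rule ennreal_le_epsilon)
    fix r :: real assume "0 < r"
    then obtain K where K: "compact K" "emeasure \<mu>' (- K) \<le> ennreal r"
      using souslin_space_tight[OF souslin m(1,2)] by blast
    have borel: "Z \<in> sets borel" "K \<in> sets borel" using m K
        by (auto intro: borel_closed compact_imp_closed)
    have "emeasure \<mu>' Z \<le> emeasure \<mu>' ((Z \<inter> K) \<union> (- K))"
      using borel m(2) by (intro emeasure_mono) auto
    also have "\<dots> \<le> emeasure \<mu>' (Z \<inter> K) + emeasure \<mu>' (- K)"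
      using borel m(2) by (intro emeasure_subadditive) auto
    also have "emeasure \<mu>' (Z \<inter> K) = emeasure \<nu>' (Z \<inter> K)"
      using K(1) m(4) by (intro m(5)) (metis Int_commute compact_Int_closed)
    also have "\<dots> \<le> emeasure \<nu>' Z" using borel m(3) by (intro emeasure_mono) auto
    finally show "emeasure \<mu>' Z \<le> emeasure \<nu>' Z + ennreal r"
      using K(2) by (meson add_mono order_trans order_refl)
  qed
  show ?thesis
  proof (rule measure_eqI_generator_eq)
    show "Int_stable {Z :: 'a set. closed Z}" by (auto intro!: Int_stableI)
    show "emeasure \<mu> Z = emeasure \<nu> Z" if "Z \<in> {Z. closed Z}" for Z
      using le[OF fin(1) sets] le[OF fin(2) sets(2,1)] eq_compact that by (intro antisym) auto
    show "sets \<mu> = sigma_sets UNIV {Z :: 'a set. closed Z}" "sets \<nu> = sigma_sets UNIV {Z :: 'a set. closed Z}"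
      using sets by (simp_all add: borel_eq_closed)
    show "emeasure \<mu> ((\<lambda>_. UNIV) (i::nat)) \<noteq> \<infinity>" for i
      using finite_measure.emeasure_finite[OF fin(1)] by simp
  qed auto
qed

text \<open>The set \<open>A\<close> belongs only to the completion, so its preimage under
  \<open>Y\<close> need not be measurable. The main part of its complement is in
  \<open>sets G\<close>, carries the whole measure of the complement, and has a negligible
  preimage.\<close>

lemma AE_completion_distrI:
  assumes Y: "Y \<in> measurable P G" and A: "A \<in> sets (completion (distr P G Y))"
    and ae: "AE \<omega> in P. Y \<omega> \<in> A"
  shows "emeasure (completion (distr P G Y)) (space G - A) = 0"
proof -
  let ?N = "distr P G Y" and ?B = "space G - A"
  have B: "?B \<in> sets (completion ?N)"
    using sets.compl_sets[OF A] by simp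
  have mp: "main_part ?N ?B \<in> sets G" "main_part ?N ?B \<subseteq> ?B"
    using main_part_sets[OF B] main_part_null_part_Un[OF B] by auto
  have "emeasure ?N (main_part ?N ?B) = emeasure P (Y -` main_part ?N ?B \<inter> space P)"
    using Y mp by (intro emeasure_distr) auto
  also have "\<dots> = 0"
  proof (rule AE_iff_measurable[THEN iffD1])
    show "Y -` main_part ?N ?B \<inter> space P \<in> sets P" using Y mp by (auto intro: measurable_sets)
    show "{x \<in> space P. \<not> Y x \<notin> main_part ?N ?B} = Y -` main_part ?N ?B \<inter> space P" by auto
    show "AE x in P. Y x \<notin> main_part ?N ?B" using ae by eventually_elim (use mp in auto)
  qed
  finally show ?thesis using emeasure_completion[OF B] by simp
qed

theorem souslin_solution_essentially_unique:
  fixes X :: "'w \<Rightarrow> 'f::t2_space"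
  assumes souslin: "souslin_space (euclidean :: 'f topology)"
    and P: "prob_space P" and Y: "Y \<in> measurable P G"
  shows "solution_essentially_unique P borel X G Y"
  unfolding solution_essentially_unique_def
proof (intro allI impI)
  fix \<mu> \<nu> assume \<mu>: "inverse_problem_solution P borel X G Y \<mu>" and \<nu>: "inverse_problem_solution P borel X G Y \<nu>"
  interpret prob_space P by fact
  let ?N = "completion (distr P G Y)"
  obtain \<U> :: "'f set set" where \<U>: "countable \<U>" "\<And>U. U \<in> \<U> \<Longrightarrow> open U"
    "\<And>x y. x \<noteq> y \<Longrightarrow> \<exists>U\<in>\<U>. x \<in> U \<and> y \<notin> U"
    using souslin_space_separating_family[OF souslin] by blast
  define E where "E = {F. finite F \<and> F \<subseteq> \<U>}"
  define A where "A F = {y \<in> space G. measure (\<mu> y) (\<Inter>F) = measure (\<nu> y) (\<Inter>F)}" for F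
  have E: "countable E" "E \<noteq> {}" "\<And>F. F \<in> E \<Longrightarrow> \<Inter>F \<in> sets borel"
    using countable_Collect_finite_subset[OF \<U>(1)] \<U>(2)
    by (auto simp: E_def intro!: borel_open open_Inter)
  have A_sets: "A F \<in> sets ?N" if "F \<in> E" for F
  proof -
    have [measurable]: "(\<lambda>y. measure (\<mu> y) (\<Inter>F)) \<in> borel_measurable ?N"
      "(\<lambda>y. measure (\<nu> y) (\<Inter>F)) \<in> borel_measurable ?N"
      using \<mu> \<nu> E(3)[OF that] unfolding inverse_problem_solution_def by blast+
    have "{y \<in> space ?N. measure (\<mu> y) (\<Inter>F) = measure (\<nu> y) (\<Inter>F)} \<in> sets ?N" by measurable
    then show ?thesis by (simp add: A_def)
  qed
  have null: "emeasure ?N (space G - A F) = 0" if "F \<in> E" for F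
  proof (rule AE_completion_distrI[OF Y A_sets[OF that]])
    have "AE \<omega> in P. measure (\<mu> (Y \<omega>)) (\<Inter>F) =
        real_cond_exp P (vimage_algebra (space P) Y G) (\<lambda>\<omega>'. indicator (\<Inter>F) (X \<omega>')) \<omega>"
      "AE \<omega> in P. measure (\<nu> (Y \<omega>)) (\<Inter>F) =
        real_cond_exp P (vimage_algebra (space P) Y G) (\<lambda>\<omega>'. indicator (\<Inter>F) (X \<omega>')) \<omega>"
      using \<mu> \<nu> E(3)[OF that] unfolding inverse_problem_solution_def by blast+
    moreover have "AE \<omega> in P. Y \<omega> \<in> space G" using measurable_space[OF Y] by simp
    ultimately show "AE \<omega> in P. Y \<omega> \<in> A F" by eventually_elim (simp add: A_def)
  qed
  \<comment> \<open>A single set that serves all \<open>F\<close> in the countable family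
    \<open>E\<close>. The empty family belongs to \<open>E\<close>, so the intersection is not over
    an empty index set and stays inside \<open>space G\<close>.\<close>
  define C where "C = (\<Inter>F\<in>E. A F)"
  have C: "C \<in> sets ?N" unfolding C_def using E(1,2) A_sets by (intro sets.countable_INT') auto
  have "C \<subseteq> space G" using E(2) by (auto simp: C_def A_def)
  have "(\<Union>F\<in>E. space G - A F) \<in> null_sets ?N"
    using null sets.compl_sets[OF A_sets] E(1) by (intro null_sets_UN') (auto simp: null_sets_def)
  then have "emeasure ?N (space G - C) = 0"
    by (simp add: C_def null_setsD1)
  moreover have "emeasure ?N (space G) = 1"
    using prob_space.emeasure_space_1[OF prob_space_distr[OF Y]] by simp
  ultimately have "emeasure ?N C = 1"
    using emeasure_Diff_null_set[of "space G - C" ?N "space G"] C \<open>C \<subseteq> space G\<close> sets.top[of ?N]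
    sets.compl_sets[OF C]
    by (auto simp: null_sets_def double_diff)
  moreover have "measure (\<mu> y) U = measure (\<nu> y) U" if y: "y \<in> C" and "U \<in> sets borel" for y U
  proof -
    have "y \<in> space G" using y \<open>C \<subseteq> space G\<close> by blast
    then have prob: "prob_space (\<mu> y)" "prob_space (\<nu> y)" and
      sets: "sets (\<mu> y) = sets borel" "sets (\<nu> y) = sets borel"
      using \<mu> \<nu> unfolding inverse_problem_solution_def by blast+
    interpret M: prob_space "\<mu> y" by fact
    interpret N: prob_space "\<nu> y" by fact
    have "\<mu> y = \<nu> y"
    proof (rule souslin_space_measure_eqI[OF souslin _ _ sets \<U>])
      fix F assume "finite F" "F \<subseteq> \<U>"
      then have "y \<in> A F" using y by (auto simp: C_def E_def)
      then show "emeasure (\<mu> y) (\<Inter>F) = emeasure (\<nu> y) (\<Inter>F)"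
        by (simp add: A_def M.emeasure_eq_measure N.emeasure_eq_measure)
    qed unfold_locales
    then show ?thesis by simp
  qed
  ultimately show "\<exists>C\<in>sets ?N. emeasure ?N C = 1 \<and> (\<forall>U\<in>sets borel. \<forall>y\<in>C. measure (\<mu> y) U = measure (\<nu> y) U)"
    using C by blast
qed

section \<open>The posterior distribution for Laplace noise\<close>

text \<open>The integrals are taken in the extended nonnegative reals, where they exist for every
  \<open>y\<close>; a real-valued integral would be 0 when the denominator is infinite. That the
  \<open>e k\<close> are the coefficients of the noise is derived from the convergence of the
  series, the coefficient functionals being continuous.\<close>

theorem theorem5p9:
  fixes P :: "'w measure"
    and X :: "'w \<Rightarrow> 'f::{real_vector, t2_space}"
    and L :: "'f \<Rightarrow> real \<Rightarrow> complex"
    and \<epsilon> Y :: "'w \<Rightarrow> (real \<Rightarrow> complex) \<Rightarrow> complex"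
    and e :: "int \<Rightarrow> 'w \<Rightarrow> real"
    and \<alpha> b :: real
    and w :: "((real \<Rightarrow> complex) \<Rightarrow> complex) \<Rightarrow> 'f \<Rightarrow> real"
  assumes F_lctvs: "locally_convex_tvs TYPE('f)"
    and F_souslin: "souslin_space (euclidean :: 'f topology)"
    and P_prob: "prob_space P"
    and P_complete: "complete_measure P"
    and X_rv: "X \<in> measurable P borel"
    and alpha: "\<alpha> > 1"
    and L_cont: "continuous_map euclidean (holder_topology \<alpha>) L"
    and L_real_coeffs: "AE \<omega> in P. \<forall>k. fourier_coeff (L (X \<omega>)) k \<in> \<real>"
    and b_pos: "b > 0"
    and eps_rv: "\<epsilon> \<in> measurable P Hm1_borel"
    and eps_series: "AE \<omega> in P. limitin Hm1_topology
           (\<lambda>n. Hm1_of_fun (\<lambda>t. \<Sum>k\<in>{- int n..int n}. complex_of_real (e k \<omega>) * cis (of_int k * t)))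
           (\<epsilon> \<omega>) sequentially"
    and eps_X_indep: "prob_space.indep_set P
           (sets (vimage_algebra (space P) X borel))
           (sets (vimage_algebra (space P) \<epsilon> Hm1_borel))"
    and e_indep: "prob_space.indep_vars P (\<lambda>_. borel) e UNIV"
    and e_density: "\<And>k. distributed P lborel (e k) (\<lambda>t. ennreal (1 / (2 * b) * exp (- \<bar>t\<bar> / b)))"
    and Y_def: "Y = (\<lambda>\<omega>. Hm1_add (Hm1_of_fun (L (X \<omega>))) (\<epsilon> \<omega>))"
    and w_def: "w = (\<lambda>y x. exp (1 / b *
           (\<Sum>\<^sub>\<infinity>k. cmod (Hm1_coeff y k) - cmod (Hm1_coeff y k - fourier_coeff (L x) k))))"
  shows "solution_essentially_unique P borel X Hm1_borel Y \<and>
    (\<exists>\<mu>. inverse_problem_solution P borel X Hm1_borel Y \<mu> \<and>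
      (\<forall>U\<in>sets borel. \<forall>y\<in>Hm1.
         (\<integral>\<^sup>+x. ennreal (w y x) \<partial>distr P borel X) \<noteq> \<infinity> \<longrightarrow>
         (\<integral>\<^sup>+x. ennreal (w y x) \<partial>distr P borel X) \<noteq> 0 \<longrightarrow>
         emeasure (\<mu> y) U =
           (\<integral>\<^sup>+x\<in>U. ennreal (w y x) \<partial>distr P borel X) /
           (\<integral>\<^sup>+x. ennreal (w y x) \<partial>distr P borel X)))"
proof -
  interpret prob_space P by (rule P_prob)
  let ?\<mu>X = "distr P borel X" and ?c = "\<lambda>x. fourier_coeff (L x)"
  define \<nu> where "\<nu> = distr P Hm1_borel \<epsilon>"
  note [measurable] = X_rv eps_rv
  interpret MX: prob_space ?\<mu>X by (rule prob_space_distr) measurable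
  interpret NU: prob_space \<nu> unfolding \<nu>_def by (rule prob_space_distr) measurable
  interpret pair_sigma_finite ?\<mu>X \<nu> ..

  \<comment> \<open>Coefficients of the translates and measurability of \<open>Y\<close>\<close>
  have L: "L x \<in> holder_space \<alpha>" for x
    using continuous_map_image_subset_topspace[OF L_cont] by (auto simp: topspace_holder_topology)
  have C1: "C1_circle (L x) (vderiv 1 (L x))" for x by (rule holder_space_C1[OF L alpha])
  have Lx: "Hm1_of_fun (L x) \<in> Hm1" for x by (rule C1_circle.Hm1_of_fun_in[OF C1])
  have [measurable]: "(\<lambda>x. ?c x k) \<in> borel_measurable borel" for k
  proof -
    have "continuous_map euclidean euclidean (\<lambda>x. ?c x k)"
      using continuous_map_compose[OF L_cont continuous_map_fourier_coeff] by (simp add: o_def)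
    then show ?thesis by (intro borel_measurable_continuous_onI) (simp add: continuous_map_iff_continuous2)
  qed
  have Y_coeff: "Hm1_coeff (Hm1_add (Hm1_of_fun (L x)) y) k = ?c x k + Hm1_coeff y k" for x y k
    by (simp add: Hm1_coeff_add Hm1_coeff_of_fun)
  \<comment> \<open>Measurability with respect to the product \<sigma>-algebra is reduced to
    coefficients, which simply add up.\<close>
  have translate[measurable]: "(\<lambda>(x, y). Hm1_add (Hm1_of_fun (L x)) y) \<in> measurable (borel \<Otimes>\<^sub>M Hm1_borel) Hm1_borel"
  proof (rule measurable_Hm1I)
    fix p assume "p \<in> space (borel \<Otimes>\<^sub>M Hm1_borel :: ('f \<times> _) measure)"
    then show "(case p of (x, y) \<Rightarrow> Hm1_add (Hm1_of_fun (L x)) y) \<in> Hm1"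
      using Hm1_add_in[OF Lx] by (auto simp: space_pair_measure space_Hm1_borel)
  next
    fix k
    have "(\<lambda>p. ?c (fst p) k + Hm1_coeff (snd p) k) \<in> borel_measurable (borel \<Otimes>\<^sub>M Hm1_borel)"
        by measurable
    then show "(\<lambda>p. Hm1_coeff (case p of (x, y) \<Rightarrow> Hm1_add (Hm1_of_fun (L x)) y) k) \<in> borel_measurable (borel \<Otimes>\<^sub>M Hm1_borel)"
      by (simp add: split_beta' Y_coeff)
  qed
  have Y_rv[measurable]: "Y \<in> measurable P Hm1_borel"
    using measurable_compose[OF measurable_Pair[OF X_rv eps_rv] translate] by (simp add: Y_def)

  \<comment> \<open>Joint measurability of the density\<close>
  have w_meas: "(\<lambda>(y, x). ennreal (w y x)) \<in> borel_measurable (Hm1_borel \<Otimes>\<^sub>M borel)"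
  proof -
    let ?t = "\<lambda>p k. cmod (Hm1_coeff (fst p) k) - cmod (Hm1_coeff (fst p) k - ?c (snd p) k)"
    \<comment> \<open>Each term is at most the modulus of a coefficient of \<open>L x\<close>, so
      the sum converges for every \<open>y\<close>, even one with non-real coefficients.\<close>
    have "(\<lambda>n. \<Sum>k\<in>{- int n..int n}. ?t p k) \<longlonglongrightarrow> (\<Sum>\<^sub>\<infinity>k. ?t p k)" for p
    proof (rule infsum_symmetric_LIMSEQ, rule abs_summable_summable, rule summable_on_comparison_test)
      show "(\<lambda>k. cmod (?c (snd p) k)) summable_on UNIV"
          by (rule C1_circle.fourier_coeff_summable[OF C1])
      show "norm (?t p k) \<le> cmod (?c (snd p) k)" for k
        using norm_triangle_ineq3[of "Hm1_coeff (fst p) k" "Hm1_coeff (fst p) k - ?c (snd p) k"]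
            by simp
    qed simp
    then have [measurable]: "(\<lambda>p. \<Sum>\<^sub>\<infinity>k. ?t p k) \<in> borel_measurable (Hm1_borel \<Otimes>\<^sub>M borel)"
      by (rule borel_measurable_LIMSEQ_real) measurable
    show ?thesis unfolding w_def split_beta' by measurable
  qed
  have w_meas': "(\<lambda>(x, y). ennreal (w y x)) \<in> borel_measurable (borel \<Otimes>\<^sub>M Hm1_borel)"
    using measurable_compose[OF measurable_pair_swap' w_meas] by (simp add: split_beta')
  have w1: "(\<lambda>y. ennreal (w y x)) \<in> borel_measurable Hm1_borel" for x
    using measurable_compose[OF measurable_Pair1'[of x borel Hm1_borel] w_meas'] by simp

  \<comment> \<open>The coefficients of the noise\<close>
  have eps_coeff: "AE \<omega> in P. \<forall>k. Hm1_coeff (\<epsilon> \<omega>) k = of_real (e k \<omega>)"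
    using eps_series
  proof eventually_elim
    case (elim \<omega>)
    show ?case
    proof
      fix k
      let ?s = "\<lambda>n. Hm1_of_fun (\<lambda>t. \<Sum>k\<in>{- int n..int n}. complex_of_real (e k \<omega>) * cis (of_int k * t))"
      have "((\<lambda>y. Hm1_coeff y k) \<circ> ?s) \<longlonglongrightarrow> Hm1_coeff (\<epsilon> \<omega>) k"
        using continuous_map_limit[OF continuous_map_Hm1_coeff elim] by simp
      moreover have "\<forall>\<^sub>F n in sequentially. ((\<lambda>y. Hm1_coeff y k) \<circ> ?s) n = of_real (e k \<omega>)"
        unfolding eventually_sequentially
      proof (intro exI allI impI)
        fix n assume "nat \<bar>k\<bar> \<le> n"
        then have "k \<in> {- int n..int n}" by auto
        then show "((\<lambda>y. Hm1_coeff y k) \<circ> ?s) n = of_real (e k \<omega>)"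
          by (simp add: Hm1_coeff_of_fun fourier_coeff_trig_poly)
      qed
      then have "((\<lambda>y. Hm1_coeff y k) \<circ> ?s) \<longlonglongrightarrow> of_real (e k \<omega>)" by (rule tendsto_eventually)
      ultimately show "Hm1_coeff (\<epsilon> \<omega>) k = of_real (e k \<omega>)" by (rule LIMSEQ_unique)
    qed
  qed

  \<comment> \<open>The law of the noise shifted by \<open>L x\<close>\<close>
  have translation: "(\<integral>\<^sup>+y. indicator A (Hm1_add (Hm1_of_fun (L x)) y) \<partial>\<nu>) = (\<integral>\<^sup>+y\<in>A. ennreal (w y x) \<partial>\<nu>)"
    if A[measurable]: "A \<in> sets Hm1_borel" and real: "\<forall>k. ?c x k \<in> \<real>" for A x
  proof -
    obtain A' where A': "A' \<in> sets (PiM UNIV (\<lambda>_::int. borel :: complex measure))" "A =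
        {y \<in> Hm1. Hm1_coeff y \<in> A'}"
      using sets_Hm1_borel_coeff[OF A] .
    let ?N = "PiM UNIV (\<lambda>_::int. borel :: real measure)"
    \<comment> \<open>\<open>A'\<close> consists of complex sequences, whereas the noise and its
      shift yield real ones; \<open>A''\<close> is the trace of \<open>A'\<close> on these.\<close>
    define A'' where "A'' = {a \<in> space ?N. (\<lambda>k. complex_of_real (a k)) \<in> A'}"
    have "(\<lambda>a k. complex_of_real (a k)) \<in> measurable ?N (PiM UNIV (\<lambda>_::int. borel :: complex measure))"
      by (rule measurable_PiM_single'; measurable)
    then have "(\<lambda>a k. complex_of_real (a k)) -` A' \<inter> space ?N \<in> sets ?N" using A'(1)
        by (rule measurable_sets)
    then have A'': "A'' \<in> sets ?N" by (simp add: A''_def vimage_def Int_def conj_commute)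
    define c where "c k = Re (?c x k)" for k
    have c: "?c x k = of_real (c k)" for k using real
        by (simp add: c_def complex_is_Real_iff complex_eq_iff)
    have A_iff: "y \<in> A \<longleftrightarrow> a \<in> A''" if "y \<in> Hm1" "\<And>k. Hm1_coeff y k = of_real (a k)" for y a
    proof -
      have "Hm1_coeff y = (\<lambda>k. of_real (a k))" using that(2) by blast
      then show ?thesis using that(1) by (simp add: A'(2) A''_def space_PiM)
    qed
    have eps_in: "\<epsilon> \<omega> \<in> Hm1" if "\<omega> \<in> space P" for \<omega>
      using measurable_space[OF eps_rv that] by (simp add: space_Hm1_borel)
    have [measurable]: "(\<lambda>y. Hm1_add (Hm1_of_fun (L x)) y) \<in> measurable Hm1_borel Hm1_borel"
      using measurable_compose[OF measurable_Pair1'[of x borel Hm1_borel] translate] by simp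
    note [measurable] = w1[of x]
    have e_meas[measurable]: "e k \<in> borel_measurable P" for k
      using distributed_measurable[OF e_density[of k]] by simp
    have ce: "(\<lambda>\<omega> k. c k + e k \<omega>) \<in> measurable P ?N" by (rule measurable_PiM_single'; auto)
    have "(\<integral>\<^sup>+y. indicator A (Hm1_add (Hm1_of_fun (L x)) y) \<partial>\<nu>) =
        (\<integral>\<^sup>+\<omega>. indicator A (Hm1_add (Hm1_of_fun (L x)) (\<epsilon> \<omega>)) \<partial>P)"
      unfolding \<nu>_def by (rule nn_integral_distr) measurable
    also have "\<dots> = (\<integral>\<^sup>+\<omega>. indicator {\<omega> \<in> space P. (\<lambda>k. c k + e k \<omega>) \<in> A''} \<omega> \<partial>P)"
    proof (rule nn_integral_cong_AE)
      show "AE \<omega> in P. indicator A (Hm1_add (Hm1_of_fun (L x)) (\<epsilon> \<omega>)) =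
          (indicator {\<omega> \<in> space P. (\<lambda>k. c k + e k \<omega>) \<in> A''} \<omega> :: ennreal)"
        using eps_coeff AE_space
      proof eventually_elim
        case (elim \<omega>)
        have "Hm1_add (Hm1_of_fun (L x)) (\<epsilon> \<omega>) \<in> A \<longleftrightarrow> (\<lambda>k. c k + e k \<omega>) \<in> A''"
          by (rule A_iff) (use elim eps_in Hm1_add_in[OF Lx] in \<open>auto simp: Y_coeff c\<close>)
        then show ?case using elim by (simp split: split_indicator)
      qed
    qed
    also have "\<dots> = emeasure P {\<omega> \<in> space P. (\<lambda>k. c k + e k \<omega>) \<in> A''}"
    proof (rule nn_integral_indicator)
      have "{\<omega> \<in> space P. (\<lambda>k. c k + e k \<omega>) \<in> A''} = (\<lambda>\<omega> k. c k + e k \<omega>) -` A'' \<inter> space P" by auto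
      then show "{\<omega> \<in> space P. (\<lambda>k. c k + e k \<omega>) \<in> A''} \<in> sets P"
        using measurable_sets[OF ce A''] by simp
    qed
    also have "\<dots> = (\<integral>\<^sup>+\<omega>. indicator A'' (\<lambda>k. e k \<omega>) * ennreal (exp (1 / b * (\<Sum>\<^sub>\<infinity>k. \<bar>e k \<omega>\<bar> -
        \<bar>e k \<omega> - c k\<bar>))) \<partial>P)"
      using C1_circle.fourier_coeff_summable[OF C1, of x]
      by (intro laplace_translation_density b_pos e_indep e_density A'') (simp add: c)
    also have "\<dots> = (\<integral>\<^sup>+\<omega>. ennreal (w (\<epsilon> \<omega>) x) * indicator A (\<epsilon> \<omega>) \<partial>P)"
    proof (rule nn_integral_cong_AE)
      show "AE \<omega> in P. indicator A'' (\<lambda>k. e k \<omega>) * ennreal (exp (1 / b * (\<Sum>\<^sub>\<infinity>k. \<bar>e k \<omega>\<bar> - \<bar>e k \<omega> - c k\<bar>))) =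
          ennreal (w (\<epsilon> \<omega>) x) * indicator A (\<epsilon> \<omega>)"
        using eps_coeff AE_space
      proof eventually_elim
        case (elim \<omega>)
        have "\<epsilon> \<omega> \<in> A \<longleftrightarrow> (\<lambda>k. e k \<omega>) \<in> A''" by (rule A_iff) (use elim eps_in in auto)
        moreover have "w (\<epsilon> \<omega>) x = exp (1 / b * (\<Sum>\<^sub>\<infinity>k. \<bar>e k \<omega>\<bar> - \<bar>e k \<omega> - c k\<bar>))"
        proof -
          have "cmod (of_real (e k \<omega>) - of_real (c k)) = \<bar>e k \<omega> - c k\<bar>" for k
            by (metis norm_of_real of_real_diff real_norm_def)
          then show ?thesis using elim by (simp add: w_def c)
        qed
        ultimately show ?case by (simp add: mult.commute split: split_indicator)
      qed
    qed
    also have "\<dots> = (\<integral>\<^sup>+y\<in>A. ennreal (w y x) \<partial>\<nu>)"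
      unfolding \<nu>_def by (rule nn_integral_distr[symmetric]) measurable
    finally show ?thesis .
  qed

  \<comment> \<open>The joint law of \<open>X\<close> and \<open>Y\<close>\<close>
  have real_coeffs: "AE x in ?\<mu>X. \<forall>k. ?c x k \<in> \<real>"
    unfolding complex_is_Real_iff
    by (subst AE_distr_iff) (use L_real_coeffs in \<open>auto simp: complex_is_Real_iff\<close>)

  have product: "?\<mu>X \<Otimes>\<^sub>M \<nu> = distr P (borel \<Otimes>\<^sub>M Hm1_borel) (\<lambda>\<omega>. (X \<omega>, \<epsilon> \<omega>))"
  proof (rule pair_measure_eqI)
    show "sigma_finite_measure ?\<mu>X" "sigma_finite_measure \<nu>" by unfold_locales
    show "sets (?\<mu>X \<Otimes>\<^sub>M \<nu>) = sets (distr P (borel \<Otimes>\<^sub>M Hm1_borel) (\<lambda>\<omega>. (X \<omega>, \<epsilon> \<omega>)))"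
      by (simp add: \<nu>_def cong: sets_pair_measure_cong)
    fix U A assume "U \<in> sets ?\<mu>X" "A \<in> sets \<nu>"
    then have [measurable]: "U \<in> sets borel" "A \<in> sets Hm1_borel" by (simp_all add: \<nu>_def)
    have "X -` U \<inter> space P \<in> sets (vimage_algebra (space P) X borel)"
      "\<epsilon> -` A \<inter> space P \<in> sets (vimage_algebra (space P) \<epsilon> Hm1_borel)"
      by (auto intro: in_vimage_algebra)
    then have "prob ((X -` U \<inter> space P) \<inter> (\<epsilon> -` A \<inter> space P)) =
        prob (X -` U \<inter> space P) * prob (\<epsilon> -` A \<inter> space P)"
      by (rule indep_setD[OF eps_X_indep])
    moreover have "(\<lambda>\<omega>. (X \<omega>, \<epsilon> \<omega>)) -` (U \<times> A) \<inter> space P = (X -` U \<inter> space P) \<inter> (\<epsilon> -` A \<inter> space P)"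
      by auto
    ultimately show "emeasure ?\<mu>X U * emeasure \<nu> A =
        emeasure (distr P (borel \<Otimes>\<^sub>M Hm1_borel) (\<lambda>\<omega>. (X \<omega>, \<epsilon> \<omega>))) (U \<times> A)"
      by (simp add: \<nu>_def emeasure_distr emeasure_eq_measure ennreal_mult)
  qed

  have joint: "emeasure P {\<omega> \<in> space P. Y \<omega> \<in> A \<and> X \<omega> \<in> U} = (\<integral>\<^sup>+y\<in>A. (\<integral>\<^sup>+x\<in>U. ennreal (w y x) \<partial>?\<mu>X) \<partial>\<nu>)"
    if A[measurable]: "A \<in> sets Hm1_borel" and U[measurable]: "U \<in> sets borel" for A U
  proof -
    let ?f = "\<lambda>(x, y). indicator U x * indicator A (Hm1_add (Hm1_of_fun (L x)) y) :: ennreal"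
    have f: "?f \<in> borel_measurable (borel \<Otimes>\<^sub>M Hm1_borel)"
    proof -
      have "(\<lambda>p. indicator A (case p of (x, y) \<Rightarrow> Hm1_add (Hm1_of_fun (L x)) y) :: ennreal) \<in> borel_measurable (borel \<Otimes>\<^sub>M Hm1_borel)"
        by measurable
      moreover have "(\<lambda>p. indicator U (fst p) :: ennreal) \<in> borel_measurable (borel \<Otimes>\<^sub>M Hm1_borel)"
          by measurable
      ultimately show ?thesis unfolding split_beta'
          by (rule borel_measurable_times_ennreal[rotated])
    qed
    have sets_prod: "sets (?\<mu>X \<Otimes>\<^sub>M \<nu>) = sets (borel \<Otimes>\<^sub>M Hm1_borel)"
        by (simp add: \<nu>_def cong: sets_pair_measure_cong)
    have meas_eq: "borel_measurable (?\<mu>X \<Otimes>\<^sub>M \<nu>) =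
        (borel_measurable (borel \<Otimes>\<^sub>M Hm1_borel) :: (_ \<Rightarrow> ennreal) set)"
      by (rule measurable_cong_sets[OF sets_prod refl])
    have "emeasure P {\<omega> \<in> space P. Y \<omega> \<in> A \<and> X \<omega> \<in> U} =
        (\<integral>\<^sup>+\<omega>. indicator {\<omega> \<in> space P. Y \<omega> \<in> A \<and> X \<omega> \<in> U} \<omega> \<partial>P)"
      by (rule nn_integral_indicator[symmetric]) measurable
    also have "\<dots> = (\<integral>\<^sup>+\<omega>. ?f (X \<omega>, \<epsilon> \<omega>) \<partial>P)"
      by (rule nn_integral_cong) (simp add: Y_def split: split_indicator)
    also have "\<dots> = (\<integral>\<^sup>+p. ?f p \<partial>(?\<mu>X \<Otimes>\<^sub>M \<nu>))"
      unfolding product by (rule nn_integral_distr[symmetric]) (use f in measurable)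
    also have "\<dots> = (\<integral>\<^sup>+x. \<integral>\<^sup>+y. ?f (x, y) \<partial>\<nu> \<partial>?\<mu>X)"
      by (rule NU.nn_integral_fst[symmetric]) (unfold meas_eq, rule f)
    also have "\<dots> = (\<integral>\<^sup>+x. \<integral>\<^sup>+y. ennreal (w y x) * indicator U x * indicator A y \<partial>\<nu> \<partial>?\<mu>X)"
    \<comment> \<open>The translation formula needs real coefficients of \<open>L x\<close>, which
      are available for almost every \<open>x\<close> under the law of \<open>X\<close>.\<close>
    proof (rule nn_integral_cong_AE)
      show "AE x in ?\<mu>X. (\<integral>\<^sup>+y. ?f (x, y) \<partial>\<nu>) = (\<integral>\<^sup>+y. ennreal (w y x) * indicator U x * indicator A y \<partial>\<nu>)"
        using real_coeffs
      proof eventually_elim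
        case (elim x)
        show ?case
          using translation[OF A elim] by (cases "x \<in> U") auto
      qed
    qed
    also have "\<dots> = (\<integral>\<^sup>+y. \<integral>\<^sup>+x. ennreal (w y x) * indicator U x * indicator A y \<partial>?\<mu>X \<partial>\<nu>)"
    proof (rule Fubini'[symmetric])
      have "(\<lambda>p. (case p of (x, y) \<Rightarrow> ennreal (w y x)) * indicator U (fst p) *
          indicator A (snd p)) \<in> borel_measurable (borel \<Otimes>\<^sub>M Hm1_borel)"
        by (intro borel_measurable_times_ennreal w_meas') measurable
      then show "(\<lambda>(x, y). ennreal (w y x) * indicator U x * indicator A y) \<in> borel_measurable (?\<mu>X \<Otimes>\<^sub>M \<nu>)"
        unfolding meas_eq by (simp add: split_beta')
    qed
    also have "\<dots> = (\<integral>\<^sup>+y\<in>A. (\<integral>\<^sup>+x\<in>U. ennreal (w y x) \<partial>?\<mu>X) \<partial>\<nu>)"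
      by (rule nn_integral_cong) (simp split: split_indicator)
    finally show ?thesis .
  qed

  have "sets \<nu> = sets Hm1_borel" by (simp add: \<nu>_def)
  show ?thesis
  proof
    show "solution_essentially_unique P borel X Hm1_borel Y"
      by (rule souslin_solution_essentially_unique[OF F_souslin P_prob Y_rv])
  qed (rule bayes_inverse_problem_solution[OF P_prob X_rv Y_rv \<open>sets \<nu> = sets Hm1_borel\<close> w_meas joint,
        unfolded space_Hm1_borel])
qed

end
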